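(* For every LSHable similarity measure $\mathrm{sim}$ and every choice of constant threshold $\lambda\in(0,1)$ and probability of recall $\varphi\in(0,1)$, the $(\lambda,\varphi)$-set similarity (self-)join problem can be solved on every set $S$ of $n$ points using working space $\tilde O(n)$ and with expected running time $$\tilde O\left(\sum_{x\in S}\min_{k_x}\left(\sum_{y\in S\setminus\{x\}}\big(\mathrm{sim}(x,y)/\lambda\big)^{k_x}+(1/\lambda)^{k_x}\right)\right).$$
   Context: A similarity measure $\mathrm{sim}$ (with values in $[0,1]$) is LSHable if there is a distribution over hash functions $h$ with $\Pr[h(x)=h(y)]=\mathrm{sim}(x,y)$ for every pair $x,y$. An algorithm solves the $(\lambda,\varphi)$-similarity self-join problem on $S$ if it outputs a list $L\subseteq\{(x,y)\in S\times S:\mathrm{sim}(x,y)\ge\lambda\}$ such that every pair $(x,y)$ with $\mathrm{sim}(x,y)\ge\lambda$ satisfies $\Pr[(x,y)\in L]\ge\varphi$, the probability being over the algorithm's random choices. Working space excludes the space to store the input data and to write the output list. $\tilde O$ hides polylogarithmic factors in $n$. *)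

theory Defs
  imports "HOL-Probability.Probability"
begin

text \<open>
  A similarity \<open>sim\<close> is LSHable iff some \<open>M\<close> satisfies the following predicate. Nothing is assumed
  about the type \<open>'b\<close> of hash values, and only the collision events need to be measurable.
\<close>

definition lsh_distribution :: "('a \<Rightarrow> 'b) measure \<Rightarrow> ('a \<Rightarrow> 'a \<Rightarrow> real) \<Rightarrow> bool" where
  "lsh_distribution M sim \<longleftrightarrow> prob_space M \<and>
     (\<forall>x y. {h \<in> space M. h x = h y} \<in> sets M \<and>
            measure M {h \<in> space M. h x = h y} = sim x y)"


text \<open>
  The machine model is a randomized word RAM. A word is a number below \<open>W\<close>, which is later set
  to \<open>(n + 2) ^ \<kappa>\<close>, so that words have \<open>O(log n)\<close> bits. The memory is divided into named arrays
  of words, a program mentioning only finitely many names. The input points are read-only and known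
  to the program only through their indices \<open>0, \<dots>, n - 1\<close>; they are accessed through unit-cost
  evaluation of the similarity (compared with a constant) and of the current hash function.
\<close>

datatype exp =
    Const nat
  | Size
  | Arr string exp
  | Plus exp exp
  | Minus exp exp
  | Times exp exp
  | Div exp exp
  | Less exp exp

text \<open>
  Informal reading, with \<open>x\<^sub>i\<close> the \<open>i\<close>-th input point and \<open>h\<close> the current hash function:
  \<^item> \<open>Flip p a i\<close>: \<open>a[i] := 1\<close> with probability \<open>p\<close>, otherwise \<open>a[i] := 0\<close>;
  \<^item> \<open>SimGe r a i j k\<close>: \<open>a[i]\<close> receives the truth value of \<open>sim x\<^sub>j x\<^sub>k \<ge> r\<close>;
  \<^item> \<open>Draw\<close>: \<open>h\<close> becomes a fresh sample from the hash distribution, with an empty dictionary;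
  \<^item> \<open>DGet a i j\<close> and \<open>DPut j e\<close>: look up \<open>a[i] := D[h x\<^sub>j]\<close> and update \<open>D[h x\<^sub>j] := e\<close> in a dictionary
    \<open>D\<close> keyed by hash values. This is how a program groups points into buckets;
  \<^item> \<open>Emit j k\<close>: append \<open>(x\<^sub>j, x\<^sub>k)\<close> to the write-only output list.
\<close>

datatype com =
    Assign string exp exp
  | Flip real string exp
  | SimGe real string exp exp exp
  | Draw
  | DGet string exp exp
  | DPut exp exp
  | Emit exp exp
  | Seq com com
  | Cond exp com com
  | While exp com

text \<open>
  The field \<open>source\<close> holds the randomness not yet consumed: every \<open>Flip\<close> and every \<open>Draw\<close> removes one
  element, consisting of a uniform number from the unit interval and a hash function.
\<close>

record ('a, 'b) state =
  mem :: "string \<Rightarrow> nat \<Rightarrow> nat"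
  hashfn :: "'a \<Rightarrow> 'b"
  dict :: "'b \<Rightarrow> nat"
  source :: "(real \<times> ('a \<Rightarrow> 'b)) stream"
  outlist :: "('a \<times> 'a) list"

fun eval :: "nat \<Rightarrow> nat \<Rightarrow> (string \<Rightarrow> nat \<Rightarrow> nat) \<Rightarrow> exp \<Rightarrow> nat" where
  "eval W n m (Const c) = c mod W"
| "eval W n m Size = n mod W"
| "eval W n m (Arr a e) = m a (eval W n m e)"
| "eval W n m (Plus e f) = (eval W n m e + eval W n m f) mod W"
| "eval W n m (Minus e f) = eval W n m e - eval W n m f"
| "eval W n m (Times e f) = (eval W n m e * eval W n m f) mod W"
| "eval W n m (Div e f) = eval W n m e div eval W n m f"
| "eval W n m (Less e f) = of_bool (eval W n m e < eval W n m f) mod W"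

definition store :: "nat \<Rightarrow> string \<Rightarrow> nat \<Rightarrow> nat \<Rightarrow> ('a, 'b) state \<Rightarrow> ('a, 'b) state" where
  "store W a i v s = s\<lparr>mem := (mem s)(a := (mem s a)(i := v mod W))\<rparr>"

text \<open>
  One elementary step; the first component of a configuration is the stack of commands still to be
  executed. Expressions are evaluated within a step, which costs only a constant factor depending on
  the program. Instructions referring to a point index outside the input have no effect.
\<close>

fun step :: "nat \<Rightarrow> ('a \<Rightarrow> 'a \<Rightarrow> real) \<Rightarrow> 'a list \<Rightarrow>
    com list \<times> ('a, 'b) state \<Rightarrow> com list \<times> ('a, 'b) state" where
  "step W sim xs ([], s) = ([], s)"
| "step W sim xs (Assign a e f # K, s) =
    (let v = eval W (length xs) (mem s) in (K, store W a (v e) (v f) s))"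
| "step W sim xs (Flip p a e # K, s) =
    (let v = eval W (length xs) (mem s) in
     (K, store W a (v e) (of_bool (fst (shd (source s)) < p)) (s\<lparr>source := stl (source s)\<rparr>)))"
| "step W sim xs (SimGe r a e f g # K, s) =
    (let v = eval W (length xs) (mem s) in
     (K, if v f < length xs \<and> v g < length xs
         then store W a (v e) (of_bool (sim (xs ! v f) (xs ! v g) \<ge> r)) s else s))"
| "step W sim xs (Draw # K, s) =
    (K, s\<lparr>hashfn := snd (shd (source s)), dict := (\<lambda>_. 0), source := stl (source s)\<rparr>)"
| "step W sim xs (DGet a e f # K, s) =
    (let v = eval W (length xs) (mem s) in
     (K, if v f < length xs then store W a (v e) (dict s (hashfn s (xs ! v f))) s else s))"
| "step W sim xs (DPut f g # K, s) =
    (let v = eval W (length xs) (mem s) in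
     (K, if v f < length xs then s\<lparr>dict := (dict s)(hashfn s (xs ! v f) := v g)\<rparr> else s))"
| "step W sim xs (Emit f g # K, s) =
    (let v = eval W (length xs) (mem s) in
     (K, if v f < length xs \<and> v g < length xs
         then s\<lparr>outlist := outlist s @ [(xs ! v f, xs ! v g)]\<rparr> else s))"
| "step W sim xs (Seq c d # K, s) = (c # d # K, s)"
| "step W sim xs (Cond e c d # K, s) =
    ((if eval W (length xs) (mem s) e \<noteq> 0 then c else d) # K, s)"
| "step W sim xs (While e c # K, s) =
    (if eval W (length xs) (mem s) e \<noteq> 0 then (c # While e c # K, s) else (K, s))"

definition init :: "(real \<times> ('a \<Rightarrow> 'b)) stream \<Rightarrow> ('a, 'b) state" where
  "init \<omega> = \<lparr>mem = (\<lambda>_ _. 0), hashfn = (\<lambda>_. undefined), dict = (\<lambda>_. 0), source = \<omega>, outlist = []\<rparr>"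

definition randomness :: "('a \<Rightarrow> 'b) measure \<Rightarrow> (real \<times> ('a \<Rightarrow> 'b)) stream measure" where
  "randomness M = stream_space (uniform_measure lborel {0..1} \<Otimes>\<^sub>M M)"

text \<open>An algorithm is a program together with the constant \<open>\<kappa>\<close> that determines its word size.\<close>

type_synonym algorithm = "com \<times> nat"

definition conf :: "algorithm \<Rightarrow> ('a \<Rightarrow> 'a \<Rightarrow> real) \<Rightarrow> 'a list \<Rightarrow>
    (real \<times> ('a \<Rightarrow> 'b)) stream \<Rightarrow> nat \<Rightarrow> com list \<times> ('a, 'b) state" where
  "conf A sim xs \<omega> t = (step ((length xs + 2) ^ snd A) sim xs ^^ t) ([fst A], init \<omega>)"

definition halted :: "algorithm \<Rightarrow> ('a \<Rightarrow> 'a \<Rightarrow> real) \<Rightarrow> 'a list \<Rightarrow>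
    (real \<times> ('a \<Rightarrow> 'b)) stream \<Rightarrow> nat \<Rightarrow> bool" where
  "halted A sim xs \<omega> t \<longleftrightarrow> fst (conf A sim xs \<omega> t) = []"

definition run_time :: "algorithm \<Rightarrow> ('a \<Rightarrow> 'a \<Rightarrow> real) \<Rightarrow> 'a list \<Rightarrow>
    (real \<times> ('a \<Rightarrow> 'b)) stream \<Rightarrow> ennreal" where
  "run_time A sim xs \<omega> =
     (if \<exists>t. halted A sim xs \<omega> t then of_nat (LEAST t. halted A sim xs \<omega> t) else \<infinity>)"

definition expected_time :: "algorithm \<Rightarrow> ('a \<Rightarrow> 'a \<Rightarrow> real) \<Rightarrow> ('a \<Rightarrow> 'b) measure \<Rightarrow> 'a list \<Rightarrow> ennreal" where
  "expected_time A sim M xs = (\<integral>\<^sup>+ \<omega>. run_time A sim xs \<omega> \<partial>randomness M)"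

text \<open>
  Number of words used during the first \<open>t\<close> steps: all memory cells that ever differ from their
  initial content \<open>0\<close>, plus the largest number of dictionary entries present simultaneously. Both are
  finite, since a step changes at most one cell and adds at most one entry. The command stack is
  bounded by the size of the program and hence not counted.
\<close>

definition working_space :: "algorithm \<Rightarrow> ('a \<Rightarrow> 'a \<Rightarrow> real) \<Rightarrow> 'a list \<Rightarrow>
    (real \<times> ('a \<Rightarrow> 'b)) stream \<Rightarrow> nat \<Rightarrow> nat" where
  "working_space A sim xs \<omega> t =
     card {(a, i). \<exists>u\<le>t. mem (snd (conf A sim xs \<omega> u)) a i \<noteq> 0} +
     Max ((\<lambda>u. card {v. dict (snd (conf A sim xs \<omega> u)) v \<noteq> 0}) ` {..t})"

definition reported :: "algorithm \<Rightarrow> ('a \<Rightarrow> 'a \<Rightarrow> real) \<Rightarrow> 'a list \<Rightarrow>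
    (real \<times> ('a \<Rightarrow> 'b)) stream \<Rightarrow> ('a \<times> 'a) set" where
  "reported A sim xs \<omega> =
     {p. \<exists>t. halted A sim xs \<omega> t \<and> p \<in> set (outlist (snd (conf A sim xs \<omega> t)))}"

definition solves_self_join :: "algorithm \<Rightarrow> real \<Rightarrow> real \<Rightarrow> ('a \<Rightarrow> 'a \<Rightarrow> real) \<Rightarrow>
    ('a \<Rightarrow> 'b) measure \<Rightarrow> 'a list \<Rightarrow> bool" where
  "solves_self_join A lam phi sim M xs \<longleftrightarrow>
     (AE \<omega> in randomness M. \<exists>t. halted A sim xs \<omega> t) \<and>
     (\<forall>\<omega>\<in>space (randomness M).
        reported A sim xs \<omega> \<subseteq> {(x, y). x \<in> set xs \<and> y \<in> set xs \<and> sim x y \<ge> lam}) \<and>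
     (\<forall>x\<in>set xs. \<forall>y\<in>set xs. sim x y \<ge> lam \<longrightarrow>
        measure (randomness M) {\<omega> \<in> space (randomness M). (x, y) \<in> reported A sim xs \<omega>} \<ge> phi)"


definition point_cost :: "real \<Rightarrow> ('a \<Rightarrow> 'a \<Rightarrow> real) \<Rightarrow> 'a set \<Rightarrow> 'a \<Rightarrow> nat \<Rightarrow> real" where
  "point_cost lam sim S x k = (\<Sum>y\<in>S - {x}. (sim x y / lam) ^ k) + (1 / lam) ^ k"

text \<open>The infimum over \<open>k\<close> in the running time bound is a minimum.\<close>

lemma point_cost_min:
  assumes "0 < lam" "lam < 1" "\<And>x y. 0 \<le> sim x y"
  shows "\<exists>k. point_cost lam sim S x k = (INF k. point_cost lam sim S x k)"
proof -
  let ?f = "point_cost lam sim S x"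
  have ge: "(1 / lam) ^ k \<le> ?f k" for k
    using assms by (auto simp: point_cost_def intro!: sum_nonneg)
  have "1 < 1 / lam" using assms by simp
  then obtain N where N: "?f 0 < (1 / lam) ^ N" using real_arch_pow by blast
  have big: "?f 0 < ?f k" if "N \<le> k" for k
    using N ge[of k] power_increasing[OF that, of "1 / lam"] \<open>1 < 1 / lam\<close> by linarith
  obtain m where m: "m \<in> {..N}" "\<And>k. k \<in> {..N} \<Longrightarrow> ?f m \<le> ?f k"
    using ex_min_if_finite[of "?f ` {..N}"] by (fastforce simp: not_less)
  have "?f m \<le> ?f k" for k
    using m(2)[of k] m(2)[of 0] big[of k] by (cases "k \<le> N") auto
  then have "(INF k. ?f k) = ?f m" by (intro cInf_eq_minimum) auto
  then show ?thesis by metis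
qed

end

theory Submission imports Defs begin

text \<open>
  Drawing \<open>k\<close> hash functions and grouping the points by their \<open>k\<close>-tuples of hash values puts
  \<open>x\<close> and \<open>y\<close> into the same class with probability \<open>sim x y ^ k\<close>. About \<open>(1 / lam) ^ k\<close>
  repetitions of this find every pair with \<open>sim x y \<ge> lam\<close>, and in expectation \<open>x\<close> then meets about
  \<open>point_cost lam sim S x k\<close> class mates. The best \<open>k\<close> for \<open>x\<close> is unknown, so phase \<open>b\<close> tries all
  \<open>k = O(log n)\<close> with the budget \<open>2 ^ b\<close> (up to logarithmic factors) for every active point. A point
  that stays within its budget for some \<open>k\<close> has been compared with all its class mates, and is retired
  at the end of the phase. By Markov's inequality \<open>x\<close> survives phase \<open>b\<close> with probability
  \<open>O(F / 2 ^ b)\<close>, where \<open>F\<close> is its minimal cost; hence every phase costs \<open>O(F)\<close> for \<open>x\<close>, and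
  there are \<open>O(log n)\<close> phases. In the last phase \<open>k = 0\<close> retires everything.

  For a real \<open>lam\<close> the number \<open>(1 / lam) ^ k\<close> cannot be computed from finitely many integer constants.
  Instead, all numbers \<open>2 ^ i\<close> of repetitions are tried, and a point may be retired only if one of about
  \<open>2 ^ i\<close> trials of \<open>k\<close> coins of bias \<open>lam\<close> shows only heads. This fails with small probability if
  \<open>2 ^ i \<ge> (1 / lam) ^ k\<close>, and is unlikely to succeed if \<open>2 ^ i\<close> is much smaller than \<open>(1 / lam) ^ k\<close>.

  The control flow up to the retirement decisions does not depend on the randomness, so every coin flip
  and every hash function sits at a fixed position of the source. The probabilistic analysis therefore
  never has to condition on the set of active points.
\<close>

section \<open>Reasoning about programs\<close>

text \<open>Which points are active depends on all earlier randomness. Everything probabilistic is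
  therefore phrased with \<open>passes\<close>, \<open>hit\<close> and \<open>mates\<close>, which
  read fixed positions of the source and refer to all points. The program meets them pathwise: a
  similar pair for which \<open>found\<close> holds is always output, and the points active in phase
  \<open>b\<close> lie in \<open>survivors\<close>.

  A level is a phase \<open>b\<close>, a width \<open>2 ^ i\<close> and an exponent
  \<open>k\<close>. With \<open>L = I + 1\<close>, about log n, there are at most
  \<open>L * L * K = D * L ^ 3\<close> levels; \<open>D\<close> makes \<open>(1 / lam) ^ D\<close>
  at least 2, so that the \<open>K = D * L\<close> exponents reach the point where
  \<open>(1 / lam) ^ k\<close> exceeds n. For a similar pair a level passes its coins and yet misses
  the pair with probability at most \<open>1 / a\<close>. Taking \<open>a = q * L ^ 3\<close> makes
  the union bound \<open>D / q\<close>, and \<open>q\<close> is chosen above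
  \<open>D / (1 - phi)\<close>. There are \<open>a * 2 ^ i\<close> coin trials but
  \<open>a ^ 3 * 2 ^ i\<close> repetitions: the gap \<open>a ^ 2\<close> leaves room for the error
  \<open>1 / a\<close> whether \<open>2 ^ i\<close> is small or large compared with
  \<open>(1 / lam) ^ k\<close>.\<close>

type_synonym ('a, 'b) source = "(real \<times> ('a \<Rightarrow> 'b)) stream"

text \<open>The postcondition of \<open>wp\<close> also sees a clock that counts the elementary steps.\<close>

definition runs :: "nat \<Rightarrow> ('a \<Rightarrow> 'a \<Rightarrow> real) \<Rightarrow> 'a list \<Rightarrow> com \<Rightarrow>
    ('a, 'b) state \<Rightarrow> ('a, 'b) state \<Rightarrow> nat \<Rightarrow> bool" where
  "runs W sim xs c s s' t \<longleftrightarrow> (\<forall>K. (step W sim xs ^^ t) (c # K, s) = (K, s'))"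

definition wp :: "nat \<Rightarrow> ('a \<Rightarrow> 'a \<Rightarrow> real) \<Rightarrow> 'a list \<Rightarrow> com \<Rightarrow>
    (('a, 'b) state \<Rightarrow> nat \<Rightarrow> bool) \<Rightarrow> ('a, 'b) state \<Rightarrow> nat \<Rightarrow> bool" where
  "wp W sim xs c Q s \<tau> \<longleftrightarrow> (\<exists>s' t. runs W sim xs c s s' t \<and> Q s' (\<tau> + t))"

lemma wp_mono:
  assumes "wp W sim xs c Q s \<tau>" and "\<And>s \<tau>. Q s \<tau> \<Longrightarrow> Q' s \<tau>"
  shows "wp W sim xs c Q' s \<tau>"
  using assms unfolding wp_def by blast

lemma wp_step:
  assumes "\<And>K. step W sim xs (c # K, s) = (K, s')" and "Q s' (\<tau> + 1)"
  shows "wp W sim xs c Q s \<tau>"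
  unfolding wp_def runs_def by (rule exI[of _ s'], rule exI[of _ 1]) (use assms in simp)

text \<open>The two runs compose because \<open>runs\<close> holds for every rest \<open>K\<close>
  of the stack: the first one is used with the second command on top of \<open>K\<close>.\<close>

lemma wp_Seq:
  assumes "wp W sim xs c (wp W sim xs d Q) s (\<tau> + 1)"
  shows "wp W sim xs (Seq c d) Q s \<tau>"
proof -
  obtain s1 t1 s2 t2 where 1: "runs W sim xs c s s1 t1" and 2: "runs W sim xs d s1 s2 t2"
    and Q: "Q s2 (\<tau> + 1 + t1 + t2)"
    using assms unfolding wp_def by blast
  have "(step W sim xs ^^ Suc (t2 + t1)) (Seq c d # K, s) = (K, s2)" for K
    unfolding funpow_Suc_right using 1 2 by (simp add: runs_def funpow_add)
  then have "runs W sim xs (Seq c d) s s2 (Suc (t2 + t1))" by (simp add: runs_def)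
  with Q show ?thesis unfolding wp_def by (metis add.assoc add.commute plus_1_eq_Suc)
qed

lemma wp_branch:
  assumes "\<And>K. step W sim xs (c # K, s) = (d # K, s)" and "wp W sim xs d Q s (\<tau> + 1)"
  shows "wp W sim xs c Q s \<tau>"
proof -
  obtain s' t where t: "runs W sim xs d s s' t" and Q: "Q s' (\<tau> + 1 + t)"
    using assms(2) unfolding wp_def by blast
  have "(step W sim xs ^^ Suc t) (c # K, s) = (K, s')" for K
    using t assms(1) by (simp add: runs_def funpow_Suc_right del: funpow.simps(2))
  then have "runs W sim xs c s s' (Suc t)" by (simp add: runs_def)
  with Q show ?thesis unfolding wp_def by (metis add_Suc_right add_Suc Suc_eq_plus1)
qed

lemma wp_Cond:
  assumes "eval W (length xs) (mem s) e \<noteq> 0 \<Longrightarrow> wp W sim xs c Q s (\<tau> + 1)"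
    and "eval W (length xs) (mem s) e = 0 \<Longrightarrow> wp W sim xs d Q s (\<tau> + 1)"
  shows "wp W sim xs (Cond e c d) Q s \<tau>"
  by (cases "eval W (length xs) (mem s) e = 0")
    (rule wp_branch[where d = d] wp_branch[where d = c]; use assms in simp)+

lemma wp_While_unfold:
  assumes "eval W (length xs) (mem s) e \<noteq> 0 \<Longrightarrow>
      wp W sim xs c (wp W sim xs (While e c) Q) s (\<tau> + 1)"
    and "eval W (length xs) (mem s) e = 0 \<Longrightarrow> Q s (\<tau> + 1)"
  shows "wp W sim xs (While e c) Q s \<tau>"
proof (cases "eval W (length xs) (mem s) e = 0")
  case True
  then show ?thesis by (intro wp_step[where s' = s] assms(2)) auto
next
  case False
  obtain s1 t1 s2 t2 where 1: "runs W sim xs c s s1 t1"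
    and 2: "runs W sim xs (While e c) s1 s2 t2" and Q: "Q s2 (\<tau> + 1 + t1 + t2)"
    using assms(1)[OF False] unfolding wp_def by blast
  have "(step W sim xs ^^ Suc (t2 + t1)) (While e c # K, s) = (K, s2)" for K
    unfolding funpow_Suc_right using 1 2 False by (simp add: runs_def funpow_add)
  then have "runs W sim xs (While e c) s s2 (Suc (t2 + t1))" by (simp add: runs_def)
  with Q show ?thesis unfolding wp_def by (metis add.assoc add.commute plus_1_eq_Suc)
qed

text \<open>The ghost value \<open>g\<close> holds what the state alone does not show, such as the
  split of a list into its visited and unvisited part, and it carries the termination measure. Since
  \<open>Inv\<close> sees the clock, time bounds are ordinary parts of the invariants.\<close>

lemma wp_While:
  fixes \<mu> :: "'g \<Rightarrow> nat"
  assumes "Inv g s \<tau>"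
    and body: "\<And>g s \<tau>. Inv g s \<tau> \<Longrightarrow> eval W (length xs) (mem s) e \<noteq> 0 \<Longrightarrow>
      wp W sim xs c (\<lambda>s' \<tau>'. \<exists>g'. Inv g' s' \<tau>' \<and> \<mu> g' < \<mu> g) s (\<tau> + 1)"
    and exit: "\<And>g s \<tau>. Inv g s \<tau> \<Longrightarrow> eval W (length xs) (mem s) e = 0 \<Longrightarrow> Q s (\<tau> + 1)"
  shows "wp W sim xs (While e c) Q s \<tau>"
  using assms(1)
proof (induction "\<mu> g" arbitrary: g s \<tau> rule: less_induct)
  case less
  show ?case
  proof (rule wp_While_unfold)
    assume "eval W (length xs) (mem s) e \<noteq> 0"
    from body[OF less.prems this] show "wp W sim xs c (wp W sim xs (While e c) Q) s (\<tau> + 1)"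
      by (rule wp_mono) (use less.hyps in blast)
  qed (rule exit[OF less.prems])
qed

lemma mem_store [simp]:
  "mem (store W a i v s) b j = (if b = a \<and> j = i then v mod W else mem s b j)"
  by (simp add: store_def)

lemma store_simps [simp]:
  "hashfn (store W a i v s) = hashfn s"
  "dict (store W a i v s) = dict s"
  "source (store W a i v s) = source s"
  "outlist (store W a i v s) = outlist s"
  by (simp_all add: store_def)

abbreviation var :: "string \<Rightarrow> exp" where "var a \<equiv> Arr a (Const 0)"

abbreviation setv :: "string \<Rightarrow> exp \<Rightarrow> com" where "setv a e \<equiv> Assign a (Const 0) e"

text \<open>Agrees with \<open>e\<close> on point indices but can never leave the range of the point indices. Using it
  for all writes makes the space bound a syntactic property of the program.\<close>

definition ix :: "exp \<Rightarrow> exp" where "ix e = Times (Less e Size) e"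

definition Eq :: "exp \<Rightarrow> exp \<Rightarrow> exp" where
  "Eq e f = Minus (Minus (Const 1) (Less e f)) (Less f e)"

definition For :: "string \<Rightarrow> exp \<Rightarrow> com \<Rightarrow> com" where
  "For v e c = Seq (setv v (Const 0)) (While (Less (var v) e)
     (Seq c (setv v (Plus (var v) (Const 1)))))"

lemma eval_ix:
  assumes "2 \<le> W" "n < W" "eval W n m e < n"
  shows "eval W n m (ix e) = eval W n m e"
  using assms by (simp add: ix_def)

lemma eval_ix_bound:
  assumes "2 \<le> W" "n < W" "0 < n"
  shows "eval W n m (ix e) < n"
  using assms by (simp add: ix_def of_bool_def) 

lemma eval_Eq:
  assumes "2 \<le> W"
  shows "eval W n m (Eq e f) = of_bool (eval W n m e = eval W n m f)"
  using assms by (simp add: Eq_def of_bool_def)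

lemma wp_setv:
  assumes "Q (store W a 0 (eval W (length xs) (mem s) e) s) (\<tau> + 1)" 
  shows "wp W sim xs (setv a e) Q s \<tau>"
  by (rule wp_step[where Q = Q, OF _ assms]) (simp add: Let_def)

lemma wp_put:
  assumes "2 \<le> W" "length xs < W" "eval W (length xs) (mem s) f < length xs"
    and "Q (store W a (eval W (length xs) (mem s) f) (eval W (length xs) (mem s) e) s) (\<tau> + 1)" 
  shows "wp W sim xs (Assign a (ix f) e) Q s \<tau>"
  by (rule wp_step[where Q = Q, OF _ assms(4)]) (simp add: eval_ix assms Let_def)

lemma wp_Flip:
  assumes "Q (store W a 0 (of_bool (fst (shd (source s)) < r)) (s\<lparr>source := stl (source s)\<rparr>)) (\<tau> + 1)"
  shows "wp W sim xs (Flip r a (Const 0)) Q s \<tau>"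
  by (rule wp_step[where Q = Q, OF _ assms]) (simp add: Let_def)

lemma wp_Draw:
  assumes "Q (s\<lparr>hashfn := snd (shd (source s)), dict := (\<lambda>_. 0), source := stl (source s)\<rparr>) (\<tau> + 1)"
  shows "wp W sim xs Draw Q s \<tau>"
  by (rule wp_step[where Q = Q, OF _ assms]) (simp add: Let_def)

lemma wp_SimGe:
  fixes W :: nat and xs :: "'a list" and s :: "('a, 'b) state"
  defines "v \<equiv> eval W (length xs) (mem s)"
  assumes "v f < length xs" "v g < length xs"
    and "Q (store W a 0 (of_bool (sim (xs ! v f) (xs ! v g) \<ge> r)) s) (\<tau> + 1)"
  shows "wp W sim xs (SimGe r a (Const 0) f g) Q s \<tau>"
  by (rule wp_step[where Q = Q, OF _ assms(4)]) (use assms(2,3) in \<open>simp add: v_def Let_def\<close>)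

lemma wp_DGet:
  fixes W :: nat and xs :: "'a list" and s :: "('a, 'b) state"
  defines "v \<equiv> eval W (length xs) (mem s)"
  assumes "v f < length xs" and "Q (store W a 0 (dict s (hashfn s (xs ! v f))) s) (\<tau> + 1)"
  shows "wp W sim xs (DGet a (Const 0) f) Q s \<tau>"
  by (rule wp_step[where Q = Q, OF _ assms(3)]) (use assms(2) in \<open>simp add: v_def Let_def\<close>)

lemma wp_DPut:
  fixes W :: nat and xs :: "'a list" and s :: "('a, 'b) state"
  defines "v \<equiv> eval W (length xs) (mem s)"
  assumes "v f < length xs" and "Q (s\<lparr>dict := (dict s)(hashfn s (xs ! v f) := v g)\<rparr>) (\<tau> + 1)"
  shows "wp W sim xs (DPut f g) Q s \<tau>"
  by (rule wp_step[where Q = Q, OF _ assms(3)]) (use assms(2) in \<open>simp add: v_def Let_def\<close>)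

lemma wp_Emit:
  fixes W :: nat and xs :: "'a list" and s :: "('a, 'b) state"
  defines "v \<equiv> eval W (length xs) (mem s)"
  assumes "v f < length xs" "v g < length xs"
    and "Q (s\<lparr>outlist := outlist s @ [(xs ! v f, xs ! v g)]\<rparr>) (\<tau> + 1)"
  shows "wp W sim xs (Emit f g) Q s \<tau>"
  by (rule wp_step[where Q = Q, OF _ assms(4)]) (use assms(2,3) in \<open>simp add: v_def Let_def\<close>)

text \<open>The bound expression is evaluated anew before every iteration, hence the premise
  \<open>bound\<close>; \<open>N < W\<close> keeps the counter from wrapping around. The clock
  offsets pay for \<open>Seq\<close>, for the assignments to the counter and for the loop
  test.\<close>

lemma wp_For:
  assumes W: "2 \<le> W" "N < W"
    and init: "Inv 0 (store W v 0 0 s) (\<tau> + 2)"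
    and bound: "\<And>j s \<tau>. j \<le> N \<Longrightarrow> Inv j s \<tau> \<Longrightarrow> mem s v 0 = j \<Longrightarrow> eval W (length xs) (mem s) e = N"
    and body: "\<And>j s \<tau>. j < N \<Longrightarrow> Inv j s \<tau> \<Longrightarrow> mem s v 0 = j \<Longrightarrow>
      wp W sim xs c (\<lambda>s' \<tau>'. mem s' v 0 = j \<and> Inv (Suc j) (store W v 0 (Suc j) s') (\<tau>' + 1)) s (\<tau> + 2)"
    and exit: "\<And>s \<tau>. Inv N s \<tau> \<Longrightarrow> mem s v 0 = N \<Longrightarrow> Q s (\<tau> + 1)"
  shows "wp W sim xs (For v e c) Q s \<tau>"
  unfolding For_def
proof (intro wp_Seq wp_setv wp_While[where \<mu> = "\<lambda>j. N - j" and
      Inv = "\<lambda>j s \<tau>. j \<le> N \<and> mem s v 0 = j \<and> Inv j s \<tau>" and g = 0], goal_cases)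
  case 1
  then show ?case using init W by simp
next
  case (2 j s \<tau>)
  have eN: "eval W (length xs) (mem s) e = N" using bound 2 by blast
  with 2 have j: "j < N" using W by (simp split: if_splits)
  from body[OF j] 2 have "wp W sim xs c (\<lambda>s' \<tau>'. mem s' v 0 = j \<and>
      Inv (Suc j) (store W v 0 (Suc j) s') (\<tau>' + 1)) s (\<tau> + 1 + 1)" by simp
  then show ?case
    by (rule wp_mono, intro wp_setv exI[of _ "Suc j"]) (use j W in auto)
next
  case (3 j s \<tau>)
  have "eval W (length xs) (mem s) e = N" using bound 3 by blast
  with 3 W have "j = N" by (auto split: if_splits)
  then show ?case using exit 3 by auto
qed

section \<open>Space and measurability\<close>

text \<open>For a nonempty input, index 0 and every index \<open>ix g\<close> are below its length
  by \<open>eval_ix_bound\<close>. A check of the program text thus confines all writes to an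
  initial segment of the arrays named in \<open>A\<close>.\<close>

fun bounded_writes :: "string set \<Rightarrow> com \<Rightarrow> bool" where
  "bounded_writes A (Assign a e f) \<longleftrightarrow> a \<in> A \<and> (e = Const 0 \<or> (\<exists>g. e = ix g))"
| "bounded_writes A (Flip p a e) \<longleftrightarrow> a \<in> A \<and> e = Const 0"
| "bounded_writes A (SimGe r a e f g) \<longleftrightarrow> a \<in> A \<and> e = Const 0"
| "bounded_writes A (DGet a e f) \<longleftrightarrow> a \<in> A \<and> e = Const 0"
| "bounded_writes A (Seq c d) \<longleftrightarrow> bounded_writes A c \<and> bounded_writes A d"
| "bounded_writes A (Cond e c d) \<longleftrightarrow> bounded_writes A c \<and> bounded_writes A d"
| "bounded_writes A (While e c) \<longleftrightarrow> bounded_writes A c"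
| "bounded_writes A c \<longleftrightarrow> True"

text \<open>The last clause is the reason why the dictionary stays small: \<open>Draw\<close>
  empties it, so all keys in use are values of the current hash function at input points.\<close>

definition bounded_space :: "string set \<Rightarrow> 'a list \<Rightarrow> com list \<times> ('a, 'b) state \<Rightarrow> bool" where
  "bounded_space A xs cs \<longleftrightarrow> (\<forall>c\<in>set (fst cs). bounded_writes A c) \<and>
     (\<forall>a i. mem (snd cs) a i \<noteq> 0 \<longrightarrow> a \<in> A \<and> i < length xs) \<and>
     (\<forall>v. dict (snd cs) v \<noteq> 0 \<longrightarrow> v \<in> hashfn (snd cs) ` set xs)"

lemma bounded_space_step:
  assumes W: "2 \<le> W" "length xs < W" and n: "xs \<noteq> []" and "bounded_space A xs cs"
  shows "bounded_space A xs (step W sim xs cs)"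
proof -
  obtain K s where cs: "cs = (K, s)" by fastforce
  show ?thesis
  proof (cases K)
    case Nil
    then show ?thesis using assms cs by simp
  next
    case (Cons c K')
    have st: "bounded_space A xs (K', store W a i v s)" if "a \<in> A" "i < length xs" for a i v
      using assms(4) that cs Cons by (auto simp: bounded_space_def)
    have st0: "bounded_space A xs (K', store W a 0 v s)" if "a \<in> A" for a v
      using st[OF that] n by simp
    show ?thesis
    proof (cases c)
      case (Assign a e f)
      have "eval W (length xs) (mem s) e < length xs" and "a \<in> A"
        using assms(4) n eval_ix_bound[OF W] cs Cons Assign by (auto simp: bounded_space_def)
      then show ?thesis using st cs Cons Assign by (simp add: Let_def)
    next
      case (Flip p a e)
      then show ?thesis
        using st0[of a "of_bool (fst (shd (source s)) < p)"] assms(4) cs Cons n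
        by (simp add: Let_def bounded_space_def)
    next
      case (SimGe r a e f g)
      then have "bounded_space A xs (K', s)" "a \<in> A" "e = Const 0"
        using assms(4) cs Cons by (simp_all add: bounded_space_def)
      then show ?thesis using st0 cs Cons SimGe by (simp add: Let_def)
    next
      case (DGet a e f)
      then have "bounded_space A xs (K', s)" "a \<in> A" "e = Const 0"
        using assms(4) cs Cons by (simp_all add: bounded_space_def)
      then show ?thesis using st0 cs Cons DGet by (simp add: Let_def)
    next
      case (DPut f g)
      then show ?thesis using assms(4) cs Cons by (simp add: Let_def bounded_space_def)
    qed (use assms(4) cs Cons in \<open>simp_all add: bounded_space_def Let_def\<close>)
  qed
qed

lemma conf_Suc: "conf A sim xs \<omega> (Suc t) = step ((length xs + 2) ^ snd A) sim xs (conf A sim xs \<omega> t)"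
  by (simp add: conf_def)

lemma working_space_bound:
  assumes c: "bounded_writes A c" and A: "finite A" and n: "xs \<noteq> []" and \<kappa>: "0 < \<kappa>"
  shows "working_space (c, \<kappa>) sim xs \<omega> t \<le> (card A + 1) * length xs"
proof -
  let ?W = "(length xs + 2) ^ \<kappa>"
  have "length xs + 2 \<le> ?W" using \<kappa> by (simp add: self_le_power)
  then have W: "2 \<le> ?W" "length xs < ?W" by linarith+
  have inv: "bounded_space A xs (conf (c, \<kappa>) sim xs \<omega> t)" for t
  proof (induction t)
    case 0
    then show ?case using c by (simp add: conf_def bounded_space_def init_def)
  next
    case (Suc t)
    then show ?case using bounded_space_step[OF W n] by (simp add: conf_Suc)
  qed
  have "{(a, i). \<exists>u\<le>t. mem (snd (conf (c, \<kappa>) sim xs \<omega> u)) a i \<noteq> 0} \<subseteq> A \<times> {..<length xs}"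
    using inv unfolding bounded_space_def by blast
  then have "card {(a, i). \<exists>u\<le>t. mem (snd (conf (c, \<kappa>) sim xs \<omega> u)) a i \<noteq> 0} \<le> card A * length xs"
    using A card_mono[of "A \<times> {..<length xs}"] by (simp add: card_cartesian_product)
  moreover have "card {v. dict (snd (conf (c, \<kappa>) sim xs \<omega> u)) v \<noteq> 0} \<le> length xs" for u
  proof -
    have "card {v. dict (snd (conf (c, \<kappa>) sim xs \<omega> u)) v \<noteq> 0} \<le>
        card (hashfn (snd (conf (c, \<kappa>) sim xs \<omega> u)) ` set xs)"
      using inv by (intro card_mono) (auto simp: bounded_space_def)
    also have "\<dots> \<le> card (set xs)" by (simp add: card_image_le)
    also have "\<dots> \<le> length xs" by (rule card_length)
    finally show ?thesis .
  qed
  then have "Max ((\<lambda>u. card {v. dict (snd (conf (c, \<kappa>) sim xs \<omega> u)) v \<noteq> 0}) ` {..t}) \<le> length xs"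
    by (subst Max_le_iff) auto
  ultimately show ?thesis unfolding working_space_def
    by (metis (no_types, lifting) add_mono distrib_right mult_1 )
qed


section \<open>Measurability of the output event\<close>

fun flips_only :: "real \<Rightarrow> com \<Rightarrow> bool" where
  "flips_only r (Flip p a e) \<longleftrightarrow> p = r"
| "flips_only r (Seq c d) \<longleftrightarrow> flips_only r c \<and> flips_only r d"
| "flips_only r (Cond e c d) \<longleftrightarrow> flips_only r c \<and> flips_only r d"
| "flips_only r (While e c) \<longleftrightarrow> flips_only r c"
| "flips_only r c \<longleftrightarrow> True"

definition collides :: "real \<times> ('a \<Rightarrow> 'b) \<Rightarrow> 'a \<Rightarrow> 'a \<Rightarrow> bool" where
  "collides u x y \<longleftrightarrow> snd u x = snd u y"

text \<open>All that a run can see of an element of the source.\<close>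

definition observation :: "real \<Rightarrow> 'a list \<Rightarrow> real \<times> ('a \<Rightarrow> 'b) \<Rightarrow> bool \<times> bool list" where
  "observation r xs u = (fst u < r, map (\<lambda>(x, y). collides u x y) (List.product xs xs))"

lemma observation_eqD:
  assumes "observation r xs u = observation r xs u'"
  shows "fst u < r \<longleftrightarrow> fst u' < r"
    and "x \<in> set xs \<Longrightarrow> y \<in> set xs \<Longrightarrow> snd u x = snd u y \<longleftrightarrow> snd u' x = snd u' y"
  using assms by (auto simp: observation_def collides_def)

text \<open>Agreement up to a renaming of hash values: the states are compared only through
  dictionary entries and the equality pattern at the input points. The number \<open>m\<close>
  counts the source elements on which both sides are still known to agree; a step uses up at most
  one.\<close>

definition indist :: "real \<Rightarrow> 'a list \<Rightarrow> nat \<Rightarrow> ('a, 'b) state \<Rightarrow> ('a, 'b) state \<Rightarrow> bool" where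
  "indist r xs m s s' \<longleftrightarrow> mem s = mem s' \<and> outlist s = outlist s' \<and>
     (\<forall>x\<in>set xs. dict s (hashfn s x) = dict s' (hashfn s' x)) \<and>
     (\<forall>x\<in>set xs. \<forall>y\<in>set xs. hashfn s x = hashfn s y \<longleftrightarrow> hashfn s' x = hashfn s' y) \<and>
     (\<forall>i<m. observation r xs (source s !! i) = observation r xs (source s' !! i))"

lemma indist_step:
  assumes "indist r xs (Suc m) s s'" and "\<forall>c\<in>set K. flips_only r c"
  shows "fst (step W sim xs (K, s)) = fst (step W sim xs (K, s')) \<and>
    indist r xs m (snd (step W sim xs (K, s))) (snd (step W sim xs (K, s'))) \<and>
    (\<forall>c\<in>set (fst (step W sim xs (K, s))). flips_only r c)"
proof (cases K)
  case Nil
  then show ?thesis using assms by (auto simp: indist_def)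
next
  case (Cons c K')
  have src: "observation r xs (source s !! i) = observation r xs (source s' !! i)" if "i \<le> m" for i
    using assms that by (auto simp: indist_def)
  have hd: "observation r xs (shd (source s)) = observation r xs (shd (source s'))"
    using src[of 0] by simp
  have tl: "\<forall>i<m. observation r xs (stl (source s) !! i) = observation r xs (stl (source s') !! i)"
    using src[of "Suc _"] by auto
  have eqs: "mem s' = mem s" "outlist s' = outlist s" using assms by (auto simp: indist_def)
  show ?thesis
  proof (cases c)
    case (Flip p a e)
    then show ?thesis using assms Cons eqs tl observation_eqD(1)[OF hd]
      by (auto simp: indist_def store_def Let_def)
  next
    case Draw
    then show ?thesis using assms Cons eqs tl observation_eqD(2)[OF hd]
      by (auto simp: indist_def)
    next
    case (DPut f g)
    then show ?thesis using assms Cons eqs by (simp add: indist_def Let_def)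
  next
    case (DGet a e f)
    then show ?thesis using assms Cons eqs by (simp add: indist_def Let_def store_def)
  qed (use assms Cons eqs in \<open>simp_all add: indist_def store_def Let_def\<close>)
qed

lemma indist_conf:
  assumes c: "flips_only r c" and obs: "\<forall>i<m. observation r xs (\<omega> !! i) = observation r xs (\<omega>' !! i)"
  shows "t \<le> m \<Longrightarrow> fst (conf (c, \<kappa>) sim xs \<omega> t) = fst (conf (c, \<kappa>) sim xs \<omega>' t) \<and>
    indist r xs (m - t) (snd (conf (c, \<kappa>) sim xs \<omega> t)) (snd (conf (c, \<kappa>) sim xs \<omega>' t)) \<and>
    (\<forall>c\<in>set (fst (conf (c, \<kappa>) sim xs \<omega> t)). flips_only r c)"
proof (induction t)
  case 0
  then show ?case using c obs by (auto simp: conf_def indist_def init_def)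
next
  case (Suc t)
  obtain K s where 1: "conf (c, \<kappa>) sim xs \<omega> t = (K, s)" by fastforce
  obtain K' s' where 2: "conf (c, \<kappa>) sim xs \<omega>' t = (K', s')" by fastforce
  have "Suc (m - Suc t) = m - t" using Suc by simp
  then show ?case
    using indist_step[of r xs "m - Suc t" s s' K] Suc 1 2 by (simp add: conf_Suc)
qed

text \<open>The target type \<open>bool \<times> bool list\<close> is countable, so single values
  \<open>v\<close> suffice, and each of them fixes finitely many comparisons and collisions.\<close>

lemma observation_measurable:
  fixes M :: "('a \<Rightarrow> 'b) measure"
  assumes M: "\<And>x y. {h \<in> space M. h x = h y} \<in> sets M"
  shows "observation r xs \<in> (uniform_measure lborel {0..1} \<Otimes>\<^sub>M M) \<rightarrow>\<^sub>M count_space UNIV"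
proof -
  let ?N = "uniform_measure lborel {0..1} \<Otimes>\<^sub>M M :: (real \<times> ('a \<Rightarrow> 'b)) measure"
  have coll [measurable]: "Measurable.pred ?N (\<lambda>u. collides u x y)" for x y
  proof -
    have "Measurable.pred M (\<lambda>h. h x = h y)" using M by (simp add: pred_def)
    from measurable_compose[OF measurable_snd this] show ?thesis by (simp add: collides_def)
  qed
  have "Measurable.pred ?N (\<lambda>u. observation r xs u = v)" for v
  proof -
    have eq: "observation r xs u = v \<longleftrightarrow> (fst u < r \<longleftrightarrow> fst v) \<and> length (List.product xs xs) = length (snd v) \<and>
       (\<forall>i<length (snd v). (case List.product xs xs ! i of (x, y) \<Rightarrow> collides u x y) \<longleftrightarrow> snd v ! i)" for u
      by (auto simp: observation_def prod_eq_iff list_eq_iff_nth_eq)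
    have [measurable]: "Measurable.pred ?N (\<lambda>u. case List.product xs xs ! i of (x, y) \<Rightarrow> collides u x y)" for i
      by (cases "List.product xs xs ! i") simp
    have [measurable]: "(\<lambda>u. fst u) \<in> borel_measurable ?N"
      by (rule measurable_compose[OF measurable_fst]) simp
    show ?thesis unfolding eq by measurable
  qed
  then show ?thesis
    by (subst measurable_count_space_eq2_countable) (auto simp: pred_def vimage_def Int_def conj_commute)
qed

lemma measurable_if_determined:
  assumes Y: "Y \<in> N \<rightarrow>\<^sub>M count_space UNIV"
    and P: "\<And>\<omega> \<omega>'. Y \<omega> = Y \<omega>' \<Longrightarrow> P \<omega> \<longleftrightarrow> P \<omega>'"
  shows "{\<omega> \<in> space N. P \<omega>} \<in> sets N"
proof -
  have "{\<omega> \<in> space N. P \<omega>} = Y -` {y. \<exists>\<omega>. Y \<omega> = y \<and> P \<omega>} \<inter> space N" using P by blast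
  also have "\<dots> \<in> sets N" by (rule measurable_sets[OF Y]) simp
  finally show ?thesis .
qed

text \<open>Being halted after \<open>t\<close> steps with \<open>z\<close> in the output is
  determined by the first \<open>t\<close> observations, which form a random variable with values in
  a discrete space; the event is the union over \<open>t\<close>. The premise
  \<open>flips_only\<close> ensures that a single threshold \<open>r\<close> is enough for the
  observations.\<close>

lemma reported_measurable:
  fixes M :: "('a \<Rightarrow> 'b) measure"
  assumes M: "\<And>x y. {h \<in> space M. h x = h y} \<in> sets M" and c: "flips_only r c"
  shows "{\<omega> \<in> space (randomness M). z \<in> reported (c, \<kappa>) sim xs \<omega>} \<in> sets (randomness M)"
proof -
  let ?Q = "\<lambda>\<omega> t. halted (c, \<kappa>) sim xs \<omega> t \<and> z \<in> set (outlist (snd (conf (c, \<kappa>) sim xs \<omega> t)))"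
  have "{\<omega> \<in> space (randomness M). ?Q \<omega> t} \<in> sets (randomness M)" for t
  proof (rule measurable_if_determined[where Y = "\<lambda>\<omega>. stake t (smap (observation r xs) \<omega>)"])
    show "(\<lambda>\<omega>. stake t (smap (observation r xs) \<omega>)) \<in> randomness M \<rightarrow>\<^sub>M count_space UNIV"
      unfolding randomness_def
      by (rule measurable_compose[OF measurable_smap[OF observation_measurable[OF M]] measurable_stake])
  next
    fix \<omega> \<omega>' :: "('a, 'b) source"
    assume *: "stake t (smap (observation r xs) \<omega>) = stake t (smap (observation r xs) \<omega>')"
    have "\<forall>i<t. observation r xs (\<omega> !! i) = observation r xs (\<omega>' !! i)"
    proof (intro allI impI)
      fix i assume "i < t"
      with arg_cong[OF *, of "\<lambda>l. l ! i"]
      show "observation r xs (\<omega> !! i) = observation r xs (\<omega>' !! i)"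
        by (simp only: stake_nth snth_smap)
    qed
    from indist_conf[OF c this order_refl, of \<kappa> sim] show "?Q \<omega> t \<longleftrightarrow> ?Q \<omega>' t"
      by (simp add: halted_def indist_def)
  qed
  then have "(\<Union>t. {\<omega> \<in> space (randomness M). ?Q \<omega> t}) \<in> sets (randomness M)" by blast
  also have "(\<Union>t. {\<omega> \<in> space (randomness M). ?Q \<omega> t}) =
      {\<omega> \<in> space (randomness M). z \<in> reported (c, \<kappa>) sim xs \<omega>}"
    by (auto simp: reported_def)
  finally show ?thesis .
qed

section \<open>Linked lists grouped into classes\<close>

text \<open>The end mark \<open>z\<close> will be the number of points, which is not a point
  index.\<close>

fun chain :: "nat \<Rightarrow> (nat \<Rightarrow> nat) \<Rightarrow> nat \<Rightarrow> nat list \<Rightarrow> bool" where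
  "chain z nx h [] \<longleftrightarrow> h = z"
| "chain z nx h (x # L) \<longleftrightarrow> h = x \<and> chain z nx (nx x) L"

lemma chain_upd: "x \<notin> set L \<Longrightarrow> chain z (nx(x := v)) h L \<longleftrightarrow> chain z nx h L"
  by (induction L arbitrary: h) auto

lemma chain_insert:
  assumes "chain z nx h (A @ r # B)" "x \<notin> set (A @ r # B)" "distinct (A @ r # B)"
  shows "chain z (nx(x := nx r, r := x)) h (A @ r # x # B)"
  using assms
proof (induction A arbitrary: h)
  case Nil
  then have "chain z (nx(x := nx r, r := x)) (nx r) B" by (subst chain_upd chain_upd; simp)+
  with Nil show ?case by (simp del: fun_upd_apply add: fun_upd_same fun_upd_other)
qed auto

lemma chain_suffix: "chain z nx h (A @ y # B) \<Longrightarrow> chain z nx y (y # B)"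
  by (induction A arbitrary: h) auto

text \<open>A class is named by its first point in the list, so a scan of the class of
  \<open>x\<close> can start at \<open>cls x\<close> without a further table. As the concatenation
  is distinct, different groups have different names.\<close>

definition groups :: "(nat \<Rightarrow> nat) \<Rightarrow> nat list list \<Rightarrow> bool" where
  "groups cls G \<longleftrightarrow> distinct (concat G) \<and> (\<forall>g\<in>set G. g \<noteq> [] \<and> (\<forall>z\<in>set g. cls z = hd g))"

lemma groups_Cons:
  "groups cls (g # G) \<longleftrightarrow> groups cls G \<and> distinct g \<and> set g \<inter> set (concat G) = {} \<and> g \<noteq> [] \<and>
     (\<forall>z\<in>set g. cls z = hd g)"
  by (auto simp: groups_def)

lemma groups_append:
  "groups cls (G @ H) \<longleftrightarrow> groups cls G \<and> groups cls H \<and> set (concat G) \<inter> set (concat H) = {}"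
  by (auto simp: groups_def)

lemma groups_hd_in:
  assumes "groups cls G" "z \<in> set (concat G)"
  shows "cls z \<in> set (concat G)"
proof -
  obtain g where "g \<in> set G" "z \<in> set g" using assms(2) by auto
  then have "hd g \<in> set g" "cls z = hd g" using assms(1) by (auto simp: groups_def)
  then show ?thesis using \<open>g \<in> set G\<close> by auto
qed

text \<open>The split singles out \<open>x\<close>, the point being processed: a class with members
  on both sides of \<open>x\<close> is the class of \<open>x\<close>. This protects the dictionary
  entries that are still needed when \<open>x\<close> overwrites one.\<close>

definition contiguous :: "(nat \<Rightarrow> nat) \<Rightarrow> nat list \<Rightarrow> bool" where
  "contiguous cls L \<longleftrightarrow> (\<forall>A x B. L = A @ x # B \<longrightarrow>
     (\<forall>z\<in>set A. \<forall>w\<in>set B. cls z = cls w \<longrightarrow> cls x = cls z))"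

lemma groups_contiguous: "groups cls G \<Longrightarrow> contiguous cls (concat G)"
proof (induction G)
  case Nil
  then show ?case by (simp add: contiguous_def)
next
  case (Cons g G)
  have "cls x = cls z" if eq: "g @ concat G = A @ x # B" and z: "z \<in> set A" and w: "w \<in> set B"
    and c: "cls z = cls w" for A x B z w
  proof -
    from eq consider C where "g = A @ x # C" | A' where "A = g @ A'" "concat G = A' @ x # B"
      by (auto simp: append_eq_append_conv2 append_eq_Cons_conv)
    then show ?thesis
    proof cases
      case 1
      then show ?thesis using Cons.prems z by (auto simp: groups_Cons)
    next
      case 2
      show ?thesis
      proof (cases "z \<in> set A'")
        case True
        then show ?thesis using Cons 2 w c unfolding groups_Cons contiguous_def by blast
      next
        case False
        with z 2 have "cls z \<in> set g" using Cons.prems by (auto simp: groups_Cons)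
        moreover have "cls w \<in> set (concat G)"
          using groups_hd_in[of cls G w] Cons.prems 2 w by (simp add: groups_Cons)
        ultimately show ?thesis using c Cons.prems by (auto simp: groups_Cons)
      qed
    qed
  qed
  then show ?case by (auto simp: contiguous_def)
qed

text \<open>The head of a group lies in the group and groups are disjoint, so no other group bears
  the same name. The last conclusion lets a scan notice that it has left the class.\<close>

lemma groups_class:
  assumes G: "groups cls G" and x: "x \<in> set (concat G)"
  obtains G1 g G2 where "G = G1 @ g # G2" "cls x = hd g" "g \<noteq> []" "distinct g"
    "set g = {y \<in> set (concat G). cls y = cls x}" "\<forall>y\<in>set (concat G2). cls y \<noteq> cls x"
proof -
  obtain g where g: "g \<in> set G" "x \<in> set g" using x by auto
  then obtain G1 G2 where G12: "G = G1 @ g # G2" by (meson split_list)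
  have 1: "groups cls G1" "groups cls G2" and d: "distinct g" "g \<noteq> []" "\<forall>z\<in>set g. cls z = hd g"
    and dis: "set g \<inter> set (concat G1) = {}" "set g \<inter> set (concat G2) = {}"
    using G unfolding G12 groups_append groups_Cons by auto
  have cx: "cls x = hd g" "hd g \<in> set g" using d g by auto
  have no: "cls y \<noteq> cls x" if "y \<in> set (concat G1) \<union> set (concat G2)" for y
    using that groups_hd_in[OF 1(1), of y] groups_hd_in[OF 1(2), of y] cx dis by (metis IntI Un_iff empty_iff)
  have "set g = {y \<in> set (concat G). cls y = cls x}"
    using no d(3) cx by (auto simp: G12)
  then show thesis using that[OF G12 cx(1) d(2,1)] no by blast
qed

text \<open>A class is split by the new hash function while the list is traversed; \<open>Lp\<close> is processed and
  \<open>Lr\<close> remains. Dictionary entries of finished classes become stale, but since classes are contiguous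
  in the list, at most one class is partly processed, and for it the last clause guarantees that the
  entries are current. A stale entry is recognised by the old class \<open>own\<close> of its representative.\<close>

definition refine_inv :: "nat \<Rightarrow> (nat \<Rightarrow> nat) \<Rightarrow> (nat \<Rightarrow> 'b) \<Rightarrow> nat list \<Rightarrow> nat list \<Rightarrow> nat \<Rightarrow> nat \<Rightarrow>
    (nat \<Rightarrow> nat) \<Rightarrow> (nat \<Rightarrow> nat) \<Rightarrow> (nat \<Rightarrow> nat) \<Rightarrow> ('b \<Rightarrow> nat) \<Rightarrow> bool" where
  "refine_inv z cls0 h Lp Lr x h2 nx cls own d \<longleftrightarrow>
     chain z nx x Lr \<and> (\<exists>G. chain z nx h2 (concat G) \<and> groups cls G \<and> set (concat G) = set Lp) \<and>
     (\<forall>w\<in>set Lr. cls w = cls0 w) \<and>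
     (\<forall>y\<in>set Lp. \<forall>w\<in>set Lp. cls y = cls w \<longleftrightarrow> cls0 y = cls0 w \<and> h y = h w) \<and>
     (\<forall>y\<in>set Lp. own (cls y) = cls0 y) \<and>
     (\<forall>v. d v \<noteq> 0 \<longrightarrow> d v - 1 \<in> set Lp \<and> h (d v - 1) = v \<and> cls (d v - 1) = d v - 1) \<and>
     (\<forall>y\<in>set Lp. \<forall>w\<in>set Lr. cls0 y = cls0 w \<longrightarrow> d (h y) = Suc (cls y))"

lemma refine_inv_join:
  assumes inv: "refine_inv z cls0 h Lp (x # R) x h2 nx cls own d"
    and dist: "distinct (Lp @ x # R)"
    and r: "d (h x) = Suc r" "own r = cls0 x"
  shows "refine_inv z cls0 h (Lp @ [x]) R (nx x) h2 (nx(x := nx r, r := x)) (cls(x := r)) own d"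
proof -
  have rLp: "r \<in> set Lp" "h r = h x" "cls r = r"
    using inv r(1) unfolding refine_inv_def by (metis diff_Suc_1 nat.distinct(1))+
  have c0: "cls0 r = cls0 x" using inv rLp r(2) unfolding refine_inv_def by metis
  have xr: "x \<noteq> r" "x \<notin> set Lp" "x \<notin> set R" "r \<notin> set R" using dist rLp by auto
  obtain G where G: "chain z nx h2 (concat G)" "groups cls G" "set (concat G) = set Lp"
    using inv unfolding refine_inv_def by blast
  obtain G1 g G2 where g: "G = G1 @ g # G2" "cls r = hd g" "g \<noteq> []" "distinct g"
    using groups_class[OF G(2), of r] rLp G(3) by metis
  then obtain t where t: "g = r # t" using rLp by (cases g) auto
  define G' where "G' = G1 @ (r # x # t) # G2"
  have xG: "x \<notin> set (concat G)" using xr G(3) by simp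
  have "chain z (nx(x := nx r, r := x)) h2 (concat G')"
    using chain_insert[of z nx h2 "concat G1" r "t @ concat G2" x] G(1,2) xG
    unfolding G'_def g(1) t groups_def concat.simps concat_append append_Cons append_assoc by blast
  moreover have "groups (cls(x := r)) G'"
    using G(2) xG unfolding G'_def g(1) t by (fastforce simp: groups_def)
  moreover have "set (concat G') = set (Lp @ [x])" using G(3) by (auto simp: G'_def g(1) t)
  ultimately have ex: "\<exists>G. chain z (nx(x := nx r, r := x)) h2 (concat G) \<and> groups (cls(x := r)) G \<and>
      set (concat G) = set (Lp @ [x])" by blast
  have ch: "chain z (nx(x := nx r, r := x)) (nx x) R"
    using inv xr by (simp add: refine_inv_def chain_upd)
  have rel: "r = cls y \<longleftrightarrow> cls0 x = cls0 y \<and> h x = h y" if "y \<in> set Lp" for y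
    using inv that rLp c0 unfolding refine_inv_def by metis
  have own: "own (cls y) = cls0 y" if "y \<in> set Lp" for y
    using inv that unfolding refine_inv_def by blast
  have dd: "d v - 1 \<in> set Lp \<and> h (d v - 1) = v \<and> cls (d v - 1) = d v - 1" if "d v \<noteq> 0" for v
    using inv that unfolding refine_inv_def by blast
  have last: "d (h y) = Suc (cls y)" if "y \<in> set Lp" "w \<in> set R" "cls0 y = cls0 w" for y w
    using inv that unfolding refine_inv_def list.set by blast
  have rem: "cls w = cls0 w" if "w \<in> set R" for w using inv that unfolding refine_inv_def by simp
  have rel0: "cls y = cls w \<longleftrightarrow> cls0 y = cls0 w \<and> h y = h w" if "y \<in> set Lp" "w \<in> set Lp" for y w
    using inv that unfolding refine_inv_def by blast
  show ?thesis unfolding refine_inv_def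
  proof (intro conjI ex ch, goal_cases)
    case 1
    then show ?case using rem xr by auto
  next
    case 2
    show ?case
    proof (intro ballI)
      fix y w assume "y \<in> set (Lp @ [x])" "w \<in> set (Lp @ [x])"
      then show "(cls(x := r)) y = (cls(x := r)) w \<longleftrightarrow> cls0 y = cls0 w \<and> h y = h w"
        using rel[of y] rel[of w] rel0[of y w] xr by (cases "y = x"; cases "w = x") auto
    qed
  next
    case 3
    then show ?case using own r(2) xr by auto
  next
    case 4
    show ?case
    proof (intro allI impI)
      fix v assume "d v \<noteq> 0"
      from dd[OF this] show "d v - 1 \<in> set (Lp @ [x]) \<and> h (d v - 1) = v \<and>
          (cls(x := r)) (d v - 1) = d v - 1" using xr by auto
    qed
  next
    case 5
    show ?case
    proof (intro ballI impI)
      fix y w assume "y \<in> set (Lp @ [x])" "w \<in> set R" "cls0 y = cls0 w"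
      then show "d (h y) = Suc ((cls(x := r)) y)"
        using last[of y w] r(1) by (cases "y = x") auto
    qed
  qed
qed

text \<open>With an absent or stale entry, no processed point shares both the old class and the hash
  value of \<open>x\<close>, so \<open>x\<close> opens a class of its own at the front of the output
  list. Overwriting an entry that belongs to another old class is safe, because by contiguity that
  class has no members left to process.\<close>

lemma refine_inv_new:
  assumes inv: "refine_inv z cls0 h Lp (x # R) x h2 nx cls own d"
    and dist: "distinct (Lp @ x # R)" and cont: "contiguous cls0 (Lp @ x # R)"
    and new: "d (h x) = 0 \<or> own (d (h x) - 1) \<noteq> cls0 x"
  shows "refine_inv z cls0 h (Lp @ [x]) R (nx x) x (nx(x := h2)) (cls(x := x)) (own(x := cls0 x))
    (d(h x := Suc x))"
proof -
  have xr: "x \<notin> set Lp" "x \<notin> set R" using dist by auto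
  obtain G where G: "chain z nx h2 (concat G)" "groups cls G" "set (concat G) = set Lp"
    using inv unfolding refine_inv_def by blast
  have xG: "x \<notin> set (concat G)" using xr G(3) by simp
  have "chain z (nx(x := h2)) x (concat ([x] # G))" using G xG by (simp add: chain_upd)
  moreover have "groups (cls(x := x)) ([x] # G)"
    using G(2) xG by (fastforce simp: groups_def)
  moreover have "set (concat ([x] # G)) = set (Lp @ [x])" using G(3) by auto
  ultimately have ex: "\<exists>G. chain z (nx(x := h2)) x (concat G) \<and> groups (cls(x := x)) G \<and>
      set (concat G) = set (Lp @ [x])" by blast
  have ch: "chain z (nx(x := h2)) (nx x) R"
    using inv xr by (simp add: refine_inv_def chain_upd)
  have cx: "cls y \<in> set Lp" if "y \<in> set Lp" for y using groups_hd_in[OF G(2)] G(3) that by blast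
  have own: "own (cls y) = cls0 y" if "y \<in> set Lp" for y
    using inv that unfolding refine_inv_def by blast
  have dd: "d v - 1 \<in> set Lp \<and> h (d v - 1) = v \<and> cls (d v - 1) = d v - 1" if "d v \<noteq> 0" for v
    using inv that unfolding refine_inv_def by blast
  have last: "d (h y) = Suc (cls y)" if "y \<in> set Lp" "w \<in> set (x # R)" "cls0 y = cls0 w" for y w
    using inv that unfolding refine_inv_def by blast
  have rem: "cls w = cls0 w" if "w \<in> set R" for w using inv that unfolding refine_inv_def by simp
  have rel0: "cls y = cls w \<longleftrightarrow> cls0 y = cls0 w \<and> h y = h w" if "y \<in> set Lp" "w \<in> set Lp" for y w
    using inv that unfolding refine_inv_def by blast
  \<comment> \<open>Otherwise \<open>x\<close>, itself still unprocessed, forces a current entry for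
    \<open>y\<close>, whose owner is the old class of \<open>x\<close>, contradicting
    \<open>new\<close>.\<close>
  have fresh: "\<not> (cls0 y = cls0 x \<and> h y = h x)" if "y \<in> set Lp" for y
  proof
    assume y: "cls0 y = cls0 x \<and> h y = h x"
    then have "d (h x) = Suc (cls y)" using last[OF that, of x] by simp
    then show False using new own[OF that] y by simp
  qed
  show ?thesis unfolding refine_inv_def
  proof (intro conjI ex ch, goal_cases)
    case 1
    then show ?case using rem xr by auto
  next
    case 2
    show ?case
    proof (intro ballI)
      fix y w assume "y \<in> set (Lp @ [x])" "w \<in> set (Lp @ [x])"
      then show "(cls(x := x)) y = (cls(x := x)) w \<longleftrightarrow> cls0 y = cls0 w \<and> h y = h w"
        using cx[of y] cx[of w] fresh[of y] fresh[of w] rel0[of y w] xr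
        by (cases "y = x"; cases "w = x") auto
    qed
  next
    case 3
    then show ?case using own cx xr by auto
  next
    case 4
    show ?case
    proof (intro allI impI)
      fix v assume *: "(d(h x := Suc x)) v \<noteq> 0"
      show "(d(h x := Suc x)) v - 1 \<in> set (Lp @ [x]) \<and> h ((d(h x := Suc x)) v - 1) = v \<and>
          (cls(x := x)) ((d(h x := Suc x)) v - 1) = (d(h x := Suc x)) v - 1"
        using dd[of v] * by (cases "v = h x") auto
    qed
  next
    case 5
    have *: "(d(h x := Suc x)) (h y) = Suc (cls y)" if y: "y \<in> set Lp" and w: "w \<in> set R"
      and c: "cls0 y = cls0 w" for y w
    proof -
      have "cls0 x = cls0 y" using cont y w c unfolding contiguous_def by blast
      then have "h y \<noteq> h x" using fresh[OF y] by auto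
      then show ?thesis using last[OF y, of w] w c by simp
    qed
    show ?case
    proof (intro ballI impI)
      fix y w assume "y \<in> set (Lp @ [x])" "w \<in> set R" "cls0 y = cls0 w"
      then show "(d(h x := Suc x)) (h y) = Suc ((cls(x := x)) y)"
        using *[of y w] by (cases "y = x") auto
    qed
  qed
qed

section \<open>The program\<close>

text \<open>The successor of \<open>x\<close> is saved first, since the entry of \<open>nxt\<close>
  at \<open>x\<close> is overwritten when \<open>x\<close> moves to the list headed by
  \<open>h2\<close>.\<close>

definition refine_body :: com where
  "refine_body =
     Seq (setv ''y'' (Arr ''nxt'' (var ''x'')))
    (Seq (DGet ''e'' (Const 0) (var ''x''))
    (Seq (Cond (Times (Less (Const 0) (var ''e''))
                 (Eq (Arr ''own'' (Minus (var ''e'') (Const 1))) (Arr ''cls'' (var ''x''))))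
       (Seq (Assign ''nxt'' (ix (var ''x'')) (Arr ''nxt'' (Minus (var ''e'') (Const 1))))
       (Seq (Assign ''nxt'' (ix (Minus (var ''e'') (Const 1))) (var ''x''))
            (Assign ''cls'' (ix (var ''x'')) (Minus (var ''e'') (Const 1)))))
       (Seq (Assign ''own'' (ix (var ''x'')) (Arr ''cls'' (var ''x'')))
       (Seq (Assign ''cls'' (ix (var ''x'')) (var ''x''))
       (Seq (Assign ''nxt'' (ix (var ''x'')) (var ''h2''))
       (Seq (setv ''h2'' (var ''x''))
            (DPut (var ''x'') (Plus (var ''x'') (Const 1))))))))
         (setv ''x'' (var ''y''))))"

definition refine :: com where
  "refine = Seq Draw (Seq (setv ''h2'' Size) (Seq (setv ''x'' (var ''h''))
     (Seq (While (Less (var ''x'') Size) refine_body) (setv ''h'' (var ''h2'')))))"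

abbreviation refine_vars :: "string set" where "refine_vars \<equiv> {''x'', ''y'', ''e'', ''nxt'', ''cls'', ''own'', ''h2'', ''h''}"

definition same :: "string set \<Rightarrow> ('a, 'b) state \<Rightarrow> ('a, 'b) state \<Rightarrow> bool" where
  "same A s s' \<longleftrightarrow> (\<forall>a. a \<notin> A \<longrightarrow> mem s' a = mem s a)"

definition word_mem :: "nat \<Rightarrow> ('a, 'b) state \<Rightarrow> bool" where
  "word_mem W s \<longleftrightarrow> (\<forall>a i. mem s a i < W)"

lemma sameD: "same A s s' \<Longrightarrow> a \<notin> A \<Longrightarrow> mem s' a = mem s a"
  by (simp add: same_def)

lemma same_trans: "same A s s' \<Longrightarrow> same A s' s'' \<Longrightarrow> same A s s''"
  by (simp add: same_def)

lemma same_mono: "same A s s' \<Longrightarrow> A \<subseteq> B \<Longrightarrow> same B s s'"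
  by (auto simp: same_def)

lemma same_store: "same A s s' \<Longrightarrow> a \<in> A \<Longrightarrow> same A s (store W a i v s')"
  by (auto simp: same_def store_def)

lemma mem_store_fun:
  "mem (store W a i v s) b = (if b = a then (mem s a)(i := v mod W) else mem s b)"
  by (simp add: store_def)

lemma wfD: "word_mem W s \<Longrightarrow> mem s a i < W"
  by (simp add: word_mem_def)

lemma wf_mod: "word_mem W s \<Longrightarrow> mem s a i mod W = mem s a i"
  by (simp add: word_mem_def)

definition partitioned :: "nat \<Rightarrow> ('a, 'b) state \<Rightarrow> nat set \<Rightarrow> (nat \<Rightarrow> nat \<Rightarrow> bool) \<Rightarrow> bool" where
  "partitioned z s A E \<longleftrightarrow>
     (\<exists>G. chain z (mem s ''nxt'') (mem s ''h'' 0) (concat G) \<and> groups (mem s ''cls'') G \<and>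
        set (concat G) = A) \<and>
     (\<forall>y\<in>A. \<forall>w\<in>A. mem s ''cls'' y = mem s ''cls'' w \<longleftrightarrow> E y w)"

lemma partitioned_cong:
  assumes "partitioned z s A E" "mem s' ''nxt'' = mem s ''nxt''" "mem s' ''cls'' = mem s ''cls''"
    "mem s' ''h'' = mem s ''h''"
  shows "partitioned z s' A E"
  using assms by (simp add: partitioned_def)

locale machine =
  fixes W :: nat and sim :: "'a \<Rightarrow> 'a \<Rightarrow> real" and xs :: "'a list" and lam :: real
  assumes W: "length xs + 2 \<le> W"
begin

abbreviation "n \<equiv> length xs"
abbreviation "wpm \<equiv> wp W sim xs"

lemma W_simps [simp]:
  "2 \<le> W" "0 < W" "n < W" "n mod W = n" "Suc 0 mod W = Suc 0" "of_bool b mod W = of_bool b" "Suc 0 < W" "W \<noteq> Suc 0"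
  "of_bool b * of_bool c mod W = of_bool (b \<and> c)"
  using W by (auto simp: of_bool_def)

lemma wf_store [simp]: "word_mem W s \<Longrightarrow> word_mem W (store W a i v s)"
  by (simp add: word_mem_def)

lemma wf_upd [simp]: 
  "word_mem W (s\<lparr>hashfn := h\<rparr>) = word_mem W s" "word_mem W (s\<lparr>dict := d\<rparr>) = word_mem W s"
  "word_mem W (s\<lparr>source := r\<rparr>) = word_mem W s" "word_mem W (s\<lparr>outlist := l\<rparr>) = word_mem W s"
  by (simp_all add: word_mem_def)

lemma same_upd [simp]: 
  "same A s (s'\<lparr>hashfn := h\<rparr>) = same A s s'" "same A s (s'\<lparr>dict := d\<rparr>) = same A s s'"
  "same A s (s'\<lparr>source := r\<rparr>) = same A s s'" "same A s (s'\<lparr>outlist := l\<rparr>) = same A s s'"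
  by (simp_all add: same_def)

lemma wp_refine_body:
  fixes s :: "('a, 'b) state" and h :: "nat \<Rightarrow> 'b"
  defines "h \<equiv> \<lambda>i. hashfn s (xs ! i)"
  assumes inv: "refine_inv n cls0 h Lp Lr (mem s ''x'' 0) (mem s ''h2'' 0) (mem s ''nxt'')
      (mem s ''cls'') (mem s ''own'') (dict s)"
    and x: "mem s ''x'' 0 < n" and wf: "word_mem W s"
    and dist: "distinct (Lp @ Lr)" and cont: "contiguous cls0 (Lp @ Lr)" and sub: "set (Lp @ Lr) \<subseteq> {..<n}"
    and Q: "\<And>s' \<tau>' x R. Lr = x # R \<Longrightarrow> refine_inv n cls0 h (Lp @ [x]) R (mem s' ''x'' 0) (mem s' ''h2'' 0)
      (mem s' ''nxt'') (mem s' ''cls'') (mem s' ''own'') (dict s') \<Longrightarrow> word_mem W s' \<Longrightarrow>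
      hashfn s' = hashfn s \<Longrightarrow> source s' = source s \<Longrightarrow> outlist s' = outlist s \<Longrightarrow>
      same {''x'', ''y'', ''e'', ''nxt'', ''cls'', ''own'', ''h2''} s s' \<Longrightarrow> \<tau>' \<le> \<tau> + 20 \<Longrightarrow> Q s' \<tau>'"
  shows "wpm refine_body Q s \<tau>"
proof -
  define x where "x = mem s ''x'' 0"
  have xn: "x < n" using x by (simp add: x_def)
  obtain R where Lr: "Lr = x # R"
    using inv x by (cases Lr) (auto simp: refine_inv_def x_def)
  have inv': "refine_inv n cls0 h Lp (x # R) x (mem s ''h2'' 0) (mem s ''nxt'')
      (mem s ''cls'') (mem s ''own'') (dict s)"
    using inv by (simp add: Lr x_def)
  have clsx: "mem s ''cls'' x = cls0 x" using inv' by (simp add: refine_inv_def)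
  define e where "e = dict s (hashfn s (xs ! x))"
  have e: "e - 1 \<in> set Lp" if "e \<noteq> 0"
    using inv' that unfolding refine_inv_def e_def h_def by blast
  have en: "e \<le> n" "e - 1 < n"
    using e sub xn by (cases "e = 0"; force)+
  have eW: "e mod W = e" using en W by simp
  have ex: "e - 1 \<noteq> x" if "e \<noteq> 0" using e[OF that] dist Lr by auto
  have xW: "Suc x mod W = Suc x" "x mod W = x" using xn W by simp_all
  have cW: "cls0 x mod W = cls0 x" using wf_mod[OF wf, of "''cls''" x] clsx by simp
  have eW': "(e - Suc 0) mod W = e - Suc 0" using en W by simp
  note simps = mem_store_fun eval_ix eval_Eq wf_mod[OF wf] x_def[symmetric] e_def[symmetric]
    eW eW' cW xn xW clsx
  show ?thesis
    unfolding refine_body_def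
  proof (intro wp_Seq wp_Cond wp_setv wp_put wp_DGet wp_DPut, simp_all add: simps en[simplified], goal_cases)
    case 1
    then have "refine_inv n cls0 h (Lp @ [x]) R (mem s ''nxt'' x) (mem s ''h2'' 0)
        ((mem s ''nxt'')(x := mem s ''nxt'' (e - 1), e - 1 := x)) ((mem s ''cls'')(x := e - 1))
        (mem s ''own'') (dict s)"
      using refine_inv_join[OF inv', of "e - 1"] dist Lr by (simp add: e_def h_def)
    then show ?case using ex 1
      by (intro Q[OF Lr]) (simp_all add: simps wf same_def)
  next
    case 2
    then have "refine_inv n cls0 h (Lp @ [x]) R (mem s ''nxt'' x) x
        ((mem s ''nxt'')(x := mem s ''h2'' 0)) ((mem s ''cls'')(x := x))
        ((mem s ''own'')(x := cls0 x)) ((dict s)(h x := Suc x))"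
      using refine_inv_new[OF inv'] dist cont Lr by (auto simp add: e_def h_def)
    then show ?case
      by (intro Q[OF Lr]) (simp_all add: simps wf same_def h_def wfD[OF wf])
  qed

qed


lemma wp_refine:
  fixes s :: "('a, 'b) state"
  assumes part: "partitioned n s A E" and wf: "word_mem W s" and A: "A \<subseteq> {..<n}"
    and Q: "\<And>s' \<tau>'. partitioned n s' A (\<lambda>y w. E y w \<and> collides (shd (source s)) (xs ! y) (xs ! w)) \<Longrightarrow>
      word_mem W s' \<Longrightarrow> source s' = stl (source s) \<Longrightarrow> outlist s' = outlist s \<Longrightarrow>
      same refine_vars s s' \<Longrightarrow>
      \<tau>' \<le> \<tau> + 30 * (card A + 1) \<Longrightarrow> Q s' \<tau>'"
  shows "wpm refine Q s \<tau>"
proof -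
  define hf where "hf = snd (shd (source s))"
  define h where "h = (\<lambda>i. hf (xs ! i))"
  define cls0 where "cls0 = mem s ''cls''"
  obtain G where G: "chain n (mem s ''nxt'') (mem s ''h'' 0) (concat G)" "groups cls0 G"
    "set (concat G) = A" using part by (auto simp: partitioned_def cls0_def)
  have E: "\<forall>y\<in>A. \<forall>w\<in>A. cls0 y = cls0 w \<longleftrightarrow> E y w" using part by (auto simp: partitioned_def cls0_def)
  have L: "distinct (concat G)" "contiguous cls0 (concat G)"
    using G(2) groups_contiguous by (auto simp: groups_def)
  have len: "length (concat G) = card A" using distinct_card[OF L(1)] G(3) by simp
  let ?N = "refine_vars"
  \<comment> \<open>The last conjunct is a potential: every unvisited point of the list reserves 21
    steps, 20 for the body and one for the loop test.\<close>
  let ?Inv = "\<lambda>(Lp, Lr) s' \<tau>'. Lp @ Lr = concat G \<and> refine_inv n cls0 h Lp Lr (mem s' ''x'' 0) (mem s' ''h2'' 0)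
      (mem s' ''nxt'') (mem s' ''cls'') (mem s' ''own'') (dict s') \<and> word_mem W s' \<and> hashfn s' = hf \<and>
      source s' = stl (source s) \<and> outlist s' = outlist s \<and> same ?N s s' \<and>
      \<tau>' + 21 * length Lr \<le> \<tau> + 21 * card A + 20"
  show ?thesis
    unfolding refine_def
  proof (intro wp_Seq wp_Draw wp_setv wp_While[where Inv = ?Inv and \<mu> = "\<lambda>(Lp, Lr). length Lr" and
        g = "([], concat G)"], goal_cases)
    case 1
    have "refine_inv n cls0 h [] (concat G) (mem s ''h'' 0) n (mem s ''nxt'') cls0 (mem s ''own'') (\<lambda>_. 0)"
      using G by (auto simp: refine_inv_def groups_def intro!: exI[of _ "[]"])
    then show ?case
      using len wf by (simp add: mem_store_fun wf_mod cls0_def same_def hf_def)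
  next
    case (2 g s1 \<tau>1)
    obtain Lp Lr where g: "g = (Lp, Lr)" by fastforce
    have inv: "?Inv (Lp, Lr) s1 \<tau>1" using 2(1) g by simp
    have h: "h = (\<lambda>i. hashfn s1 (xs ! i))" using inv by (simp add: h_def)
    have x: "mem s1 ''x'' 0 < n" using 2(2) by (simp split: if_splits)
    show ?case
    proof (rule wp_refine_body[where ?cls0.0 = cls0 and Lp = Lp and Lr = Lr])
      show "refine_inv n cls0 (\<lambda>i. hashfn s1 (xs ! i)) Lp Lr (mem s1 ''x'' 0) (mem s1 ''h2'' 0)
        (mem s1 ''nxt'') (mem s1 ''cls'') (mem s1 ''own'') (dict s1)"
        using inv by (simp add: h_def)
    next
      fix s' \<tau>' x R
      assume *: "Lr = x # R" "refine_inv n cls0 (\<lambda>i. hashfn s1 (xs ! i)) (Lp @ [x]) R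
          (mem s' ''x'' 0) (mem s' ''h2'' 0) (mem s' ''nxt'') (mem s' ''cls'') (mem s' ''own'') (dict s')"
        "word_mem W s'" "hashfn s' = hashfn s1" "source s' = source s1" "outlist s' = outlist s1"
        "same {''x'', ''y'', ''e'', ''nxt'', ''cls'', ''own'', ''h2''} s1 s'" "\<tau>' \<le> \<tau>1 + 1 + 20"
      have "same ?N s1 s'" using *(7) by (rule same_mono) auto
      moreover have "same ?N s s1" using inv by simp
      ultimately have "same ?N s s'" by (rule same_trans[rotated])
      with * inv have "?Inv (Lp @ [x], R) s' \<tau>'" by (simp add: h_def)
      then show "\<exists>g'. ?Inv g' s' \<tau>' \<and> (\<lambda>(Lp, Lr). length Lr) g' < (\<lambda>(Lp, Lr). length Lr) g"
        using g *(1) by (intro exI[of _ "(Lp @ [x], R)"]) simp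
    qed (use inv x L G(3) A in \<open>auto\<close>)
  next
    case (3 g s1 \<tau>1)
    obtain Lp Lr where g: "g = (Lp, Lr)" by fastforce
    have inv: "?Inv (Lp, Lr) s1 \<tau>1" using 3(1) g by simp
    have x: "\<not> mem s1 ''x'' 0 < n" using 3(2) by (simp split: if_splits)
    have LpLr: "Lp @ Lr = concat G" using inv by simp
    have "set (Lp @ Lr) = A" unfolding LpLr by (rule G(3))
    moreover have "Lr = []"
    proof (cases Lr)
      case (Cons y R)
      then have "y < n" using A \<open>set (Lp @ Lr) = A\<close> by auto
      moreover have "mem s1 ''x'' 0 = y" using inv Cons by (simp add: refine_inv_def)
      ultimately show ?thesis using x by simp
    qed simp
    ultimately have Lp: "set Lp = A" by simp
    let ?s = "store W ''h'' 0 (mem s1 ''h2'' 0) s1"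
    have "refine_inv n cls0 h Lp Lr (mem s1 ''x'' 0) (mem s1 ''h2'' 0)
      (mem s1 ''nxt'') (mem s1 ''cls'') (mem s1 ''own'') (dict s1)" using inv by simp
    note ri = this[unfolded \<open>Lr = []\<close>]
    have w1: "word_mem W s1" using inv by simp
    show ?case
    proof (simp, rule Q)
      show "partitioned n ?s A (\<lambda>y w. E y w \<and> collides (shd (source s)) (xs ! y) (xs ! w))"
        unfolding partitioned_def
      proof (intro conjI)
        show "\<exists>G. chain n (mem ?s ''nxt'') (mem ?s ''h'' 0) (concat G) \<and> groups (mem ?s ''cls'') G \<and>
          set (concat G) = A"
          using ri Lp by (simp add: refine_inv_def mem_store_fun wf_mod[OF w1])
        show "\<forall>y\<in>A. \<forall>w\<in>A. mem ?s ''cls'' y = mem ?s ''cls'' w \<longleftrightarrow>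
            E y w \<and> collides (shd (source s)) (xs ! y) (xs ! w)"
          using ri E Lp unfolding refine_inv_def collides_def h_def hf_def by (simp add: mem_store_fun)
      qed
    qed (use inv w1 in \<open>auto simp: same_store\<close>)
  qed
qed

end

section \<open>One repetition: initial list, refinement by k hash functions, capped scans\<close>

definition init_list :: com where
  "init_list = Seq (setv ''h'' Size) (For ''p'' (var ''m'')
     (Seq (setv ''x'' (Arr ''act'' (var ''p'')))
     (Seq (Assign ''nxt'' (ix (var ''x'')) (var ''h''))
     (Seq (setv ''h'' (var ''x''))
          (Assign ''cls'' (ix (var ''x'')) (Arr ''act'' (Minus (var ''m'') (Const 1))))))))"

text \<open>Both orders of a pair are emitted at once, because the scans of the partner may be cut
  off before they reach \<open>x\<close>.\<close>

definition scan_body :: "real \<Rightarrow> com" where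
  "scan_body r =
     Seq (SimGe r ''e'' (Const 0) (var ''x'') (var ''y''))
    (Seq (Cond (var ''e'') (Seq (Emit (var ''x'') (var ''y'')) (Emit (var ''y'') (var ''x'')))
            (setv ''e'' (Const 0)))
    (Seq (Assign ''cnt'' (ix (var ''x'')) (Plus (Arr ''cnt'' (var ''x'')) (Const 1)))
         (setv ''y'' (Arr ''nxt'' (var ''y'')))))"

text \<open>The counter stops at \<open>cap + 1\<close> and is not reset between the repetitions of
  a level. A final value of at most \<open>cap\<close> therefore certifies that no scan of
  \<open>x\<close> in the whole level was cut short.\<close>

definition scan :: "real \<Rightarrow> com" where
  "scan r = Seq (setv ''x'' (Arr ''act'' (var ''p''))) (Seq (setv ''y'' (Arr ''cls'' (var ''x'')))
     (While (Times (Less (var ''y'') Size) (Times (Eq (Arr ''cls'' (var ''y'')) (Arr ''cls'' (var ''x'')))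
         (Less (Arr ''cnt'' (var ''x'')) (Plus (var ''cap'') (Const 1))))) (scan_body r)))"

definition rep :: "real \<Rightarrow> com" where
  "rep r = Seq init_list (Seq (For ''q'' (var ''k'') refine) (For ''p'' (var ''m'') (scan r)))"

definition active :: "('a, 'b) state \<Rightarrow> nat list \<Rightarrow> bool" where
  "active s As \<longleftrightarrow> mem s ''m'' 0 = length As \<and> (\<forall>i<length As. mem s ''act'' i = As ! i)"

lemma active_cong: "active s As \<Longrightarrow> mem s' ''m'' = mem s ''m'' \<Longrightarrow> mem s' ''act'' = mem s ''act'' \<Longrightarrow> active s' As"
  by (simp add: active_def)

lemma distinct_length_le:
  assumes "distinct As" "set As \<subseteq> {..<n}"
  shows "length As \<le> n"
  using card_mono[OF _ assms(2)] distinct_card[OF assms(1)] by simp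

context machine
begin

text \<open>Points are prepended, so the last active point becomes the head of the list; this is why
  \<open>init_list\<close> takes it as the name of the single initial class.\<close>

lemma wp_init_list:
  fixes s :: "('a, 'b) state"
  assumes act: "active s As" and As: "distinct As" "set As \<subseteq> {..<n}" and wf: "word_mem W s"
    and Q: "\<And>s' \<tau>'. partitioned n s' (set As) (\<lambda>_ _. True) \<Longrightarrow> word_mem W s' \<Longrightarrow> source s' = source s \<Longrightarrow>
      outlist s' = outlist s \<Longrightarrow> same {''h'', ''p'', ''x'', ''nxt'', ''cls''} s s' \<Longrightarrow>
      \<tau>' \<le> \<tau> + 20 * (length As + 1) \<Longrightarrow> Q s' \<tau>'"
  shows "wpm init_list Q s \<tau>"
proof -
  have len: "length As \<le> n" using distinct_length_le[OF As] .
  let ?N = "{''h'', ''p'', ''x'', ''nxt'', ''cls''}"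
  let ?Inv = "\<lambda>j s' \<tau>'. chain n (mem s' ''nxt'') (mem s' ''h'' 0) (rev (take j As)) \<and>
     (\<forall>y\<in>set (take j As). mem s' ''cls'' y = last As) \<and> word_mem W s' \<and> source s' = source s \<and>
     outlist s' = outlist s \<and> same ?N s s' \<and> \<tau>' \<le> \<tau> + 4 + 15 * j"
  show ?thesis unfolding init_list_def
  proof (intro wp_Seq wp_setv, rule wp_For[where N = "length As" and Inv = ?Inv], goal_cases)
    case 2
    show ?case using len W by simp
  next
    case 3
    show ?case using wf by (simp add: mem_store_fun same_def)
  next
    case (4 j s1 \<tau>1)
    then have "mem s1 ''m'' = mem s ''m''" by (simp add: same_def)
    then show ?case using act by (simp add: active_def)
  next
    case (5 j s1 \<tau>1)
    then have eqs: "mem s1 ''m'' = mem s ''m''" "mem s1 ''act'' = mem s ''act''" by (simp_all add: same_def)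
    have w1: "word_mem W s1" using 5 by simp
    have x: "mem s1 ''act'' j = As ! j" using act 5(1) eqs by (simp add: active_def)
    have m: "mem s1 ''m'' 0 = length As" using act eqs by (simp add: active_def)
    have "As \<noteq> []" using 5(1) by auto
    then have l: "mem s1 ''act'' (length As - Suc 0) = last As"
      using act 5(1) eqs by (simp add: active_def last_conv_nth)
    have xn: "As ! j < n" "last As < n" using As(2) 5(1) \<open>As \<noteq> []\<close> by (auto simp: subset_iff)
    have xW: "As ! j mod W = As ! j" "last As mod W = last As" using xn W by simp_all
    have tk: "take (Suc j) As = take j As @ [As ! j]" using 5(1) by (rule take_Suc_conv_app_nth)
    have notin: "As ! j \<notin> set (take j As)"
      using As(1) 5(1) by (metis distinct_take not_distinct_conv_prefix tk distinct_append disjoint_insert(1) list.set(2) set_append)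
    have sj: "Suc j mod W = Suc j" using 5(1) len W by simp
    note simps = mem_store_fun eval_ix xW xn x m l wf_mod[OF w1] sj
    show ?case
      by (intro wp_Seq wp_setv wp_put)
        (use 5 notin w1 in \<open>simp_all add: simps tk chain_upd same_store\<close>)
  next
    case (6 s1 \<tau>1)
    have "partitioned n s1 (set As) (\<lambda>_ _. True)"
      unfolding partitioned_def
    proof (intro conjI exI[of _ "if As = [] then [] else [rev As]"])
      show "groups (mem s1 ''cls'') (if As = [] then [] else [rev As])"
        using 6 As(1) by (simp add: groups_def hd_rev)
    qed (use 6 in auto)
    with 6 show ?case by (intro Q) auto
  qed simp
qed

lemma wp_draws:
  fixes s :: "('a, 'b) state"
  assumes part: "partitioned n s A (\<lambda>_ _. True)" and wf: "word_mem W s" and A: "A \<subseteq> {..<n}"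
    and k: "mem s ''k'' 0 = k" 
    and Q: "\<And>s' \<tau>'. partitioned n s' A (\<lambda>y w. \<forall>i<k. collides (source s !! i) (xs ! y) (xs ! w)) \<Longrightarrow>
      word_mem W s' \<Longrightarrow> source s' = sdrop k (source s) \<Longrightarrow> outlist s' = outlist s \<Longrightarrow>
      same (insert ''q'' refine_vars) s s' \<Longrightarrow>
      \<tau>' \<le> \<tau> + 40 * (card A + 1) * k + 3 \<Longrightarrow> Q s' \<tau>'"
  shows "wpm (For ''q'' (var ''k'') refine) Q s \<tau>"
proof -
  let ?N = "(insert ''q'' refine_vars)"
  let ?Inv = "\<lambda>j s' \<tau>'. partitioned n s' A (\<lambda>y w. \<forall>i<j. collides (source s !! i) (xs ! y) (xs ! w)) \<and>
     word_mem W s' \<and> source s' = sdrop j (source s) \<and>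
     outlist s' = outlist s \<and> same ?N s s' \<and> \<tau>' \<le> \<tau> + 2 + 40 * (card A + 1) * j"
  have kW: "k < W" using wfD[OF wf] k by metis
  show ?thesis
  proof (rule wp_For[where N = k and Inv = ?Inv], goal_cases)
    case 3
    have "partitioned n (store W ''q'' 0 0 s) A (\<lambda>_ _. True)"
      using part by (rule partitioned_cong) (simp_all add: mem_store_fun)
    then show ?case using wf by (simp add: mem_store_fun same_def)
  next
    case (4 j s1 \<tau>1)
    then have "mem s1 ''k'' = mem s ''k''" by (simp add: same_def)
    then show ?case using k by simp
  next
    case (5 j s1 \<tau>1)
    have src: "source s1 = sdrop j (source s)" using 5 by simp
    show ?case
    proof (rule wp_refine[where A = A and E = "\<lambda>y w. \<forall>i<j. collides (source s !! i) (xs ! y) (xs ! w)"], goal_cases)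
      case (4 s2 \<tau>2)
      have rel: "(\<lambda>y w. (\<forall>i<j. collides (source s !! i) (xs ! y) (xs ! w)) \<and>
          collides (shd (source s1)) (xs ! y) (xs ! w)) =
        (\<lambda>y w. \<forall>i<Suc j. collides (source s !! i) (xs ! y) (xs ! w))"
        by (auto simp: src less_Suc_eq fun_eq_iff)
      have "partitioned n (store W ''q'' 0 (Suc j) s2) A (\<lambda>y w. \<forall>i<Suc j. collides (source s !! i) (xs ! y) (xs ! w))"
        by (rule partitioned_cong[OF 4(1)[unfolded rel]]) (simp_all add: mem_store_fun)
      moreover have "mem s2 ''q'' = mem s1 ''q''" using 4 by (simp add: same_def)
      moreover have "same ?N s (store W ''q'' 0 (Suc j) s2)"
        using 4 5 by (simp add: same_def mem_store_fun)
      moreover have "stl (sdrop j (source s)) = sdrop (Suc j) (source s)" by (metis sdrop_simps(2) sdrop_stl)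
      ultimately show ?case using 4 5 src by (simp add: algebra_simps)
    qed (use 5 A in auto)
  next
    case (6 s1 \<tau>1)
    then show ?case by (intro Q) auto
  qed (use kW in auto)
qed

end

definition emitted :: "'a list \<Rightarrow> ('a, 'b) state \<Rightarrow> nat \<Rightarrow> nat \<Rightarrow> bool" where
  "emitted xs s y w \<longleftrightarrow> (xs ! y, xs ! w) \<in> set (outlist s) \<and> (xs ! w, xs ! y) \<in> set (outlist s)"

lemma emitted_mono: "emitted xs s y w \<Longrightarrow> set (outlist s) \<subseteq> set (outlist s') \<Longrightarrow> emitted xs s' y w"
  by (auto simp: emitted_def)

locale join_machine = machine +
  assumes sim_sym: "\<And>x y. sim x y = sim y x"
begin

abbreviation "joined s x w \<equiv> lam \<le> sim (xs ! x) (xs ! w) \<longrightarrow> emitted xs s x w"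

definition good :: "('a, 'b) state \<Rightarrow> bool" where
  "good s \<longleftrightarrow> set (outlist s) \<subseteq> {(x, y). x \<in> set xs \<and> y \<in> set xs \<and> sim x y \<ge> lam}"

text \<open>Time is charged to the increase of \<open>cnt\<close> at \<open>x\<close>. Over the
  repetitions of a level these charges telescope to at most \<open>c + 1\<close> units per point,
  however large the classes are.\<close>

lemma wp_scan:
  fixes s :: "('a, 'b) state"
  assumes part: "partitioned n s A E" and wf: "word_mem W s" and A: "A \<subseteq> {..<n}"
    and act: "mem s ''act'' (mem s ''p'' 0) = x" and x: "x \<in> A"
    and cap: "mem s ''cap'' 0 = c" "c + 1 < W" and cnt: "mem s ''cnt'' x \<le> c + 1" and good: "good s"
    and Q: "\<And>s' \<tau>'. mem s' ''cnt'' = (mem s ''cnt'')(x := min (mem s ''cnt'' x + card {w \<in> A. E x w}) (c + 1)) \<Longrightarrow>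
      word_mem W s' \<Longrightarrow> source s' = source s \<Longrightarrow> good s' \<Longrightarrow> set (outlist s) \<subseteq> set (outlist s') \<Longrightarrow>
      (mem s' ''cnt'' x \<le> c \<Longrightarrow> \<forall>w\<in>A. E x w \<longrightarrow> joined s' x w) \<Longrightarrow>
      same {''x'', ''y'', ''e'', ''cnt''} s s' \<Longrightarrow>
      \<tau>' + 20 * mem s ''cnt'' x \<le> \<tau> + 20 * mem s' ''cnt'' x + 20 \<Longrightarrow> Q s' \<tau>'"
  shows "wpm (scan lam) Q s \<tau>"
proof -
  let ?nx = "mem s ''nxt''" and ?cls = "mem s ''cls''"
  obtain G where G: "chain n ?nx (mem s ''h'' 0) (concat G)" "groups ?cls G"
    "set (concat G) = A" using part by (auto simp: partitioned_def)
  have E: "?cls w = ?cls x \<longleftrightarrow> E x w" if "w \<in> A" for w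
    using part x that unfolding partitioned_def by (auto simp: eq_commute)
  obtain G1 g G2 where g: "G = G1 @ g # G2" "?cls x = hd g" "g \<noteq> []" "distinct g"
    "set g = {y \<in> set (concat G). ?cls y = ?cls x}" "\<forall>y\<in>set (concat G2). ?cls y \<noteq> ?cls x"
    using groups_class[OF G(2)] x G(3) by blast
  have sg: "set g = {w \<in> A. E x w}" using g(5) E G(3) by auto
  have lg: "length g = card {w \<in> A. E x w}" using distinct_card[OF g(4)] sg by simp
  define R where "R = concat G2"
  have ch0: "chain n ?nx (?cls x) (g @ R)"
  proof -
    obtain t where t: "g = ?cls x # t" using g(2,3) by (cases g) auto
    show ?thesis using chain_suffix[of n ?nx "mem s ''h'' 0" "concat G1" "?cls x" "t @ R"] G(1)
      by (simp add: g(1) R_def) (subst t, subst (asm) t, simp)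
  qed
  have xn: "x < n" using x A by auto
  have xW: "x mod W = x" using xn W by simp
  have gn: "\<forall>w\<in>set g. w < n" using sg A by auto
  let ?N = "{''x'', ''y'', ''e'', ''cnt''}"
  let ?c0 = "mem s ''cnt'' x"
  let ?Inv = "\<lambda>(g1, g2) s' \<tau>'. g1 @ g2 = g \<and> chain n ?nx (mem s' ''y'' 0) (g2 @ R) \<and> mem s' ''x'' 0 = x \<and>
     mem s' ''cnt'' = (mem s ''cnt'')(x := ?c0 + length g1) \<and> ?c0 + length g1 \<le> c + 1 \<and>
     word_mem W s' \<and> source s' = source s \<and> good s' \<and> set (outlist s) \<subseteq> set (outlist s') \<and>
     (\<forall>w\<in>set g1. joined s' x w) \<and> same ?N s s' \<and>
     \<tau>' \<le> \<tau> + 20 * length g1 + 10"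
  have frame: "mem s' ''cls'' = ?cls" "mem s' ''nxt'' = ?nx" "mem s' ''cap'' = mem s ''cap''"
    if "same ?N s s'" for s' :: "('a, 'b) state" using that by (simp_all add: same_def)
  show ?thesis
    unfolding scan_def
  proof (intro wp_Seq wp_setv wp_While[where Inv = ?Inv and \<mu> = "\<lambda>(g1, g2). length g2" and g = "([], g)"], goal_cases)
    case 1
    show ?case
      using act ch0 cnt wf good by (simp add: mem_store_fun wf_mod xW same_def good_def)
  next
    case (2 gg s1 \<tau>1)
    obtain g1 g2 where gg: "gg = (g1, g2)" by fastforce
    have inv: "?Inv (g1, g2) s1 \<tau>1" using 2(1) gg by simp
    define y where "y = mem s1 ''y'' 0"
    have w1: "word_mem W s1" and sm: "same ?N s s1" and x1: "mem s1 ''x'' 0 = x" using inv by simp_all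
    have cnt1: "mem s1 ''cnt'' = (mem s ''cnt'')(x := ?c0 + length g1)" using inv by simp
    have cond: "y < n" "?cls y = ?cls x" "?c0 + length g1 < c + 1"
      using 2(2) frame[OF sm] cap x1 cnt1
      by (simp_all add: eval_Eq y_def[symmetric] split: if_splits)
    \<comment> \<open>Behind the group comes the end mark or a point of another class, and both
      falsify the loop test.\<close>
    have "g2 \<noteq> []"
    proof
      assume "g2 = []"
      then have "chain n ?nx y R" using inv by (simp add: y_def)
      then show False using cond(1,2) g(6) by (cases R) (auto simp: R_def[symmetric])
    qed
    then obtain g2' where g2: "g2 = y # g2'" using inv by (cases g2) (auto simp: y_def)
    have yW: "y mod W = y" using cond(1) W by simp
    have cW: "Suc (?c0 + length g1) mod W = Suc (?c0 + length g1)" using cond(3) cap(2) by simp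
    have chain': "chain n ?nx (?nx y) (g2' @ R)" using inv g2 by simp
    have xs: "xs ! x \<in> set xs" "xs ! y \<in> set xs" using xn cond(1) by simp_all
    note simps = mem_store_fun x1 y_def[symmetric] xn cond(1) eval_ix wf_mod[OF w1] wf_mod[OF wf] frame[OF sm] cnt1 xW yW cW
    define Res where "Res = (\<lambda>s' \<tau>'. \<exists>g'. ?Inv g' s' \<tau>' \<and> (\<lambda>(g1, g2). length g2) g' < (\<lambda>(g1, g2). length g2) gg)"
    have res: "Res s' \<tau>'"
      if "mem s' ''y'' 0 = ?nx y" "mem s' ''x'' 0 = x" "mem s' ''cnt'' = (mem s ''cnt'')(x := ?c0 + length (g1 @ [y]))"
       "word_mem W s'" "source s' = source s1" "good s'" "set (outlist s1) \<subseteq> set (outlist s')"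
       "joined s' x y" "same ?N s s'" "\<tau>' \<le> \<tau>1 + 20" for s' \<tau>'
      unfolding Res_def
    proof (intro exI[of _ "(g1 @ [y], g2')"])
      have "\<forall>w\<in>set g1. joined s' x w"
        using inv that(7) emitted_mono[of xs s1 x _ s'] by simp
      then show "?Inv (g1 @ [y], g2') s' \<tau>' \<and> (\<lambda>(g1, g2). length g2) (g1 @ [y], g2') < (\<lambda>(g1, g2). length g2) gg"
        using inv that chain' g2 gg cond(3) by auto
    qed
    have good1: "good s1" using inv by simp
    have "wpm (scan_body lam) Res s1 (\<tau>1 + 1)"
      unfolding scan_body_def
    proof (intro wp_Seq wp_SimGe wp_Cond wp_Emit wp_setv wp_put, simp_all add: simps, goal_cases)
      case 1
      then show ?case using good1 w1 sm xs sim_sym[of "xs ! x" "xs ! y"]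
        by (intro res) (simp_all add: simps good_def emitted_def same_store subset_insertI2)
    next
      case 2
      then show ?case using good1 w1 sm
        by (intro res) (simp_all add: simps good_def emitted_def same_store)
    qed
    then show ?case unfolding Res_def .
  next
    case (3 gg s1 \<tau>1)
    obtain g1 g2 where gg: "gg = (g1, g2)" by fastforce
    have inv: "?Inv (g1, g2) s1 \<tau>1" using 3(1) gg by simp
    define y where "y = mem s1 ''y'' 0"
    have w1: "word_mem W s1" and sm: "same ?N s s1" and x1: "mem s1 ''x'' 0 = x" using inv by simp_all
    have cnt1: "mem s1 ''cnt'' = (mem s ''cnt'')(x := ?c0 + length g1)" using inv by simp
    have cond: "\<not> y < n \<or> ?cls y \<noteq> ?cls x \<or> \<not> ?c0 + length g1 < c + 1"
      using 3(2) frame[OF sm] cap x1 cnt1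
      by (auto simp: eval_Eq y_def[symmetric] split: if_splits)
    \<comment> \<open>The loop stops at the end of the class or at the saturated counter; either way
      the counter is the minimum that the postcondition asks for.\<close>
    have "g2 = [] \<or> ?c0 + length g1 = c + 1"
    proof (cases g2)
      case (Cons y' t)
      then have "y' = y" "y' \<in> set g" using inv by (auto simp: y_def)
      then have "y < n" "?cls y = ?cls x" using gn g(5) by auto
      then show ?thesis using cond inv by auto
    qed simp
    moreover have "g1 @ g2 = g" "?c0 + length g1 \<le> c + 1" using inv by simp_all
    ultimately have c: "?c0 + length g1 = min (?c0 + length g) (c + 1)" by auto
    show ?case
    proof (rule Q, goal_cases)
      case 1
      show ?case using cnt1 c lg by simp
    next
      case 6
      then have "g2 = []" using cnt1 \<open>g2 = [] \<or> _\<close> by auto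
      then have "g1 = g" using inv by simp
      then show ?case using inv sg by auto
    qed (use inv cnt1 in auto)
  qed
qed

end

section \<open>One level: coin trials, repetitions, retirement\<close>

definition coin :: "real \<Rightarrow> com" where
  "coin r = Seq (setv ''ok'' (Const 0)) (For ''t'' (Times (var ''a'') (var ''P''))
     (Seq (setv ''all'' (Const 1))
     (Seq (For ''f'' (var ''k'') (Seq (Flip r ''c'' (Const 0)) (setv ''all'' (Times (var ''all'') (var ''c'')))))
          (Cond (var ''all'') (setv ''ok'' (Const 1)) (setv ''c'' (Const 0))))))"

text \<open>Retiring a point only sets a flag: the active list stays as it is until
  \<open>build_active\<close> rebuilds it for the next phase. The counters are cleared for the next
  level.\<close>

definition retire :: com where
  "retire = For ''p'' (var ''m'') (Seq (setv ''x'' (Arr ''act'' (var ''p'')))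
     (Seq (Cond (Times (var ''ok'') (Less (Arr ''cnt'' (var ''x'')) (Plus (var ''cap'') (Const 1))))
       (Assign ''done'' (ix (var ''x'')) (Const 1)) (setv ''e'' (Const 0)))
       (Assign ''cnt'' (ix (var ''x'')) (Const 0))))"

definition level :: "real \<Rightarrow> com" where
  "level r = Seq (coin r) (Seq (For ''r'' (Times (var ''a3'') (var ''P'')) (rep r)) retire)"

abbreviation rep_vars :: "string set" where
  "rep_vars \<equiv> {''x'', ''y'', ''e'', ''nxt'', ''cls'', ''own'', ''h2'', ''h'', ''q'', ''p'', ''cnt''}"

context join_machine
begin

lemma wp_scans:
  fixes s :: "('a, 'b) state"
  assumes part: "partitioned n s (set As) E"
    and act: "active s As" and As: "distinct As" "set As \<subseteq> {..<n}" and wf: "word_mem W s"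
    and cap: "mem s ''cap'' 0 = c" "c + 1 < W"
    and cnt: "\<forall>x\<in>set As. mem s ''cnt'' x \<le> c + 1" and good: "good s"
    and Q: "\<And>s' \<tau>'. (\<forall>x. mem s' ''cnt'' x = (if x \<in> set As
          then min (mem s ''cnt'' x + card {w \<in> set As. E x w}) (c + 1) else mem s ''cnt'' x)) \<Longrightarrow>
      word_mem W s' \<Longrightarrow> source s' = source s \<Longrightarrow> good s' \<Longrightarrow> set (outlist s) \<subseteq> set (outlist s') \<Longrightarrow>
      (\<forall>x\<in>set As. \<forall>w\<in>set As. mem s' ''cnt'' x \<le> c \<longrightarrow> E x w \<longrightarrow> joined s' x w) \<Longrightarrow>
      same {''x'', ''y'', ''e'', ''cnt'', ''p''} s s' \<Longrightarrow>
      \<tau>' + 20 * (\<Sum>x\<in>set As. mem s ''cnt'' x) \<le> \<tau> + 20 * (\<Sum>x\<in>set As. mem s' ''cnt'' x) + 30 * (length As + 1) \<Longrightarrow> Q s' \<tau>'"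
  shows "wpm (For ''p'' (var ''m'') (scan lam)) Q s \<tau>"
proof -
  let ?N = "{''x'', ''y'', ''e'', ''cnt'', ''p''}"
  have len: "length As \<le> n" using distinct_length_le[OF As] .
  let ?new = "\<lambda>x. min (mem s ''cnt'' x + card {w \<in> set As. E x w}) (c + 1)"
  let ?Inv = "\<lambda>j s' \<tau>'. (\<forall>x. mem s' ''cnt'' x = (if x \<in> set (take j As) then ?new x else mem s ''cnt'' x)) \<and>
     word_mem W s' \<and> source s' = source s \<and> good s' \<and> set (outlist s) \<subseteq> set (outlist s') \<and>
     (\<forall>x\<in>set (take j As). \<forall>w\<in>set As. mem s' ''cnt'' x \<le> c \<longrightarrow> E x w \<longrightarrow> joined s' x w) \<and>
     same ?N s s' \<and> \<tau>' + 20 * (\<Sum>x\<in>set As. mem s ''cnt'' x) \<le> \<tau> + 20 * (\<Sum>x\<in>set As. mem s' ''cnt'' x) + 30 * j + 2"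
  show ?thesis
  proof (rule wp_For[where N = "length As" and Inv = ?Inv], goal_cases)
    case 3
    show ?case using wf good by (simp add: mem_store_fun same_store good_def same_def)
  next
    case (4 j s1 \<tau>1)
    then have "mem s1 ''m'' = mem s ''m''" by (simp add: same_def)
    then show ?case using act by (simp add: active_def)
  next
    case (5 j s1 \<tau>1)
    define x where "x = As ! j"
    have sm: "same ?N s s1" and w1: "word_mem W s1" and good1: "good s1" using 5 by simp_all
    have fr: "mem s1 ''act'' = mem s ''act''" "mem s1 ''cap'' = mem s ''cap''"
      using sameD[OF sm] by simp_all
    have xA: "x \<in> set As" using 5(1) by (simp add: x_def)
    have tk: "take (Suc j) As = take j As @ [x]" unfolding x_def using 5(1) by (rule take_Suc_conv_app_nth)
    have "distinct (take (Suc j) As)" using As(1) by simp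
    then have notin: "x \<notin> set (take j As)" unfolding tk by simp
    have cx: "mem s1 ''cnt'' x = mem s ''cnt'' x" using 5 notin by simp
    have part1: "partitioned n s1 (set As) E"
      by (rule partitioned_cong[OF part]) (use sameD[OF sm] in simp_all)
    show ?case
    proof (rule wp_scan[where A = "set As" and E = E and x = x and c = c])
      show "mem s1 ''act'' (mem s1 ''p'' 0) = x" using 5 act fr by (simp add: active_def x_def)
      show "mem s1 ''cap'' 0 = c" using fr cap by simp
      show "mem s1 ''cnt'' x \<le> c + 1" using cx cnt xA by simp
    next
      fix s' \<tau>'
      assume *: "mem s' ''cnt'' = (mem s1 ''cnt'')(x := min (mem s1 ''cnt'' x + card {w \<in> set As. E x w}) (c + 1))"
        "word_mem W s'" "source s' = source s1" "good s'" "set (outlist s1) \<subseteq> set (outlist s')"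
        "mem s' ''cnt'' x \<le> c \<Longrightarrow> \<forall>w\<in>set As. E x w \<longrightarrow> joined s' x w"
        "same {''x'', ''y'', ''e'', ''cnt''} s1 s'"
        "\<tau>' + 20 * mem s1 ''cnt'' x \<le> \<tau>1 + 2 + 20 * mem s' ''cnt'' x + 20"
      let ?s = "store W ''p'' 0 (Suc j) s'"
      have p: "mem s' ''p'' = mem s1 ''p''" using sameD[OF *(7)] by simp
      have "same ?N s1 s'" using *(7) by (rule same_mono) auto
      then have sm': "same ?N s s'" by (rule same_trans[OF sm])
      have c': "mem s' ''cnt'' y = (if y \<in> set (take (Suc j) As) then ?new y else mem s ''cnt'' y)" for y
        using 5 notin *(1) cx unfolding tk by simp
      have em: "emitted xs s' y w" if "y \<in> set (take (Suc j) As)" "w \<in> set As" "mem s' ''cnt'' y \<le> c" "E y w"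
        "lam \<le> sim (xs ! y) (xs ! w)" for y w
      proof (cases "y = x")
        case True
        then show ?thesis using *(6) that by blast
      next
        case False
        then have "y \<in> set (take j As)" "mem s1 ''cnt'' y \<le> c" using that *(1) unfolding tk by auto
        then have "emitted xs s1 y w" using 5 that by blast
        then show ?thesis using emitted_mono *(5) by blast
      qed
      have "(\<Sum>x\<in>set As. mem s' ''cnt'' x) = mem s' ''cnt'' x + (\<Sum>x\<in>set As - {x}. mem s1 ''cnt'' x)"
        by (subst sum.remove[OF _ xA]) (auto simp: *(1))
      moreover have "(\<Sum>x\<in>set As. mem s1 ''cnt'' x) = mem s1 ''cnt'' x + (\<Sum>x\<in>set As - {x}. mem s1 ''cnt'' x)"
        by (rule sum.remove[OF _ xA]) simp
      moreover have "\<tau>1 + 20 * (\<Sum>x\<in>set As. mem s ''cnt'' x) \<le> \<tau> + 20 * (\<Sum>x\<in>set As. mem s1 ''cnt'' x) + 30 * j + 2"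
        using 5(2) by blast
      ultimately have time: "\<tau>' + 1 + 20 * (\<Sum>x\<in>set As. mem s ''cnt'' x) \<le> \<tau> + 20 * (\<Sum>x\<in>set As. mem s' ''cnt'' x) + 30 * Suc j + 2"
        using *(8) by (simp add: algebra_simps)
      have same': "same ?N s ?s" using sm' by (simp add: same_store)
      have "set (outlist s) \<subseteq> set (outlist s1)" "source s1 = source s" using 5 by auto
      then show "mem s' ''p'' 0 = j \<and> ?Inv (Suc j) ?s (\<tau>' + 1)"
        using p 5(3) c' *(2-5) em time same'
        by (simp add: mem_store_fun good_def emitted_def)
    qed (use part1 w1 As cap xA good1 in auto)
  next
    case (6 s1 \<tau>1)
    then show ?case by (intro Q) auto
  qed (use len W in auto)
qed

lemma wp_rep:
  fixes s :: "('a, 'b) state"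
  assumes act: "active s As" and As: "distinct As" "set As \<subseteq> {..<n}" and wf: "word_mem W s"
    and cap: "mem s ''cap'' 0 = c" "c + 1 < W" and k: "mem s ''k'' 0 = k"
    and cnt: "\<forall>x\<in>set As. mem s ''cnt'' x \<le> c + 1" and good: "good s"
    and E: "E = (\<lambda>x w. \<forall>i<k. collides (source s !! i) (xs ! x) (xs ! w))"
    and Q: "\<And>s' \<tau>'. (\<forall>x. mem s' ''cnt'' x = (if x \<in> set As
          then min (mem s ''cnt'' x + card {w \<in> set As. E x w}) (c + 1) else mem s ''cnt'' x)) \<Longrightarrow>
      word_mem W s' \<Longrightarrow> source s' = sdrop k (source s) \<Longrightarrow> good s' \<Longrightarrow> set (outlist s) \<subseteq> set (outlist s') \<Longrightarrow>
      (\<forall>x\<in>set As. \<forall>w\<in>set As. mem s' ''cnt'' x \<le> c \<longrightarrow> E x w \<longrightarrow> joined s' x w) \<Longrightarrow>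
      same rep_vars s s' \<Longrightarrow>
      \<tau>' + 20 * (\<Sum>x\<in>set As. mem s ''cnt'' x) \<le> \<tau> + 20 * (\<Sum>x\<in>set As. mem s' ''cnt'' x) + 100 * (k + 1) * (length As + 1) \<Longrightarrow> Q s' \<tau>'"
  shows "wpm (rep lam) Q s \<tau>"
  unfolding rep_def
proof (intro wp_Seq, rule wp_init_list[OF act As wf])
  fix s1 \<tau>1
  assume 1: "partitioned n s1 (set As) (\<lambda>_ _. True)" "word_mem W s1" "source s1 = source s"
    "outlist s1 = outlist s" "same {''h'', ''p'', ''x'', ''nxt'', ''cls''} s s1"
    "\<tau>1 \<le> \<tau> + 1 + 20 * (length As + 1)"
  note f1 = sameD[OF 1(5)]
  have k1: "mem s1 ''k'' 0 = k" using f1[of "''k''"] k by simp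
  show "wpm (Seq (For ''q'' (var ''k'') refine) (For ''p'' (var ''m'') (scan lam))) Q s1 \<tau>1"
  proof (intro wp_Seq, rule wp_draws[OF 1(1,2) As(2) k1])
    fix s2 \<tau>2
    assume 2: "partitioned n s2 (set As) (\<lambda>y w. \<forall>i<k. collides (source s1 !! i) (xs ! y) (xs ! w))"
      "word_mem W s2" "source s2 = sdrop k (source s1)" "outlist s2 = outlist s1"
      "same (insert ''q'' refine_vars) s1 s2"
      "\<tau>2 \<le> \<tau>1 + 1 + 40 * (card (set As) + 1) * k + 3"
    note f2 = sameD[OF 2(5)]
    have fr: "mem s2 ''m'' = mem s ''m''" "mem s2 ''act'' = mem s ''act''" "mem s2 ''cap'' = mem s ''cap''"
      "mem s2 ''cnt'' = mem s ''cnt''" using f1 f2 by simp_all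
    have part: "partitioned n s2 (set As) E" using 2(1) unfolding E 1(3) .
    have act2: "active s2 As" by (rule active_cong[OF act]) (use fr in simp_all)
    have good2: "good s2" using good 1(4) 2(4) by (simp add: good_def)
    show "wpm (For ''p'' (var ''m'') (scan lam)) Q s2 \<tau>2"
    proof (rule wp_scans[OF part act2 As 2(2) _ cap(2) _ good2])
      fix s3 \<tau>3
      assume 3: "\<forall>x. mem s3 ''cnt'' x = (if x \<in> set As
          then min (mem s2 ''cnt'' x + card {w \<in> set As. E x w}) (c + 1) else mem s2 ''cnt'' x)"
        "word_mem W s3" "source s3 = source s2" "good s3" "set (outlist s2) \<subseteq> set (outlist s3)"
        "\<forall>x\<in>set As. \<forall>w\<in>set As. mem s3 ''cnt'' x \<le> c \<longrightarrow> E x w \<longrightarrow> joined s3 x w"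
        "same {''x'', ''y'', ''e'', ''cnt'', ''p''} s2 s3"
        "\<tau>3 + 20 * (\<Sum>x\<in>set As. mem s2 ''cnt'' x) \<le> \<tau>2 + 20 * (\<Sum>x\<in>set As. mem s3 ''cnt'' x) + 30 * (length As + 1)"
      show "Q s3 \<tau>3"
      proof (rule Q)
        show "same rep_vars s s3"
          using 1(5) 2(5) 3(7) by (simp add: same_def)
        have "1 + 20 * (length As + 1) + (1 + 40 * (card (set As) + 1) * k + 3) + 30 * (length As + 1)
            \<le> 100 * (k + 1) * (length As + 1)"
          by (simp add: distinct_card[OF As(1)] algebra_simps)
        then show "\<tau>3 + 20 * (\<Sum>x\<in>set As. mem s ''cnt'' x) \<le> \<tau> + 20 * (\<Sum>x\<in>set As. mem s3 ''cnt'' x) + 100 * (k + 1) * (length As + 1)"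
          using 3(8) 2(6) 1(6) fr(4) by simp
      qed (use 3 fr(4) 1 2 in simp_all)
    qed (use fr cap cnt in simp_all)
  qed
qed

end

definition coin_success :: "real \<Rightarrow> nat \<Rightarrow> ('a, 'b) source \<Rightarrow> nat \<Rightarrow> bool" where
  "coin_success r k \<sigma> t \<longleftrightarrow> (\<forall>i<k. fst (\<sigma> !! (t * k + i)) < r)"

definition all_collide :: "nat \<Rightarrow> ('a, 'b) source \<Rightarrow> nat \<Rightarrow> 'a \<Rightarrow> 'a \<Rightarrow> bool" where
  "all_collide k \<sigma> t x y \<longleftrightarrow> (\<forall>i<k. collides (\<sigma> !! (t * k + i)) x y)"

context join_machine
begin

lemma wp_flips:
  fixes s :: "('a, 'b) state"
  assumes wf: "word_mem W s" and k: "mem s ''k'' 0 = k" and all: "mem s ''all'' 0 = 1"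
    and Q: "\<And>s' \<tau>'. mem s' ''all'' 0 = of_bool (\<forall>i<k. fst (source s !! i) < lam) \<Longrightarrow> word_mem W s' \<Longrightarrow>
      source s' = sdrop k (source s) \<Longrightarrow> outlist s' = outlist s \<Longrightarrow> same {''f'', ''c'', ''all''} s s' \<Longrightarrow>
      \<tau>' \<le> \<tau> + 3 + 10 * k \<Longrightarrow> Q s' \<tau>'"
  shows "wpm (For ''f'' (var ''k'') (Seq (Flip lam ''c'' (Const 0))
    (setv ''all'' (Times (var ''all'') (var ''c''))))) Q s \<tau>"
proof -
  let ?N = "{''f'', ''c'', ''all''}"
  let ?Inv = "\<lambda>j s' \<tau>'. mem s' ''all'' 0 = of_bool (\<forall>i<j. fst (source s !! i) < lam) \<and> word_mem W s' \<and>
      source s' = sdrop j (source s) \<and> outlist s' = outlist s \<and> same ?N s s' \<and> \<tau>' \<le> \<tau> + 2 + 10 * j"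
  have kW: "k < W" using wfD[OF wf, of "''k''" 0] k by simp
  show ?thesis
  proof (rule wp_For[where N = k and Inv = ?Inv], goal_cases)
    case 3
    show ?case using wf all by (simp add: mem_store_fun same_store same_def)
  next
    case (4 j s1 \<tau>1)
    then have "mem s1 ''k'' = mem s ''k''" by (simp add: same_def)
    then show ?case using k by simp
  next
    case (5 j s1 \<tau>1)
    have eq: "(\<forall>i<Suc j. fst (source s !! i) < lam) \<longleftrightarrow> (\<forall>i<j. fst (source s !! i) < lam) \<and> fst (source s !! j) < lam"
      by (auto simp: less_Suc_eq)
    have st: "stl (sdrop j (source s)) = sdrop (Suc j) (source s)"
      by (rule sdrop_simps(2))
    show ?case
      by (intro wp_Seq wp_Flip wp_setv)
        (use 5 in \<open>simp_all add: mem_store_fun eq st same_store del: sdrop.simps\<close>)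
  next
    case (6 s1 \<tau>1)
    then show ?case by (intro Q) auto
  qed (use kW in auto)
qed

text \<open>There is no early exit after a success, so exactly \<open>T * k\<close> source elements
  are consumed and all later positions stay fixed. For \<open>k = 0\<close> every trial
  succeeds.\<close>

lemma wp_coin:
  fixes s :: "('a, 'b) state"
  assumes wf: "word_mem W s" and k: "mem s ''k'' 0 = k" and T: "mem s ''a'' 0 * mem s ''P'' 0 = T" "T < W"
    and Q: "\<And>s' \<tau>'. mem s' ''ok'' 0 = of_bool (\<exists>t<T. coin_success lam k (source s) t) \<Longrightarrow> word_mem W s' \<Longrightarrow>
      source s' = sdrop (T * k) (source s) \<Longrightarrow> outlist s' = outlist s \<Longrightarrow>
      same {''ok'', ''t'', ''all'', ''f'', ''c''} s s' \<Longrightarrow> \<tau>' \<le> \<tau> + 20 * (T + 1) * (k + 1) \<Longrightarrow> Q s' \<tau>'"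
  shows "wpm (coin lam) Q s \<tau>"
proof -
  let ?N = "{''ok'', ''t'', ''all'', ''f'', ''c''}"
  let ?Inv = "\<lambda>j s' \<tau>'. mem s' ''ok'' 0 = of_bool (\<exists>t<j. coin_success lam k (source s) t) \<and> word_mem W s' \<and>
      source s' = sdrop (j * k) (source s) \<and> outlist s' = outlist s \<and> same ?N s s' \<and> \<tau>' \<le> \<tau> + 4 + 20 * j * (k + 1)"
  show ?thesis unfolding coin_def
  proof (intro wp_Seq wp_setv, rule wp_For[where N = T and Inv = ?Inv], goal_cases)
    case 3
    show ?case using wf by (simp add: mem_store_fun same_store same_def)
  next
    case (4 j s1 \<tau>1)
    then have "mem s1 ''a'' = mem s ''a''" "mem s1 ''P'' = mem s ''P''" by (simp_all add: same_def)
    then show ?case using T by simp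
  next
    case (5 j s1 \<tau>1)
    let ?s = "store W ''all'' 0 1 s1"
    have sm: "same ?N s s1" using 5 by simp
    have k1: "mem ?s ''k'' 0 = k" using sameD[OF sm, of "''k''"] k by (simp add: mem_store_fun)
    have w1: "word_mem W ?s" using 5 by simp
    have all1: "mem ?s ''all'' 0 = 1" by (simp add: mem_store_fun)
    have ex: "(\<exists>t<Suc j. coin_success lam k (source s) t) \<longleftrightarrow>
        (\<exists>t<j. coin_success lam k (source s) t) \<or> (\<forall>i<k. fst (source s1 !! i) < lam)"
      using 5 by (auto simp: less_Suc_eq coin_success_def sdrop_snth)
    have "wpm (For ''f'' (var ''k'') (Seq (Flip lam ''c'' (Const 0))
      (setv ''all'' (Times (var ''all'') (var ''c'')))))
      (wpm (Cond (var ''all'') (setv ''ok'' (Const 1)) (setv ''c'' (Const 0)))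
        (\<lambda>s' \<tau>'. mem s' ''t'' 0 = j \<and> ?Inv (Suc j) (store W ''t'' 0 (Suc j) s') (\<tau>' + 1))) ?s (\<tau>1 + 5)"
    proof (rule wp_flips[OF w1 k1 all1], goal_cases)
      case (1 s2 \<tau>2)
      have fr: "mem s2 ''t'' = mem s1 ''t''" "mem s2 ''ok'' = mem s1 ''ok''"
        using sameD[OF 1(5)] by (simp_all add: mem_store_fun)
      have "same ?N ?s s2" using 1(5) by (rule same_mono) auto
      moreover have "same ?N s ?s" using sm by (simp add: same_store)
      ultimately have sm2: "same ?N s s2" by (rule same_trans[rotated])
      have tm: "\<tau>2 + 3 \<le> \<tau> + 4 + 20 * Suc j * (k + 1)" "\<tau>2 + 2 \<le> \<tau> + 4 + 20 * Suc j * (k + 1)"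
        using 1(6) 5(2) by (simp_all add: algebra_simps)
      have src: "source s2 = sdrop (Suc j * k) (source s)"
        using 1(3) 5 by (simp add: sdrop_add add.commute)
      show ?case
      proof (intro wp_Cond wp_setv, goal_cases)
        case c: 1
        then have "\<forall>i<k. fst (source s1 !! i) < lam" using 1(1) by (simp split: if_splits)
        then have "\<exists>t<Suc j. coin_success lam k (source s) t" using ex by simp
        then show ?case using 1 5 fr sm2 src tm
          by (simp add: mem_store_fun same_store del: ex_simps)
      next
        case c: 2
        then have "\<not> (\<forall>i<k. fst (source s1 !! i) < lam)" using 1(1) by (simp split: if_splits)
        then have "(\<exists>t<Suc j. coin_success lam k (source s) t) \<longleftrightarrow> (\<exists>t<j. coin_success lam k (source s) t)"
          using ex by blast
        then show ?case using 1 5 fr sm2 src tm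
          by (simp add: mem_store_fun same_store del: ex_simps)
      qed
    qed
    moreover have "eval W n (mem s1) (Const 1) = 1" "\<tau>1 + 2 + 1 + 1 + 1 = \<tau>1 + 5" by simp_all
    ultimately show ?case by (intro wp_Seq wp_setv) (simp only:)
  next
    case (6 s1 \<tau>1)
    then show ?case by (intro Q) (auto simp: algebra_simps)
  qed (use T in auto)
qed

text \<open>Every repetition pays for building and refining the classes of the active points. The
  scans are paid once for all repetitions through the telescoping counters, which is the summand
  with \<open>c + 1\<close>.\<close>

lemma wp_reps:
  fixes s :: "('a, 'b) state"
  assumes act: "active s As" and As: "distinct As" "set As \<subseteq> {..<n}" and wf: "word_mem W s"
    and cap: "mem s ''cap'' 0 = c" "c + 1 < W" and k: "mem s ''k'' 0 = k"
    and R: "mem s ''a3'' 0 * mem s ''P'' 0 = R" "R < W"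
    and cnt: "\<forall>x\<in>set As. mem s ''cnt'' x = 0" and good: "good s"
    and E: "E = (\<lambda>r x w. all_collide k (source s) r (xs ! x) (xs ! w))"
    and Q: "\<And>s' \<tau>'. (\<forall>x. mem s' ''cnt'' x = (if x \<in> set As
          then min (\<Sum>r<R. card {w \<in> set As. E r x w}) (c + 1) else mem s ''cnt'' x)) \<Longrightarrow>
      word_mem W s' \<Longrightarrow> source s' = sdrop (R * k) (source s) \<Longrightarrow> good s' \<Longrightarrow> set (outlist s) \<subseteq> set (outlist s') \<Longrightarrow>
      (\<forall>x\<in>set As. \<forall>w\<in>set As. \<forall>r<R. mem s' ''cnt'' x \<le> c \<longrightarrow> E r x w \<longrightarrow> joined s' x w) \<Longrightarrow>
      same (insert ''r'' rep_vars) s s' \<Longrightarrow>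
      \<tau>' \<le> \<tau> + 3 + R * (103 * (k + 1) * (length As + 1)) + 20 * length As * (c + 1) \<Longrightarrow> Q s' \<tau>'"
  shows "wpm (For ''r'' (Times (var ''a3'') (var ''P'')) (rep lam)) Q s \<tau>"
proof -
  let ?N = "insert ''r'' rep_vars"
  let ?Z = "103 * (k + 1) * (length As + 1)"
  let ?new = "\<lambda>j x. min (\<Sum>r<j. card {w \<in> set As. E r x w}) (c + 1)"
  let ?Inv = "\<lambda>j s' \<tau>'. (\<forall>x. mem s' ''cnt'' x = (if x \<in> set As then ?new j x else mem s ''cnt'' x)) \<and>
      word_mem W s' \<and> source s' = sdrop (j * k) (source s) \<and> good s' \<and> set (outlist s) \<subseteq> set (outlist s') \<and>
      (\<forall>x\<in>set As. \<forall>w\<in>set As. \<forall>r<j. mem s' ''cnt'' x \<le> c \<longrightarrow> E r x w \<longrightarrow> joined s' x w) \<and>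
      same ?N s s' \<and> \<tau>' \<le> \<tau> + 2 + j * ?Z + 20 * (\<Sum>x\<in>set As. mem s' ''cnt'' x)"
  show ?thesis
  proof (rule wp_For[where N = R and Inv = ?Inv], goal_cases)
    case 3
    show ?case using wf good cnt by (simp add: mem_store_fun same_store same_def good_def)
  next
    case (4 j s1 \<tau>1)
    then have "mem s1 ''a3'' = mem s ''a3''" "mem s1 ''P'' = mem s ''P''" by (simp_all add: same_def)
    then show ?case using R by simp
  next
    case (5 j s1 \<tau>1)
    have sm: "same ?N s s1" and w1: "word_mem W s1" and good1: "good s1"
      and src1: "source s1 = sdrop (j * k) (source s)"
      and c1: "\<And>x. mem s1 ''cnt'' x = (if x \<in> set As then ?new j x else mem s ''cnt'' x)"
      and tm1: "\<tau>1 \<le> \<tau> + 2 + j * ?Z + 20 * (\<Sum>x\<in>set As. mem s1 ''cnt'' x)"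
      and em1: "\<forall>x\<in>set As. \<forall>w\<in>set As. \<forall>r<j. mem s1 ''cnt'' x \<le> c \<longrightarrow> E r x w \<longrightarrow>
        joined s1 x w"
      and out1: "set (outlist s) \<subseteq> set (outlist s1)"
      using 5(2) by blast+
    note fr = sameD[OF sm]
    have act1: "active s1 As" by (rule active_cong[OF act]) (use fr in simp_all)
    have cap1: "mem s1 ''cap'' 0 = c" using fr cap by simp
    have k1: "mem s1 ''k'' 0 = k" using fr k by simp
    have cnt1: "\<forall>x\<in>set As. mem s1 ''cnt'' x \<le> c + 1" using c1 by simp
    have E1: "E j = (\<lambda>x w. \<forall>i<k. collides (source s1 !! i) (xs ! x) (xs ! w))"
      unfolding E src1 all_collide_def by (simp add: sdrop_snth)
    show ?case
    proof (rule wp_rep[OF act1 As w1 cap1 cap(2) k1 cnt1 good1 E1])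
      fix s' \<tau>'
      assume *: "\<forall>x. mem s' ''cnt'' x = (if x \<in> set As
          then min (mem s1 ''cnt'' x + card {w \<in> set As. E j x w}) (c + 1) else mem s1 ''cnt'' x)"
        "word_mem W s'" "source s' = sdrop k (source s1)" "good s'" "set (outlist s1) \<subseteq> set (outlist s')"
        "\<forall>x\<in>set As. \<forall>w\<in>set As. mem s' ''cnt'' x \<le> c \<longrightarrow> E j x w \<longrightarrow> joined s' x w"
        "same rep_vars s1 s'"
        "\<tau>' + 20 * (\<Sum>x\<in>set As. mem s1 ''cnt'' x) \<le> \<tau>1 + 2 + 20 * (\<Sum>x\<in>set As. mem s' ''cnt'' x) + 100 * (k + 1) * (length As + 1)"
      let ?s = "store W ''r'' 0 (Suc j) s'"
      have r: "mem s' ''r'' = mem s1 ''r''" using sameD[OF *(7)] by simp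
      have "same ?N s1 s'" using *(7) by (rule same_mono) auto
      then have sm': "same ?N s s'" by (rule same_trans[OF sm])
      have c': "mem s' ''cnt'' x = (if x \<in> set As then ?new (Suc j) x else mem s ''cnt'' x)" for x
        using c1[of x] *(1) by (auto simp: min_def)
      have em: "emitted xs s' x w" if "x \<in> set As" "w \<in> set As" "r < Suc j" "mem s' ''cnt'' x \<le> c" "E r x w"
        "lam \<le> sim (xs ! x) (xs ! w)" for x w r
      proof (cases "r = j")
        case True
        then show ?thesis using *(6) that by blast
      next
        case False
        have "mem s1 ''cnt'' x \<le> c" using that *(1) by simp
        then have "emitted xs s1 x w" using em1 that False by (meson less_SucE)
        then show ?thesis using emitted_mono *(5) by blast
      qed
      have "Suc j * ?Z = j * ?Z + ?Z" by simp
      moreover have "100 * (k + 1) * (length As + 1) + 3 \<le> ?Z" by (simp add: algebra_simps)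
      ultimately have time: "\<tau>' + 1 \<le> \<tau> + 2 + Suc j * ?Z + 20 * (\<Sum>x\<in>set As. mem s' ''cnt'' x)"
        using *(8) tm1 by linarith
      have same': "same ?N s ?s" using sm' by (simp add: same_store)
      have src: "source s' = sdrop (Suc j * k) (source s)"
        using *(3) src1 by (simp add: sdrop_add add.commute)
      have "?Inv (Suc j) ?s (\<tau>' + 1)"
      proof (intro conjI)
        show "same ?N s ?s" by (rule same')
        show "\<tau>' + 1 \<le> \<tau> + 2 + Suc j * ?Z + 20 * (\<Sum>x\<in>set As. mem ?s ''cnt'' x)"
          using time by (simp add: mem_store_fun)
        show "\<forall>x. mem ?s ''cnt'' x = (if x \<in> set As then ?new (Suc j) x else mem s ''cnt'' x)"
          using c' by (simp only: mem_store_fun) simp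
        show "\<forall>x\<in>set As. \<forall>w\<in>set As. \<forall>r<Suc j. mem ?s ''cnt'' x \<le> c \<longrightarrow> E r x w \<longrightarrow> joined ?s x w"
          using em by (simp add: mem_store_fun emitted_def)
        show "set (outlist s) \<subseteq> set (outlist ?s)" using out1 *(5) by simp
        show "good ?s" using *(4) by (simp add: good_def)
      qed (use *(2) src in simp_all)
      moreover have "mem s' ''r'' 0 = j" using r 5(3) by simp
      ultimately show "mem s' ''r'' 0 = j \<and> ?Inv (Suc j) ?s (\<tau>' + 1)" by blast
    qed
  next
    case (6 s1 \<tau>1)
    have "(\<Sum>x\<in>set As. mem s1 ''cnt'' x) \<le> (\<Sum>x\<in>set As. c + 1)"
      using 6(1) by (intro sum_mono) simp
    also have "\<dots> = length As * (c + 1)" using distinct_card[OF As(1)] by simp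
    finally have "20 * (\<Sum>x\<in>set As. mem s1 ''cnt'' x) \<le> 20 * length As * (c + 1)" by simp
    moreover have "\<tau>1 \<le> \<tau> + 2 + R * ?Z + 20 * (\<Sum>x\<in>set As. mem s1 ''cnt'' x)" using 6(1) by blast
    ultimately have t: "\<tau>1 + 1 \<le> \<tau> + 3 + R * ?Z + 20 * length As * (c + 1)" by linarith
    show ?case by (rule Q[OF _ _ _ _ _ _ _ t]) (use 6(1) in blast)+
  qed (use R in auto)
qed

lemma wp_retire:
  fixes s :: "('a, 'b) state"
  assumes act: "active s As" and As: "distinct As" "set As \<subseteq> {..<n}" and wf: "word_mem W s"
    and cap: "mem s ''cap'' 0 = c" "c + 1 < W" and ok: "mem s ''ok'' 0 = of_bool ok"
    and Q: "\<And>s' \<tau>'. (\<forall>x. mem s' ''done'' x = (if x \<in> set As \<and> ok \<and> mem s ''cnt'' x \<le> c then 1 else mem s ''done'' x)) \<Longrightarrow>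
      (\<forall>x. mem s' ''cnt'' x = (if x \<in> set As then 0 else mem s ''cnt'' x)) \<Longrightarrow>
      word_mem W s' \<Longrightarrow> source s' = source s \<Longrightarrow> outlist s' = outlist s \<Longrightarrow>
      same {''p'', ''x'', ''e'', ''done'', ''cnt''} s s' \<Longrightarrow>
      \<tau>' \<le> \<tau> + 20 * (length As + 1) \<Longrightarrow> Q s' \<tau>'"
  shows "wpm retire Q s \<tau>"
proof -
  have len: "length As \<le> n" using distinct_length_le[OF As] .
  let ?N = "{''p'', ''x'', ''e'', ''done'', ''cnt''}"
  let ?Inv = "\<lambda>j s' \<tau>'. (\<forall>x. mem s' ''done'' x = (if x \<in> set (take j As) \<and> ok \<and> mem s ''cnt'' x \<le> c then 1 else mem s ''done'' x)) \<and>
      (\<forall>x. mem s' ''cnt'' x = (if x \<in> set (take j As) then 0 else mem s ''cnt'' x)) \<and>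
      word_mem W s' \<and> source s' = source s \<and> outlist s' = outlist s \<and> same ?N s s' \<and> \<tau>' \<le> \<tau> + 2 + 20 * j"
  show ?thesis
    unfolding retire_def
  proof (rule wp_For[where N = "length As" and Inv = ?Inv], goal_cases)
    case 3
    show ?case using wf by (simp add: mem_store_fun same_store same_def)
  next
    case (4 j s1 \<tau>1)
    then have "mem s1 ''m'' = mem s ''m''" by (simp add: same_def)
    then show ?case using act by (simp add: active_def)
  next
    case (5 j s1 \<tau>1)
    define x where "x = As ! j"
    have sm: "same ?N s s1" and w1: "word_mem W s1"
      and d1: "\<And>x. mem s1 ''done'' x = (if x \<in> set (take j As) \<and> ok \<and> mem s ''cnt'' x \<le> c then 1 else mem s ''done'' x)"
      and c1: "\<And>x. mem s1 ''cnt'' x = (if x \<in> set (take j As) then 0 else mem s ''cnt'' x)"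
      and r1: "source s1 = source s" "outlist s1 = outlist s" "\<tau>1 \<le> \<tau> + 2 + 20 * j"
      using 5(2) by blast+
    have fr: "mem s1 ''act'' = mem s ''act''" "mem s1 ''cap'' = mem s ''cap''" "mem s1 ''ok'' = mem s ''ok''"
      using sameD[OF sm] by simp_all
    have xn: "x < n" using 5(1) As(2) by (auto simp: x_def subset_iff)
    have xW: "x mod W = x" using xn W by simp
    have sj: "Suc j mod W = Suc j" using 5(1) len W by simp
    have ax: "mem s ''act'' j = x" using act 5(1) by (simp add: active_def x_def)
    have tk: "take (Suc j) As = take j As @ [x]" unfolding x_def using 5(1) by (rule take_Suc_conv_app_nth)
    have "distinct (take (Suc j) As)" using As(1) by simp
    then have notin: "x \<notin> set (take j As)" unfolding tk by simp
    note simps = mem_store_fun eval_ix fr 5(3) ax xW xn cap ok c1 d1 notin tk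
    show ?case
      by (intro wp_Seq wp_setv wp_Cond wp_put)
        (use w1 sm r1 cap(2) in \<open>auto simp: simps same_store split: if_splits\<close>)
  next
    case (6 s1 \<tau>1)
    then show ?case by (intro Q) auto
  qed (use len W in auto)
qed

end

abbreviation level_vars :: "string set" where
  "level_vars \<equiv> {''ok'', ''t'', ''all'', ''f'', ''c'', ''r'', ''done''} \<union> rep_vars"

definition build_active :: com where
  "build_active = Seq (setv ''m'' (Const 0)) (For ''i'' Size (Cond (Arr ''done'' (var ''i''))
     (setv ''e'' (Const 0))
     (Seq (Assign ''act'' (ix (var ''m'')) (var ''i'')) (setv ''m'' (Plus (var ''m'') (Const 1))))))"

context join_machine
begin

text \<open>\<open>N x\<close> is the uncapped number of class mates met by \<open>x\<close>. The
  counter ends at its minimum with \<open>c + 1\<close>, so the test in \<open>retire\<close>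
  decides \<open>N x \<le> c\<close>. As \<open>T\<close> and \<open>R\<close> are at most
  \<open>c\<close>, one budget covers coins, refinements and scans.\<close>

lemma wp_level:
  fixes s :: "('a, 'b) state"
  assumes act: "active s As" and As: "distinct As" "set As \<subseteq> {..<n}" and wf: "word_mem W s"
    and cap: "mem s ''cap'' 0 = c" "c + 1 < W" and k: "mem s ''k'' 0 = k"
    and T: "mem s ''a'' 0 * mem s ''P'' 0 = T" "T \<le> c"
    and R: "mem s ''a3'' 0 * mem s ''P'' 0 = R" "R \<le> c"
    and cnt: "\<forall>x. mem s ''cnt'' x = 0" and good: "good s"
    and ok: "ok \<longleftrightarrow> (\<exists>t<T. coin_success lam k (source s) t)"
    and E: "E = (\<lambda>r x w. all_collide k (sdrop (T * k) (source s)) r (xs ! x) (xs ! w))"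
    and N: "N = (\<lambda>x. \<Sum>r<R. card {w \<in> set As. E r x w})"
    and Q: "\<And>s' \<tau>'. (\<forall>x. mem s' ''done'' x = (if x \<in> set As \<and> ok \<and> N x \<le> c then 1 else mem s ''done'' x)) \<Longrightarrow>
      (\<forall>x. mem s' ''cnt'' x = 0) \<Longrightarrow> word_mem W s' \<Longrightarrow> source s' = sdrop (T * k + R * k) (source s) \<Longrightarrow> good s' \<Longrightarrow>
      set (outlist s) \<subseteq> set (outlist s') \<Longrightarrow>
      (\<forall>x\<in>set As. \<forall>w\<in>set As. \<forall>r<R. N x \<le> c \<longrightarrow> E r x w \<longrightarrow> joined s' x w) \<Longrightarrow>
      same level_vars s s' \<Longrightarrow>
      \<tau>' \<le> \<tau> + 400 * (k + 1) * (c + 1) * (length As + 1) \<Longrightarrow> Q s' \<tau>'"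
  shows "wpm (level lam) Q s \<tau>"
proof -
  have TW: "T < W" "R < W" using T R cap(2) by simp_all
  show ?thesis
    unfolding level_def
  proof (intro wp_Seq, rule wp_coin[OF wf k T(1) TW(1)])
    fix s1 \<tau>1
    assume 1: "mem s1 ''ok'' 0 = of_bool (\<exists>t<T. coin_success lam k (source s) t)" "word_mem W s1"
      "source s1 = sdrop (T * k) (source s)" "outlist s1 = outlist s"
      "same {''ok'', ''t'', ''all'', ''f'', ''c''} s s1" "\<tau>1 \<le> \<tau> + 1 + 20 * (T + 1) * (k + 1)"
    note f1 = sameD[OF 1(5)]
    have act1: "active s1 As" by (rule active_cong[OF act]) (use f1 in simp_all)
    have e1: "mem s1 ''cap'' 0 = c" "mem s1 ''k'' 0 = k" "mem s1 ''a3'' 0 * mem s1 ''P'' 0 = R"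
      "\<forall>x\<in>set As. mem s1 ''cnt'' x = 0" "mem s1 ''cnt'' = mem s ''cnt''" "mem s1 ''done'' = mem s ''done''"
      using f1 cap k R cnt by simp_all
    have good1: "good s1" using good 1(4) by (simp add: good_def)
    have E1: "E = (\<lambda>r x w. all_collide k (source s1) r (xs ! x) (xs ! w))" by (simp add: E 1(3))
    show "wpm (Seq (For ''r'' (Times (var ''a3'') (var ''P'')) (rep lam)) retire) Q s1 \<tau>1"
    proof (intro wp_Seq, rule wp_reps[OF act1 As 1(2) e1(1) cap(2) e1(2,3) TW(2) e1(4) good1 E1])
      fix s2 \<tau>2
      assume 2: "\<forall>x. mem s2 ''cnt'' x = (if x \<in> set As
          then min (\<Sum>r<R. card {w \<in> set As. E r x w}) (c + 1) else mem s1 ''cnt'' x)"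
        "word_mem W s2" "source s2 = sdrop (R * k) (source s1)" "good s2" "set (outlist s1) \<subseteq> set (outlist s2)"
        "\<forall>x\<in>set As. \<forall>w\<in>set As. \<forall>r<R. mem s2 ''cnt'' x \<le> c \<longrightarrow> E r x w \<longrightarrow> joined s2 x w"
        "same (insert ''r'' rep_vars) s1 s2"
        "\<tau>2 \<le> \<tau>1 + 1 + 3 + R * (103 * (k + 1) * (length As + 1)) + 20 * length As * (c + 1)"
      note f2 = sameD[OF 2(7)]
      have act2: "active s2 As" by (rule active_cong[OF act1]) (use f2 in simp_all)
      have cap2: "mem s2 ''cap'' 0 = c" using f2 e1 by simp
      have ok2: "mem s2 ''ok'' 0 = of_bool ok" using f2 1(1) ok by simp
      have d2: "mem s2 ''done'' = mem s ''done''" using f2 e1 by simp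
      show "wpm retire Q s2 \<tau>2"
      proof (rule wp_retire[OF act2 As 2(2) cap2 cap(2) ok2])
        fix s3 \<tau>3
        assume 3: "\<forall>x. mem s3 ''done'' x = (if x \<in> set As \<and> ok \<and> mem s2 ''cnt'' x \<le> c then 1 else mem s2 ''done'' x)"
          "\<forall>x. mem s3 ''cnt'' x = (if x \<in> set As then 0 else mem s2 ''cnt'' x)"
          "word_mem W s3" "source s3 = source s2" "outlist s3 = outlist s2"
          "same {''p'', ''x'', ''e'', ''done'', ''cnt''} s2 s3" "\<tau>3 \<le> \<tau>2 + 20 * (length As + 1)"
        have cN: "mem s2 ''cnt'' x \<le> c \<longleftrightarrow> N x \<le> c" if "x \<in> set As" for x
          using 2(1) that by (auto simp: N)
        show "Q s3 \<tau>3"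
        proof (rule Q)
          show "\<forall>x. mem s3 ''done'' x = (if x \<in> set As \<and> ok \<and> N x \<le> c then 1 else mem s ''done'' x)"
            using 3(1) cN d2 by auto
          show "\<forall>x. mem s3 ''cnt'' x = 0"
            using 3(2) 2(1) e1(5) cnt by simp
          show "good s3" using 2(4) 3(5) by (simp add: good_def)
          show "set (outlist s) \<subseteq> set (outlist s3)" using 1(4) 2(5) 3(5) by simp
          show "\<forall>x\<in>set As. \<forall>w\<in>set As. \<forall>r<R. N x \<le> c \<longrightarrow> E r x w \<longrightarrow> joined s3 x w"
            using 2(6) cN 3(5) unfolding emitted_def by simp
          have "same level_vars s s1" using 1(5) by (rule same_mono) auto
          moreover have "same level_vars s1 s2" using 2(7) by (rule same_mono) auto
          moreover have "same level_vars s2 s3" using 3(6) by (rule same_mono) auto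
          ultimately show "same level_vars s s3" by (blast intro: same_trans)
          have sum_le: "\<tau> + 5 + 20 * u + 103 * v + 20 * w + 20 * (m + 1) \<le> \<tau> + 400 * Z"
            if "u \<le> Z" "v \<le> Z" "w \<le> Z" "m + 1 \<le> Z" for u v w m Z :: nat
            using that by simp
          define Z where "Z = (k + 1) * (c + 1) * (length As + 1)"
          have "(T + 1) * (k + 1) \<le> (c + 1) * (k + 1)" using T(2) by (intro mult_right_mono) simp_all
          also have "\<dots> = (k + 1) * (c + 1)" by (rule mult.commute)
          also have "\<dots> \<le> Z" by (simp add: Z_def)
          finally have b1: "(T + 1) * (k + 1) \<le> Z" .
          have "R * ((k + 1) * (length As + 1)) \<le> (c + 1) * ((k + 1) * (length As + 1))"
            using R(2) by (intro mult_right_mono) simp_all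
          then have b2: "R * ((k + 1) * (length As + 1)) \<le> Z" by (simp add: Z_def algebra_simps)
          have "length As * (c + 1) \<le> (c + 1) * (length As + 1)" by (simp add: algebra_simps)
          also have "\<dots> \<le> (k + 1) * ((c + 1) * (length As + 1))" by simp
          also have "\<dots> = Z" unfolding Z_def by (rule mult.assoc[symmetric])
          finally have b3: "length As * (c + 1) \<le> Z" .
          have b4: "length As + 1 \<le> Z" by (simp add: Z_def)
          have "\<tau>3 \<le> \<tau> + 5 + 20 * ((T + 1) * (k + 1)) + 103 * (R * ((k + 1) * (length As + 1))) +
              20 * (length As * (c + 1)) + 20 * (length As + 1)"
            using 1(6) 2(8) 3(7) by (simp add: algebra_simps)
          also have "\<dots> \<le> \<tau> + 400 * Z" by (rule sum_le[OF b1 b2 b3 b4])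
          finally show "\<tau>3 \<le> \<tau> + 400 * (k + 1) * (c + 1) * (length As + 1)" unfolding Z_def mult.assoc .
        qed (use 3 2(3) 1(3) in simp_all)
      qed
    qed
  qed
qed

lemma wp_build_active:
  fixes s :: "('a, 'b) state"
  assumes wf: "word_mem W s"
    and Q: "\<And>s' \<tau>'. active s' (filter (\<lambda>i. mem s ''done'' i = 0) [0..<n]) \<Longrightarrow> word_mem W s' \<Longrightarrow> source s' = source s \<Longrightarrow>
      outlist s' = outlist s \<Longrightarrow> same {''m'', ''i'', ''act'', ''e''} s s' \<Longrightarrow> \<tau>' \<le> \<tau> + 20 * (n + 1) \<Longrightarrow> Q s' \<tau>'"
  shows "wpm build_active Q s \<tau>"
proof -
  let ?N = "{''m'', ''i'', ''act'', ''e''}"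
  let ?L = "\<lambda>j. filter (\<lambda>i. mem s ''done'' i = 0) [0..<j]"
  let ?Inv = "\<lambda>j s' \<tau>'. active s' (?L j) \<and> word_mem W s' \<and> source s' = source s \<and>
      outlist s' = outlist s \<and> same ?N s s' \<and> \<tau>' \<le> \<tau> + 4 + 15 * j"
  show ?thesis
    unfolding build_active_def
  proof (intro wp_Seq wp_setv, rule wp_For[where N = n and Inv = ?Inv], goal_cases)
    case 3
    show ?case using wf by (simp add: active_def mem_store_fun same_store same_def)
  next
    case (5 j s1 \<tau>1)
    have a1: "active s1 (?L j)" and w1: "word_mem W s1" and sm: "same ?N s s1"
      and r1: "source s1 = source s" "outlist s1 = outlist s" "\<tau>1 \<le> \<tau> + 4 + 15 * j" using 5(2) by blast+
    have fr: "mem s1 ''done'' = mem s ''done''" using sameD[OF sm] by simp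
    have le: "length (?L j) \<le> j" using length_filter_le[of "\<lambda>i. mem s ''done'' i = 0" "[0..<j]"] by simp
    then have lt: "length (?L j) < n" using 5(1) by linarith
    have jW: "j mod W = j" "Suc j mod W = Suc j" "Suc (length (?L j)) mod W = Suc (length (?L j))"
      using 5(1) lt W by simp_all
    have m: "mem s1 ''m'' 0 = length (?L j)" using a1 by (simp add: active_def)
    show ?case
    proof (intro wp_Cond wp_Seq wp_setv wp_put, goal_cases)
      case 1
      then have "?L (Suc j) = ?L j" using fr 5(3) by simp
      then show ?case using a1 w1 sm r1 5(3) by (simp add: mem_store_fun same_store active_def)
    next
      case 2 show ?case by simp
    next
      case 3 show ?case by simp
    next
      case 4
      show ?case using m lt by simp
    next
      case g: 5
      then have "?L (Suc j) = ?L j @ [j]" using fr 5(3) by simp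
      then show ?case using a1 w1 sm r1 5(3) m lt jW
        by (simp add: mem_store_fun same_store active_def nth_append)
    qed
  next
    case (6 s1 \<tau>1)
    then show ?case by (intro Q) auto
  qed (use W in auto)
qed

end

section \<open>The complete program and its pathwise invariant\<close>

definition phase :: "real \<Rightarrow> com" where
  "phase r = Seq (setv ''cap'' (Times (var ''a3'') (var ''B''))) (Seq build_active (Seq (setv ''P'' (Const 1))
     (While (Less (var ''P'') (Plus (var ''B'') (Const 1)))
       (Seq (For ''k'' (var ''K'') (level r)) (setv ''P'' (Plus (var ''P'') (var ''P'')))))))"

text \<open>Doubling turns \<open>V\<close> into the least power of two not below the input size and
  \<open>L\<close> into its exponent plus one. The test against \<open>V + 1\<close> includes the
  phase with \<open>B = V\<close>.\<close>

definition program :: "real \<Rightarrow> nat \<Rightarrow> nat \<Rightarrow> com" where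
  "program r D q = Seq (setv ''V'' (Const 1)) (Seq (setv ''L'' (Const 1))
     (Seq (While (Less (var ''V'') Size)
        (Seq (setv ''V'' (Plus (var ''V'') (var ''V''))) (setv ''L'' (Plus (var ''L'') (Const 1)))))
     (Seq (setv ''K'' (Times (Const D) (var ''L'')))
     (Seq (setv ''a'' (Times (Const q) (Times (var ''L'') (Times (var ''L'') (var ''L'')))))
     (Seq (setv ''a3'' (Times (var ''a'') (Times (var ''a'') (var ''a''))))
     (Seq (setv ''B'' (Const 1))
     (While (Less (var ''B'') (Plus (var ''V'') (Const 1)))
       (Seq (phase r) (setv ''B'' (Plus (var ''B'') (var ''B'')))))))))))"

text \<open>The premise \<open>big\<close> rules out overflow: among the largest numbers computed
  are the cap \<open>a3 * 2 ^ I\<close> of the last phase and \<open>2 ^ Suc I\<close>, the value of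
  \<open>B\<close> and \<open>P\<close> when their last loops exit.\<close>

locale join_params = join_machine +
  fixes I D q :: nat
  assumes D: "0 < D" and q: "0 < q" and I: "n \<le> 2 ^ I" "I = 0 \<or> 2 ^ (I - 1) < n"
    and big: "(q * (Suc I * (Suc I * Suc I))) ^ 3 * 2 ^ Suc I + 2 < W" "D * Suc I < W"
begin

definition "L = Suc I"
definition "K = D * L"
definition "a = q * (L * (L * L))"
definition "a3 = a * (a * a)"

lemma a_pos: "0 < a" and a3_pos: "0 < a3" and K_pos: "0 < K" and L_pos: "0 < L"
  using D q by (simp_all add: a_def a3_def K_def L_def)

lemma a_le: "a \<le> a3" "a * a \<le> a3" "q \<le> a" "L * L \<le> a" "L * (L * L) \<le> a" "L \<le> a" "D \<le> K" "L \<le> K"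
proof -
  have "1 \<le> a" "1 \<le> L" using a_pos L_pos by simp_all
  then show "a \<le> a3" "a * a \<le> a3" by (simp_all add: a3_def)
  show "L * (L * L) \<le> a" using q by (simp add: a_def)
  moreover have "L * L \<le> L * (L * L)" using \<open>1 \<le> L\<close> by simp
  moreover have "L \<le> L * L" using \<open>1 \<le> L\<close> by simp
  ultimately show "L * L \<le> a" "L \<le> a" by linarith+
  show "q \<le> a" using \<open>1 \<le> L\<close> by (simp add: a_def)
  show "D \<le> K" "L \<le> K" using D \<open>1 \<le> L\<close> by (simp_all add: K_def)
qed

lemma a3W: "a3 * 2 ^ Suc I + 2 < W"
  using big(1) by (simp add: a3_def a_def L_def power3_eq_cube mult.assoc)

lemma pow_bounds:
  assumes "i \<le> b" "b \<le> I"
  shows "a3 * 2 ^ i \<le> a3 * 2 ^ b" "a * 2 ^ i \<le> a3 * 2 ^ b" "a3 * 2 ^ b + 1 < W"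
    "(2::nat) ^ Suc b + 1 < W"
proof -
  have ib: "(2::nat) ^ i \<le> 2 ^ b" "(2::nat) ^ b \<le> 2 ^ I" "(2::nat) ^ Suc b \<le> 2 ^ Suc I"
    using assms by (auto intro: power_increasing)
  have "(2::nat) ^ b \<le> 2 ^ Suc I" using assms by (intro power_increasing) simp_all
  then have "a3 * 2 ^ b \<le> a3 * 2 ^ Suc I" by simp
  then show "a3 * 2 ^ b + 1 < W" using a3W by linarith
  show "a3 * 2 ^ i \<le> a3 * 2 ^ b" using ib(1) by simp
  show "a * 2 ^ i \<le> a3 * 2 ^ b" using a_le(1) ib(1) by (rule mult_mono) simp_all
  have "2 ^ Suc b \<le> a3 * 2 ^ Suc I" using ib(3) a3_pos by (metis One_nat_def Suc_leI le_trans mult.commute mult_le_mono2 nat_mult_1_right)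
  then show "(2::nat) ^ Suc b + 1 < W" using a3W by linarith
qed

definition draws :: "nat \<Rightarrow> nat \<Rightarrow> nat" where
  "draws i k = a * 2 ^ i * k + a3 * 2 ^ i * k"

text \<open>The source position at which a level starts, with levels ordered by phase, then width,
  then exponent. No random choice enters it.\<close>

definition offset :: "nat \<Rightarrow> nat \<Rightarrow> nat \<Rightarrow> nat" where
  "offset b i k = (\<Sum>b'<b. \<Sum>i'<Suc b'. \<Sum>k'<K. draws i' k') + (\<Sum>i'<i. \<Sum>k'<K. draws i' k') + (\<Sum>k'<k. draws i k')"

definition passes :: "('a, 'b) source \<Rightarrow> nat \<Rightarrow> nat \<Rightarrow> nat \<Rightarrow> bool" where
  "passes \<omega> b i k \<longleftrightarrow> (\<exists>t<a * 2 ^ i. coin_success lam k (sdrop (offset b i k) \<omega>) t)"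

definition hit :: "('a, 'b) source \<Rightarrow> nat \<Rightarrow> nat \<Rightarrow> nat \<Rightarrow> nat \<Rightarrow> 'a \<Rightarrow> 'a \<Rightarrow> bool" where
  "hit \<omega> b i k r x y \<longleftrightarrow> all_collide k (sdrop (offset b i k + a * 2 ^ i * k) \<omega>) r x y"

text \<open>Counting all points instead of the active ones makes this a function of the source alone
  and an upper bound for the count of the program. The point itself is included; it accounts for the
  summand \<open>(1 / lam) ^ k\<close> of \<open>point_cost\<close>.\<close>

definition mates :: "('a, 'b) source \<Rightarrow> nat \<Rightarrow> nat \<Rightarrow> nat \<Rightarrow> nat \<Rightarrow> nat" where
  "mates \<omega> b i k x = (\<Sum>r<a3 * 2 ^ i. card {w. w < n \<and> hit \<omega> b i k r (xs ! x) (xs ! w)})"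

text \<open>It is random which level retires a point. A pair is therefore considered safe only if
  every level that passes its coins also brings the pair together, and then it does not matter which
  level it is.\<close>

definition found :: "('a, 'b) source \<Rightarrow> 'a \<Rightarrow> 'a \<Rightarrow> bool" where
  "found \<omega> x y \<longleftrightarrow> (\<forall>b\<le>I. \<forall>i\<le>b. \<forall>k<K. passes \<omega> b i k \<longrightarrow> (\<exists>r<a3 * 2 ^ i. hit \<omega> b i k r x y))"

text \<open>A superset of the points active in phase \<open>b\<close> that can be analysed without
  following the program.\<close>

definition survivors :: "('a, 'b) source \<Rightarrow> nat \<Rightarrow> nat set" where
  "survivors \<omega> b = {x. x < n \<and> (\<forall>b'<b. \<forall>i\<le>b'. \<forall>k<K. passes \<omega> b' i k \<longrightarrow> a3 * 2 ^ b' < mates \<omega> b' i k x)}"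

definition before :: "nat \<Rightarrow> nat \<Rightarrow> nat \<Rightarrow> nat \<Rightarrow> nat \<Rightarrow> nat \<Rightarrow> bool" where
  "before b' i' k' b i k \<longleftrightarrow> i' \<le> b' \<and> k' < K \<and> (b' < b \<or> b' = b \<and> (i' < i \<or> i' = i \<and> k' < k))"

abbreviation complete :: "('a, 'b) source \<Rightarrow> ('a, 'b) state \<Rightarrow> bool" where
  "complete \<omega> s \<equiv> \<forall>x<n. \<forall>w<n. lam \<le> sim (xs ! x) (xs ! w) \<longrightarrow>
     found \<omega> (xs ! x) (xs ! w) \<longrightarrow> emitted xs s x w"

lemma hit_sym: "hit \<omega> b i k r x y \<longleftrightarrow> hit \<omega> b i k r y x"
  by (auto simp: hit_def all_collide_def collides_def)

lemma found_sym: "found \<omega> x y \<longleftrightarrow> found \<omega> y x"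
  unfolding found_def using hit_sym by meson

text \<open>The output clause ranges over all \<open>w\<close>, retired or not: when the first of
  two points retires, the other one is still in the active list and has been compared with it. The
  last clause yields both the inclusion of the active points in \<open>survivors\<close> and, after
  the final phase, \<open>all_done\<close>.\<close>

definition join_inv :: "('a, 'b) source \<Rightarrow> nat \<Rightarrow> nat \<Rightarrow> nat \<Rightarrow> ('a, 'b) state \<Rightarrow> bool" where
  "join_inv \<omega> b i k s \<longleftrightarrow> good s \<and> word_mem W s \<and> (\<forall>x. mem s ''cnt'' x = 0) \<and>
     source s = sdrop (offset b i k) \<omega> \<and>
     (\<forall>x<n. \<forall>w<n. lam \<le> sim (xs ! x) (xs ! w) \<longrightarrow> found \<omega> (xs ! x) (xs ! w) \<longrightarrow> mem s ''done'' x \<noteq> 0 \<longrightarrow> emitted xs s x w) \<and>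
     (\<forall>x<n. mem s ''done'' x = 0 \<longrightarrow> (\<forall>b' i' k'. before b' i' k' b i k \<longrightarrow>
        passes \<omega> b' i' k' \<longrightarrow> a3 * 2 ^ b' < mates \<omega> b' i' k' x))"

text \<open>The part of the state that stays fixed during a phase.\<close>

definition phase_inv :: "nat \<Rightarrow> nat list \<Rightarrow> ('a, 'b) state \<Rightarrow> bool" where
  "phase_inv b As s \<longleftrightarrow> active s As \<and> mem s ''cap'' 0 = a3 * 2 ^ b \<and> mem s ''B'' 0 = 2 ^ b \<and>
     mem s ''V'' 0 = 2 ^ I \<and> mem s ''K'' 0 = K \<and> mem s ''a'' 0 = a \<and> mem s ''a3'' 0 = a3 \<and>
     (\<forall>x<n. x \<notin> set As \<longrightarrow> mem s ''done'' x \<noteq> 0)"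

lemma wp_level_step:
  fixes s :: "('a, 'b) state" and \<omega> :: "('a, 'b) source"
  assumes inv: "join_inv \<omega> b i k s" and ph: "phase_inv b As s" and As: "distinct As" "set As \<subseteq> {..<n}"
    and P: "mem s ''P'' 0 = 2 ^ i" and k: "mem s ''k'' 0 = k" "k < K" and b: "i \<le> b" "b \<le> I"
    and Q: "\<And>s' \<tau>'. join_inv \<omega> b i (Suc k) s' \<Longrightarrow> phase_inv b As s' \<Longrightarrow> same level_vars s s' \<Longrightarrow>
      \<tau>' \<le> \<tau> + 400 * (K * (a3 * 2 ^ b + 1) * (length As + 1)) \<Longrightarrow> Q s' \<tau>'"
  shows "wpm (level lam) Q s \<tau>"
proof -
  let ?T = "a * 2 ^ i" and ?R = "a3 * 2 ^ i" and ?c = "a3 * 2 ^ b"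
  let ?E = "\<lambda>r x w. hit \<omega> b i k r (xs ! x) (xs ! w)"
  let ?N = "\<lambda>x. \<Sum>r<?R. card {w \<in> set As. ?E r x w}"
  note bd = pow_bounds[OF b]
  have src: "source s = sdrop (offset b i k) \<omega>" using inv by (simp add: join_inv_def)
  have E: "?E = (\<lambda>r x w. all_collide k (sdrop (?T * k) (source s)) r (xs ! x) (xs ! w))"
    by (simp add: hit_def src)
  have ok: "passes \<omega> b i k \<longleftrightarrow> (\<exists>t<?T. coin_success lam k (source s) t)"
    by (simp add: passes_def src)
  have act: "active s As" and cap: "mem s ''cap'' 0 = ?c" and T: "mem s ''a'' 0 * mem s ''P'' 0 = ?T"
    and R: "mem s ''a3'' 0 * mem s ''P'' 0 = ?R"
    using ph P by (simp_all add: phase_inv_def)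
  have wf: "word_mem W s" and good: "good s" and cnt: "\<forall>x. mem s ''cnt'' x = 0"
    using inv by (simp_all add: join_inv_def)
  have NM: "?N x \<le> mates \<omega> b i k x" for x
    unfolding mates_def by (intro sum_mono card_mono) (use As(2) in auto)
  show ?thesis
  proof (rule wp_level[OF act As wf cap bd(3) k(1) T bd(2) R bd(1) cnt good ok E refl])
    fix s' \<tau>'
    assume 1: "\<forall>x. mem s' ''done'' x = (if x \<in> set As \<and> passes \<omega> b i k \<and> ?N x \<le> ?c then 1 else mem s ''done'' x)"
      "\<forall>x. mem s' ''cnt'' x = 0" "word_mem W s'" "source s' = sdrop (?T * k + ?R * k) (source s)" "good s'"
      "set (outlist s) \<subseteq> set (outlist s')"
      "\<forall>x\<in>set As. \<forall>w\<in>set As. \<forall>r<?R. ?N x \<le> ?c \<longrightarrow> ?E r x w \<longrightarrow> joined s' x w"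
      "same level_vars s s'"
      "\<tau>' \<le> \<tau> + 400 * (k + 1) * (?c + 1) * (length As + 1)"
    note fr = sameD[OF 1(8)]
    have old: "emitted xs s' x w" if "x < n" "w < n" "lam \<le> sim (xs ! x) (xs ! w)" "found \<omega> (xs ! x) (xs ! w)"
      "mem s ''done'' x \<noteq> 0" for x w
    proof -
      have "emitted xs s x w" using inv that unfolding join_inv_def by blast
      then show ?thesis using emitted_mono 1(6) by blast
    qed
    have em_sym: "emitted xs s' x w \<longleftrightarrow> emitted xs s' w x" for x w by (auto simp: emitted_def)
    \<comment> \<open>If neither point was retired before the level, \<open>x\<close> retires in it,
      so the coins pass and its scans are complete; \<open>found\<close> then supplies a repetition
      with a hit. Otherwise the invariant applies to the point retired earlier, and symmetry turns
      the pair around.\<close>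
    have new: "emitted xs s' x w" if x: "x < n" "w < n" "lam \<le> sim (xs ! x) (xs ! w)" "found \<omega> (xs ! x) (xs ! w)"
      "mem s' ''done'' x \<noteq> 0" for x w
    proof (cases "mem s ''done'' x = 0 \<and> mem s ''done'' w = 0")
      case True
      then have dx: "x \<in> set As" "passes \<omega> b i k" "?N x \<le> ?c" using x(5) 1(1) by (auto split: if_splits)
      have wA: "w \<in> set As" using True ph x(2) by (auto simp: phase_inv_def)
      obtain r where "r < ?R" "?E r x w" using x(4) dx(2) b k(2) unfolding found_def by blast
      then show ?thesis using 1(7) dx wA x(3) by blast
    next
      case False
      then consider "mem s ''done'' x \<noteq> 0" | "mem s ''done'' w \<noteq> 0" by auto
      then show ?thesis
      proof cases
        case 1
        then show ?thesis using old x by blast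
      next
        case 2
        then have "emitted xs s' w x" using old[of w x] x sim_sym[of "xs ! x" "xs ! w"] found_sym[of \<omega> "xs ! x" "xs ! w"] by simp
        then show ?thesis using em_sym by blast
      qed
    qed
    \<comment> \<open>A point that is not retired although the coins pass has exceeded the cap with
      active mates alone, hence also with all mates.\<close>
    have D2: "a3 * 2 ^ b' < mates \<omega> b' i' k' x"
      if "x < n" "mem s' ''done'' x = 0" "before b' i' k' b i (Suc k)" "passes \<omega> b' i' k'" for x b' i' k'
    proof (cases "before b' i' k' b i k")
      case True
      have "mem s ''done'' x = 0" using that(2) 1(1) by (auto split: if_splits)
      then show ?thesis using inv that True unfolding join_inv_def by blast
    next
      case False
      then have eq: "b' = b" "i' = i" "k' = k" using that(3) by (auto simp: before_def)
      have "mem s ''done'' x = 0" using that(2) 1(1) by (auto split: if_splits)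
      then have "x \<in> set As" using ph that(1) by (auto simp: phase_inv_def)
      then have "\<not> ?N x \<le> ?c" using 1(1) that eq by auto
      then show ?thesis using NM[of x] eq by simp
    qed
    have "join_inv \<omega> b i (Suc k) s'"
      unfolding join_inv_def
    proof (intro conjI)
      show "source s' = sdrop (offset b i (Suc k)) \<omega>"
        by (simp add: 1(4) src offset_def draws_def add.assoc)
    qed (use 1 new D2 in blast)+
    moreover have "phase_inv b As s'"
      using ph fr 1(1) by (simp add: phase_inv_def active_def)
    moreover have "\<tau>' \<le> \<tau> + 400 * (K * (?c + 1) * (length As + 1))"
    proof -
      have "(k + 1) * ((?c + 1) * (length As + 1)) \<le> K * ((?c + 1) * (length As + 1))"
        using k(2) by (intro mult_right_mono) simp_all
      then have "400 * ((k + 1) * ((?c + 1) * (length As + 1))) \<le> 400 * (K * ((?c + 1) * (length As + 1)))"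
        by (rule mult_left_mono) simp
      then show ?thesis using 1(9) unfolding mult.assoc by (meson add_left_mono le_trans)
    qed
    ultimately show "Q s' \<tau>'" using Q 1(8) by blast
  qed
qed

end

context join_params
begin

lemma join_inv_store:
  assumes "join_inv \<omega> b i k s" "v \<notin> {''cnt'', ''done''}"
  shows "join_inv \<omega> b i k (store W v j z s)"
proof -
  have "mem (store W v j z s) ''cnt'' = mem s ''cnt''" "mem (store W v j z s) ''done'' = mem s ''done''"
    using assms(2) by (auto simp: mem_store_fun)
  then show ?thesis using assms(1) by (simp add: join_inv_def good_def emitted_def)
qed

lemma phase_inv_store:
  assumes "phase_inv b As s" "v \<notin> {''m'', ''act'', ''cap'', ''B'', ''V'', ''K'', ''a'', ''a3'', ''done''}"
  shows "phase_inv b As (store W v j z s)"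
proof -
  have "mem (store W v j z s) u = mem s u"
    if "u \<in> {''m'', ''act'', ''cap'', ''B'', ''V'', ''K'', ''a'', ''a3'', ''done''}" for u
  proof -
    have "u \<noteq> v" using that assms(2) by blast
    then show ?thesis by (simp add: mem_store_fun)
  qed
  then show ?thesis using assms(1) by (simp add: phase_inv_def active_def)
qed

text \<open>Phase \<open>b\<close> runs through the width exponents 0 to \<open>b\<close>, so
  \<open>Suc b\<close> marks its end.\<close>

lemma offset_next: "offset b (Suc i) 0 = offset b i K" "offset (Suc b) 0 0 = offset b (Suc b) 0"
  by (simp_all add: offset_def)

lemma before_next:
  "before b' i' k' b (Suc i) 0 \<longleftrightarrow> before b' i' k' b i K"
  "before b' i' k' (Suc b) 0 0 \<longleftrightarrow> before b' i' k' b (Suc b) 0"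
  by (auto simp: before_def)

lemma join_inv_next_width: "join_inv \<omega> b i K s \<Longrightarrow> join_inv \<omega> b (Suc i) 0 s"
  unfolding join_inv_def offset_next before_next .

lemma join_inv_next_phase: "join_inv \<omega> b (Suc b) 0 s \<Longrightarrow> join_inv \<omega> (Suc b) 0 0 s"
  unfolding join_inv_def offset_next before_next .

lemma pow2_less: "(2::nat) ^ i < 2 ^ j + 1 \<longleftrightarrow> i \<le> j"
  unfolding Suc_eq_plus1[symmetric] less_Suc_eq_le by simp

lemma wp_levels:
  fixes s :: "('a, 'b) state" and \<omega> :: "('a, 'b) source"
  assumes inv: "join_inv \<omega> b i 0 s" and ph: "phase_inv b As s" and As: "distinct As" "set As \<subseteq> {..<n}"
    and P: "mem s ''P'' 0 = 2 ^ i" and b: "i \<le> b" "b \<le> I"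
    and Q: "\<And>s' \<tau>'. join_inv \<omega> b (Suc i) 0 s' \<Longrightarrow> phase_inv b As s' \<Longrightarrow> mem s' ''P'' 0 = 2 ^ i \<Longrightarrow>
      \<tau>' \<le> \<tau> + 3 + K * (400 * (K * (a3 * 2 ^ b + 1) * (length As + 1)) + 3) \<Longrightarrow> Q s' \<tau>'"
  shows "wpm (For ''k'' (var ''K'') (level lam)) Q s \<tau>"
proof -
  let ?Y = "400 * (K * (a3 * 2 ^ b + 1) * (length As + 1))"
  let ?Inv = "\<lambda>j s' \<tau>'. join_inv \<omega> b i j s' \<and> phase_inv b As s' \<and> mem s' ''P'' 0 = 2 ^ i \<and> \<tau>' \<le> \<tau> + 2 + j * (?Y + 3)"
  show ?thesis
  proof (rule wp_For[where N = K and Inv = ?Inv], goal_cases)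
    case 2
    show ?case using big(2) by (simp add: K_def L_def)
  next
    case 3
    show ?case using join_inv_store[OF inv] phase_inv_store[OF ph] P by (simp add: mem_store_fun)
  next
    case (4 j s1 \<tau>1)
    then show ?case by (simp add: phase_inv_def)
  next
    case (5 j s1 \<tau>1)
    have i1: "join_inv \<omega> b i j s1" "phase_inv b As s1" "mem s1 ''P'' 0 = 2 ^ i" and t1: "\<tau>1 \<le> \<tau> + 2 + j * (?Y + 3)"
      using 5(2) by blast+
    show ?case
    proof (rule wp_level_step[OF i1(1,2) As i1(3) 5(3,1) b])
      fix s' \<tau>'
      assume *: "join_inv \<omega> b i (Suc j) s'" "phase_inv b As s'" "same level_vars s1 s'" "\<tau>' \<le> \<tau>1 + 2 + ?Y"
      have "mem s' ''k'' 0 = j" "mem s' ''P'' 0 = 2 ^ i" using sameD[OF *(3)] 5(3) i1(3) by simp_all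
      moreover have "\<tau>' + 1 \<le> \<tau> + 2 + Suc j * (?Y + 3)" using *(4) t1 by simp
      ultimately show "mem s' ''k'' 0 = j \<and> ?Inv (Suc j) (store W ''k'' 0 (Suc j) s') (\<tau>' + 1)"
        using join_inv_store[OF *(1)] phase_inv_store[OF *(2)] by (simp add: mem_store_fun)
    qed
  next
    case (6 s1 \<tau>1)
    then have "join_inv \<omega> b (Suc i) 0 s1" using join_inv_next_width by blast
    then show ?case using 6 by (intro Q) auto
  qed simp
qed

text \<open>One factor \<open>K\<close> counts the exponents and the other bounds the factor
  \<open>k + 1\<close> of a single level. Replacing 400 by 420 absorbs the loop overhead, and the
  summand with \<open>n\<close> pays for \<open>build_active\<close>.\<close>

definition phase_time :: "('a, 'b) source \<Rightarrow> nat \<Rightarrow> nat" where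
  "phase_time \<omega> b = Suc b * (420 * (K * (K * ((a3 * 2 ^ b + 1) * (card (survivors \<omega> b) + 1))))) + 20 * n + 100"

lemma wp_phase:
  fixes s :: "('a, 'b) state" and \<omega> :: "('a, 'b) source"
  assumes inv: "join_inv \<omega> b 0 0 s" and b: "b \<le> I"
    and glob: "mem s ''B'' 0 = 2 ^ b" "mem s ''V'' 0 = 2 ^ I" "mem s ''K'' 0 = K" "mem s ''a'' 0 = a" "mem s ''a3'' 0 = a3"
    and Q: "\<And>s' \<tau>'. join_inv \<omega> (Suc b) 0 0 s' \<Longrightarrow> mem s' ''B'' 0 = 2 ^ b \<Longrightarrow> mem s' ''V'' 0 = 2 ^ I \<Longrightarrow>
      mem s' ''K'' 0 = K \<Longrightarrow> mem s' ''a'' 0 = a \<Longrightarrow> mem s' ''a3'' 0 = a3 \<Longrightarrow> \<tau>' \<le> \<tau> + phase_time \<omega> b \<Longrightarrow> Q s' \<tau>'"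
  shows "wpm (phase lam) Q s \<tau>"
proof -
  let ?c = "a3 * 2 ^ b"
  define As where "As = filter (\<lambda>i. mem s ''done'' i = 0) [0..<n]"
  have As: "distinct As" "set As \<subseteq> {..<n}" by (auto simp: As_def)
  \<comment> \<open>This replaces the actual active set in the time bound by a set that is defined
    from the source.\<close>
  have "set As \<subseteq> survivors \<omega> b"
  proof
    fix x assume "x \<in> set As"
    then have x: "x < n" "mem s ''done'' x = 0" by (auto simp: As_def)
    have "a3 * 2 ^ b' < mates \<omega> b' i k x" if "b' < b" "i \<le> b'" "k < K" "passes \<omega> b' i k" for b' i k
      using inv x that unfolding join_inv_def before_def by blast
    then show "x \<in> survivors \<omega> b" using x(1) by (simp add: survivors_def)
  qed
  then have "card (set As) \<le> card (survivors \<omega> b)" by (intro card_mono) (auto simp: survivors_def)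
  then have len: "length As \<le> card (survivors \<omega> b)" using distinct_card[OF As(1)] by simp
  let ?Y = "K * (?c + 1) * (length As + 1)"
  let ?Inv = "\<lambda>i s' \<tau>'. i \<le> Suc b \<and> mem s' ''P'' 0 = 2 ^ i \<and> join_inv \<omega> b i 0 s' \<and> phase_inv b As s' \<and>
     \<tau>' \<le> \<tau> + 20 * (n + 1) + 10 + i * (K * (400 * ?Y + 3) + 10)"
  have wf: "word_mem W s" using inv by (simp add: join_inv_def)
  have cW: "?c mod W = ?c" using pow_bounds[OF order_refl b] by simp
  let ?s0 = "store W ''cap'' 0 ?c s"
  have wf0: "word_mem W ?s0" using wf by simp
  have L0: "filter (\<lambda>i. mem ?s0 ''done'' i = 0) [0..<n] = As" by (simp add: As_def mem_store_fun)
  have "wpm build_active (wpm (Seq (setv ''P'' (Const 1))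
     (While (Less (var ''P'') (Plus (var ''B'') (Const 1)))
       (Seq (For ''k'' (var ''K'') (level lam)) (setv ''P'' (Plus (var ''P'') (var ''P'')))))) Q) ?s0 (\<tau> + 3)"
  proof (rule wp_build_active[OF wf0, unfolded L0])
    fix s1 \<tau>1
    assume 1: "active s1 As" "word_mem W s1" "source s1 = source ?s0" "outlist s1 = outlist ?s0"
      "same {''m'', ''i'', ''act'', ''e''} ?s0 s1" "\<tau>1 \<le> \<tau> + 3 + 20 * (n + 1)"
    have fr: "mem s1 v = mem ?s0 v" if "v \<notin> {''m'', ''i'', ''act'', ''e''}" for v using sameD[OF 1(5) that] .
    have ph1: "phase_inv b As s1"
      using glob 1(1) cW by (auto simp: phase_inv_def fr mem_store_fun As_def)
    have inv1: "join_inv \<omega> b 0 0 s1"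
    proof -
      have "mem s1 ''cnt'' = mem s ''cnt''" "mem s1 ''done'' = mem s ''done''" by (simp_all add: fr mem_store_fun)
      then show ?thesis using inv 1(2-4) by (simp add: join_inv_def good_def emitted_def)
    qed
    show "wpm (Seq (setv ''P'' (Const 1))
     (While (Less (var ''P'') (Plus (var ''B'') (Const 1)))
       (Seq (For ''k'' (var ''K'') (level lam)) (setv ''P'' (Plus (var ''P'') (var ''P'')))))) Q s1 \<tau>1"
    proof (intro wp_Seq wp_setv wp_While[where Inv = ?Inv and \<mu> = "\<lambda>i. Suc b - i" and g = 0], goal_cases)
      case 1
      show ?case using join_inv_store[OF inv1] phase_inv_store[OF ph1] \<open>\<tau>1 \<le> _\<close> by (simp add: mem_store_fun)
    next
      case (2 i s2 \<tau>2)
      have i2: "mem s2 ''P'' 0 = 2 ^ i" "join_inv \<omega> b i 0 s2" "phase_inv b As s2"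
        and t2: "\<tau>2 \<le> \<tau> + 20 * (n + 1) + 10 + i * (K * (400 * ?Y + 3) + 10)"
        using 2(1) by blast+
      have BW: "(2::nat) ^ b + 1 < W" using pow_bounds(4)[OF order_refl b] by simp
      have "(2::nat) ^ i < 2 ^ b + 1"
        using 2(2) i2 BW by (simp add: phase_inv_def split: if_splits)
      then have ib: "i \<le> b" by (simp only: pow2_less)
      show ?case
      proof (rule wp_levels[OF i2(2,3) As i2(1) ib b], intro wp_setv exI[of _ "Suc i"])
        fix s' \<tau>'
        assume *: "join_inv \<omega> b (Suc i) 0 s'" "phase_inv b As s'" "mem s' ''P'' 0 = 2 ^ i"
          "\<tau>' \<le> \<tau>2 + 1 + 1 + 3 + K * (400 * ?Y + 3)"
        have "(2::nat) ^ Suc i + 1 < W" using pow_bounds(4)[OF order_refl, of i] ib b by simp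
        then have PW: "(2 ^ i + 2 ^ i) mod W = (2::nat) ^ Suc i" "(2::nat) ^ Suc i mod W = 2 ^ Suc i" by simp_all
        have dec: "b - i < Suc b - i" using ib by arith
        have "\<tau>' + 1 \<le> \<tau> + 20 * (n + 1) + 10 + Suc i * (K * (400 * ?Y + 3) + 10)"
          using *(4) t2 by simp
        then show "?Inv (Suc i) (store W ''P'' 0 (eval W n (mem s') (Plus (var ''P'') (var ''P''))) s') (\<tau>' + 1) \<and>
            Suc b - Suc i < Suc b - i"
          using join_inv_store[OF *(1)] phase_inv_store[OF *(2)] *(3) PW ib dec by (simp add: mem_store_fun del: power_Suc)
      qed
    next
      case (3 i s2 \<tau>2)
      have i2: "i \<le> Suc b" "mem s2 ''P'' 0 = 2 ^ i" "join_inv \<omega> b i 0 s2" "phase_inv b As s2"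
        and t2: "\<tau>2 \<le> \<tau> + 20 * (n + 1) + 10 + i * (K * (400 * ?Y + 3) + 10)"
        using 3(1) by blast+
      have BW: "(2::nat) ^ b + 1 < W" using pow_bounds(4)[OF order_refl b] by simp
      have "\<not> (2::nat) ^ i < 2 ^ b + 1"
        using 3(2) i2 BW by (simp add: phase_inv_def split: if_splits)
      then have "\<not> i \<le> b" using pow2_less[of i b] by blast
      then have ib: "i = Suc b" using i2(1) by simp
      let ?Z = "K * ((?c + 1) * (card (survivors \<omega> b) + 1))"
      have Y: "?Y \<le> ?Z" unfolding mult.assoc using len by (intro mult_left_mono) simp_all
      have "1 \<le> K" using K_pos by simp
      then have "1 \<le> ?Z" by simp
      then have Z1: "K \<le> K * ?Z" "1 \<le> K * ?Z" using \<open>1 \<le> K\<close> by simp_all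
      have "K * (400 * ?Y + 3) + 10 \<le> K * (400 * ?Z + 3) + 10" using Y by simp
      also have "\<dots> = 400 * (K * ?Z) + 3 * K + 10" by (simp add: algebra_simps)
      also have "\<dots> \<le> 420 * (K * ?Z)" using Z1 by linarith
      finally have "Suc b * (K * (400 * ?Y + 3) + 10) \<le> Suc b * (420 * (K * ?Z))" by (rule mult_left_mono) simp
      moreover have "t + 1 \<le> \<tau> + (y + 20 * n + 100)" if "x \<le> y" "t \<le> \<tau> + 20 * (n + 1) + 10 + x" for t x y :: nat
        using that by simp
      ultimately have "\<tau>2 + 1 \<le> \<tau> + phase_time \<omega> b"
        using t2 unfolding ib phase_time_def by blast
      then show ?case
        using i2 join_inv_next_phase[of \<omega> b s2] unfolding ib by (intro Q) (simp_all add: phase_inv_def)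
    qed
  qed
  moreover have "eval W n (mem s) (Times (var ''a3'') (var ''B'')) = ?c" using glob cW by simp
  moreover have "\<tau> + 1 + 1 + 1 = \<tau> + 3" by simp
  ultimately show ?thesis
    unfolding phase_def by (intro wp_Seq[of _ _ _ "setv _ _"] wp_Seq[of _ _ _ build_active] wp_setv) (simp only:)
qed

text \<open>At exponent 0 the coins pass trivially and all points collide, so at width 1 a point has
  at most \<open>a3 * n\<close> mates. This is within the cap \<open>a3 * 2 ^ I\<close> of the last
  phase.\<close>

lemma all_done:
  assumes "join_inv \<omega> (Suc I) 0 0 s" "x < n"
  shows "mem s ''done'' x \<noteq> 0"
proof
  assume "mem s ''done'' x = 0"
  moreover have "before I 0 0 (Suc I) 0 0" using K_pos by (simp add: before_def)
  moreover have "passes \<omega> I 0 0" using a_pos by (auto simp: passes_def coin_success_def)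
  ultimately have "a3 * 2 ^ I < mates \<omega> I 0 0 x" using assms unfolding join_inv_def by blast
  also have "mates \<omega> I 0 0 x \<le> (\<Sum>r<a3. n)"
    unfolding mates_def power_0 mult_1_right
  proof (rule sum_mono)
    fix r
    have "card {w. w < n \<and> hit \<omega> I 0 0 r (xs ! x) (xs ! w)} \<le> card {..<n}" by (intro card_mono) auto
    then show "card {w. w < n \<and> hit \<omega> I 0 0 r (xs ! x) (xs ! w)} \<le> n" by simp
  qed
  also have "\<dots> \<le> a3 * 2 ^ I" using I(1) by simp
  finally show False by simp
qed

lemma wp_program:
  fixes \<omega> :: "('a, 'b) source"
  shows "wpm (program lam D q) (\<lambda>s \<tau>. good s \<and>
      complete \<omega> s \<and>
      \<tau> \<le> 100 * Suc I + (\<Sum>b<Suc I. phase_time \<omega> b + 10)) (init \<omega>) 0"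
proof -
  let ?Q = "\<lambda>s \<tau>. good s \<and>
      complete \<omega> s \<and>
      \<tau> \<le> 100 * Suc I + (\<Sum>b<Suc I. phase_time \<omega> b + 10)"
  have W0: "L < W" "L * L < W" "L * (L * L) < W" "q < W" "a < W" "a * a < W" "a3 < W" "D < W" "K < W" "(2::nat) ^ Suc I + 1 < W"
    using a_le pow_bounds[OF order_refl order_refl] pow_bounds(3)[of 0 0] big(2) by (simp_all add: K_def L_def)
  let ?V = "{''V'', ''L''}"
  let ?pre = "\<lambda>s :: ('a, 'b) state. join_inv \<omega> 0 0 0 s"
  let ?Inv1 = "\<lambda>j s \<tau>. j \<le> I \<and> ?pre s \<and> mem s ''V'' 0 = 2 ^ j \<and> mem s ''L'' 0 = Suc j \<and> \<tau> \<le> 10 + 10 * j"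
  let ?Inv2 = "\<lambda>b s \<tau>. b \<le> Suc I \<and> join_inv \<omega> b 0 0 s \<and> mem s ''B'' 0 = 2 ^ b \<and> mem s ''V'' 0 = 2 ^ I \<and>
      mem s ''K'' 0 = K \<and> mem s ''a'' 0 = a \<and> mem s ''a3'' 0 = a3 \<and> \<tau> \<le> 50 + 10 * I + (\<Sum>b'<b. phase_time \<omega> b' + 10)"
  have init: "join_inv \<omega> 0 0 0 (init \<omega>)"
    by (simp add: join_inv_def init_def good_def word_mem_def offset_def before_def)
  have main: "wpm (While (Less (var ''B'') (Plus (var ''V'') (Const 1)))
       (Seq (phase lam) (setv ''B'' (Plus (var ''B'') (var ''B''))))) ?Q s \<tau>" if "?Inv2 0 s \<tau>" for s \<tau>
  proof (rule wp_While[where Inv = ?Inv2 and \<mu> = "\<lambda>b. Suc I - b" and g = 0, OF that])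
    fix b s1 \<tau>1
    assume 1: "?Inv2 b s1 \<tau>1" and c: "eval W n (mem s1) (Less (var ''B'') (Plus (var ''V'') (Const 1))) \<noteq> 0"
    have "(2::nat) ^ b < 2 ^ I + 1" using c 1 W0(10) by (simp split: if_splits)
    then have bI: "b \<le> I" by (simp only: pow2_less)
    have j1: "join_inv \<omega> b 0 0 s1" "mem s1 ''B'' 0 = 2 ^ b" "mem s1 ''V'' 0 = 2 ^ I" "mem s1 ''K'' 0 = K"
      "mem s1 ''a'' 0 = a" "mem s1 ''a3'' 0 = a3" and t1: "\<tau>1 \<le> 50 + 10 * I + (\<Sum>b'<b. phase_time \<omega> b' + 10)"
      using 1 by blast+
    show "wpm (Seq (phase lam) (setv ''B'' (Plus (var ''B'') (var ''B''))))
      (\<lambda>s' \<tau>'. \<exists>g'. ?Inv2 g' s' \<tau>' \<and> Suc I - g' < Suc I - b) s1 (\<tau>1 + 1)"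
    proof (intro wp_Seq, rule wp_phase[OF j1(1) bI j1(2-6)], intro wp_setv exI[of _ "Suc b"])
      fix s' \<tau>'
      assume *: "join_inv \<omega> (Suc b) 0 0 s'" "mem s' ''B'' 0 = 2 ^ b" "mem s' ''V'' 0 = 2 ^ I" "mem s' ''K'' 0 = K"
        "mem s' ''a'' 0 = a" "mem s' ''a3'' 0 = a3" "\<tau>' \<le> \<tau>1 + 1 + 1 + phase_time \<omega> b"
      have "(2::nat) ^ Suc b + 1 < W" using pow_bounds(4)[OF order_refl bI] .
      then have BW: "(2 ^ b + 2 ^ b) mod W = (2::nat) ^ Suc b" "(2::nat) ^ Suc b mod W = 2 ^ Suc b" by simp_all
      have dec: "I - b < Suc I - b" using bI by arith
      have "\<tau>' + 1 \<le> 50 + 10 * I + (\<Sum>b'<Suc b. phase_time \<omega> b' + 10)" using *(7) t1 by simp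
      then show "?Inv2 (Suc b) (store W ''B'' 0 (eval W n (mem s') (Plus (var ''B'') (var ''B''))) s') (\<tau>' + 1) \<and>
          Suc I - Suc b < Suc I - b"
        using join_inv_store[OF *(1)] *(2-6) BW bI dec by (simp add: mem_store_fun del: power_Suc sum.lessThan_Suc)
    qed
  next
    fix b s1 \<tau>1
    assume 1: "?Inv2 b s1 \<tau>1" and c: "eval W n (mem s1) (Less (var ''B'') (Plus (var ''V'') (Const 1))) = 0"
    have "\<not> (2::nat) ^ b < 2 ^ I + 1" using c 1 W0(10) by (simp split: if_splits)
    then have "\<not> b \<le> I" using pow2_less[of b I] by blast
    then have b: "b = Suc I" using 1 by simp
    have j: "join_inv \<omega> (Suc I) 0 0 s1" using 1 b by simp
    have "\<tau>1 \<le> 50 + 10 * I + (\<Sum>b'<Suc I. phase_time \<omega> b' + 10)" using 1 b by blast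
    then have "\<tau>1 + 1 \<le> 100 * Suc I + (\<Sum>b<Suc I. phase_time \<omega> b + 10)" by simp
    moreover have "emitted xs s1 x w" if "x < n" "w < n" "lam \<le> sim (xs ! x) (xs ! w)" "found \<omega> (xs ! x) (xs ! w)" for x w
      using j all_done[OF j that(1)] that unfolding join_inv_def by blast
    moreover have "good s1" using j by (simp add: join_inv_def)
    ultimately show "?Q s1 (\<tau>1 + 1)" by blast
  qed
  show ?thesis
    unfolding program_def
  proof (intro wp_Seq wp_setv, rule wp_While[where Inv = ?Inv1 and \<mu> = "\<lambda>j. I - j" and g = 0], goal_cases)
    case 1
    show ?case using join_inv_store[OF join_inv_store[OF init]] by (simp add: mem_store_fun)
  next
    case (2 j s1 \<tau>1)
    have "(2::nat) ^ j < n" using 2 by (simp split: if_splits)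
    then have "(2::nat) ^ j < 2 ^ I" using I(1) by linarith
    then have "j < I" by simp
    have j1: "?pre s1" "mem s1 ''V'' 0 = 2 ^ j" "mem s1 ''L'' 0 = Suc j" "\<tau>1 \<le> 10 + 10 * j" using 2(1) by blast+
    have "(2::nat) ^ Suc j + 1 < W" using pow_bounds(4)[OF order_refl, of j] \<open>j < I\<close> by simp
    then have VW: "(2 ^ j + 2 ^ j) mod W = (2::nat) ^ Suc j" "(2::nat) ^ Suc j mod W = 2 ^ Suc j" by simp_all
    have dec: "I - Suc j < I - j" using \<open>j < I\<close> by arith
    have LW: "Suc (Suc j) mod W = Suc (Suc j)" using W0(1) \<open>j < I\<close> by (simp add: L_def)
    show ?case
      by (intro wp_Seq wp_setv exI[of _ "Suc j"])
        (use \<open>j < I\<close> dec j1 join_inv_store[OF join_inv_store[OF j1(1)]] in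
          \<open>simp add: mem_store_fun VW LW del: power_Suc\<close>)
  next
    case (3 j s1 \<tau>1)
    have "\<not> (2::nat) ^ j < n" using 3 by (simp split: if_splits)
    have "\<not> j < I"
    proof
      assume "j < I"
      then have "(2::nat) ^ j \<le> 2 ^ (I - 1)" by (intro power_increasing) auto
      moreover have "2 ^ (I - 1) < n" using I(2) \<open>j < I\<close> by auto
      ultimately show False using \<open>\<not> 2 ^ j < n\<close> by linarith
    qed
    then have j: "j = I" using 3(1) by simp
    have j1: "?pre s1" "mem s1 ''V'' 0 = 2 ^ I" "mem s1 ''L'' 0 = L" "\<tau>1 \<le> 10 + 10 * I" using 3(1) j by (simp_all add: L_def)
    have ev: "D * L = K" "q * (L * (L * L)) = a" "a * (a * a) = a3" by (simp_all add: K_def a_def a3_def)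
    note jst = join_inv_store[OF join_inv_store[OF join_inv_store[OF join_inv_store[OF j1(1)]]]]
    show ?case
      by (intro wp_Seq[of _ _ _ "setv _ _"] wp_setv main)
        (use j1 W0 jst in \<open>simp add: mem_store_fun ev\<close>)
  qed
qed

end

section \<open>Independent blocks of a random stream\<close>

context prob_space
begin

lemma stream_block_measurable:
  assumes [measurable]: "E \<in> events" "F \<in> sets (stream_space M)"
  shows "{\<omega> \<in> space (stream_space M). (\<forall>i<k. \<omega> !! (d + i) \<in> E) \<and> sdrop e \<omega> \<in> F} \<in> sets (stream_space M)"
  by measurable

text \<open>Induction on \<open>k\<close>, splitting off the head of the stream. The arbitrary event
  \<open>F\<close> on the remainder takes the role of an independence statement and gives the
  recursion for \<open>missed\<close>.\<close>

lemma emeasure_stream_prefix: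
  assumes E [measurable]: "E \<in> events" and F [measurable]: "F \<in> sets (stream_space M)"
  shows "emeasure (stream_space M) {\<omega> \<in> space (stream_space M). (\<forall>i<k. \<omega> !! i \<in> E) \<and> sdrop k \<omega> \<in> F} =
    emeasure M E ^ k * emeasure (stream_space M) F"
proof (induction k)
  case 0
  have "{\<omega> \<in> space (stream_space M). \<omega> \<in> F} = F" using sets.sets_into_space[OF F] by auto
  then show ?case by simp
next
  case (Suc k)
  let ?S = "stream_space M"
  let ?X = "\<lambda>k. {\<omega> \<in> space ?S. (\<forall>i<k. \<omega> !! i \<in> E) \<and> sdrop k \<omega> \<in> F}"
  have X: "?X k \<in> sets ?S" for k using stream_block_measurable[OF E F, of k 0 k] by (simp only: add_0)
  have "emeasure ?S (?X (Suc k)) = (\<integral>\<^sup>+ t. emeasure ?S {x \<in> space ?S. t ## x \<in> ?X (Suc k)} \<partial>M)"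
    by (rule emeasure_stream_space[OF X])
  also have "\<dots> = (\<integral>\<^sup>+ t. emeasure ?S (?X k) * indicator E t \<partial>M)"
  proof (rule nn_integral_cong)
    fix t assume t: "t \<in> space M"
    have "{x \<in> space ?S. t ## x \<in> ?X (Suc k)} = (if t \<in> E then ?X k else {})"
      using t by (auto simp: space_stream_space All_less_Suc2)
    then show "emeasure ?S {x \<in> space ?S. t ## x \<in> ?X (Suc k)} = emeasure ?S (?X k) * indicator E t"
      by simp
  qed
  also have "\<dots> = emeasure ?S (?X k) * emeasure M E" by (rule nn_integral_cmult_indicator) simp
  finally show ?case by (simp add: Suc mult_ac)
qed

lemma measure_stream_prefix:
  assumes "E \<in> events" and "F \<in> sets (stream_space M)"
  shows "measure (stream_space M) {\<omega> \<in> space (stream_space M). (\<forall>i<k. \<omega> !! i \<in> E) \<and> sdrop k \<omega> \<in> F} =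
    prob E ^ k * measure (stream_space M) F"
proof -
  interpret S: prob_space "stream_space M" by (rule prob_space_stream_space)
  show ?thesis
    using emeasure_stream_prefix[OF assms, of k]
    by (simp add: emeasure_eq_measure S.emeasure_eq_measure ennreal_power ennreal_mult'' [symmetric] mult_nonneg_nonneg)
qed

lemma measure_stream_sdrop:
  assumes F: "F \<in> sets (stream_space M)"
  shows "measure (stream_space M) {\<omega> \<in> space (stream_space M). sdrop k \<omega> \<in> F} = measure (stream_space M) F"
proof -
  have "{\<omega> \<in> space (stream_space M). (\<forall>i<k. \<omega> !! i \<in> space M) \<and> sdrop k \<omega> \<in> F} =
      {\<omega> \<in> space (stream_space M). sdrop k \<omega> \<in> F}"
    by (auto simp: space_stream_space streams_iff_snth)
  then show ?thesis using measure_stream_prefix[OF sets.top F, of k] by (simp add: prob_space)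
qed

text \<open>Used for two kinds of blocks: \<open>E\<close> is a coin showing heads, or a collision
  of two fixed points.\<close>

definition missed :: "'a set \<Rightarrow> nat \<Rightarrow> nat \<Rightarrow> 'a stream set" where
  "missed E k T = {\<omega> \<in> space (stream_space M). \<forall>t<T. \<not> (\<forall>i<k. \<omega> !! (t * k + i) \<in> E)}"

lemma missed_measurable:
  assumes [measurable]: "E \<in> events"
  shows "missed E k T \<in> sets (stream_space M)"
  unfolding missed_def by measurable

text \<open>The event for \<open>Suc T\<close> is \<open>?A - ?B\<close>, where \<open>?A\<close>
  says that all blocks after the first miss, and \<open>?B\<close> that moreover the first one hits.
  The probability of \<open>?B\<close> is \<open>prob E ^ k\<close> times that of
  \<open>?A\<close>.\<close>

lemma measure_missed:
  assumes E: "E \<in> events"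
  shows "measure (stream_space M) (missed E k T) = (1 - prob E ^ k) ^ T"
proof (induction T)
  case 0
  interpret S: prob_space "stream_space M" by (rule prob_space_stream_space)
  show ?case by (simp add: missed_def S.prob_space)
next
  case (Suc T)
  let ?S = "stream_space M"
  interpret S: prob_space ?S by (rule prob_space_stream_space)
  let ?A = "{\<omega> \<in> space ?S. sdrop k \<omega> \<in> missed E k T}"
  let ?B = "{\<omega> \<in> space ?S. (\<forall>i<k. \<omega> !! i \<in> E) \<and> sdrop k \<omega> \<in> missed E k T}"
  have F: "missed E k T \<in> sets ?S" by (rule missed_measurable[OF E])
  have B: "?B \<in> sets ?S" using stream_block_measurable[OF E F, of k 0 k] by (simp only: add_0)
  have A: "?A \<in> sets ?S" using measurable_sets[OF measurable_sdrop F] by (simp only: vimage_def Int_def mem_Collect_eq conj_commute)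
  have sp: "sdrop k \<omega> \<in> space ?S" if "\<omega> \<in> space ?S" for \<omega>
    using that by (auto simp: space_stream_space streams_iff_snth sdrop_snth)
  have "missed E k (Suc T) = ?A - ?B"
    using sp by (auto simp: missed_def sdrop_snth All_less_Suc2 add.assoc)
  then have "S.prob (missed E k (Suc T)) = S.prob ?A - S.prob ?B"
    using S.finite_measure_Diff[OF A B] by auto
  also have "\<dots> = (1 - prob E ^ k) * S.prob (missed E k T)"
    unfolding measure_stream_sdrop[OF F] measure_stream_prefix[OF E F] by (simp add: algebra_simps)
  finally show ?case by (simp add: Suc)
qed

lemma measure_missed_sdrop:
  assumes E: "E \<in> events"
  shows "measure (stream_space M) {\<omega> \<in> space (stream_space M). sdrop d \<omega> \<in> missed E k T} = (1 - prob E ^ k) ^ T"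
  using measure_stream_sdrop[OF missed_measurable[OF E]] measure_missed[OF E] by simp

lemma measure_block:
  assumes E: "E \<in> events"
  shows "measure (stream_space M) {\<omega> \<in> space (stream_space M). \<forall>i<k. \<omega> !! (d + i) \<in> E} = prob E ^ k"
proof -
  interpret S: prob_space "stream_space M" by (rule prob_space_stream_space)
  let ?F = "{\<omega> \<in> space (stream_space M). (\<forall>i<k. \<omega> !! i \<in> E) \<and> sdrop k \<omega> \<in> space (stream_space M)}"
  have F: "?F \<in> sets (stream_space M)"
    using stream_block_measurable[OF E sets.top, of k 0 k] by (simp only: add_0)
  have sp: "sdrop k \<omega> \<in> space (stream_space M)" if "\<omega> \<in> space (stream_space M)" for \<omega> k
    using that by (auto simp: space_stream_space streams_iff_snth sdrop_snth)
  have "{\<omega> \<in> space (stream_space M). sdrop d \<omega> \<in> ?F} = {\<omega> \<in> space (stream_space M). \<forall>i<k. \<omega> !! (d + i) \<in> E}"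
    using sp by (auto simp: sdrop_snth)
  then show ?thesis
    using measure_stream_sdrop[OF F, of d] measure_stream_prefix[OF E sets.top, of k] by (simp add: S.prob_space)
qed

end

section \<open>Recall and running time\<close>

text \<open>Multiply by \<open>1 + m * z \<le> (1 + z) ^ m\<close> and use
  \<open>(1 - z) * (1 + z) \<le> 1\<close>. This slow decay is enough, since the union bound asks
  only for an error of \<open>1 / a\<close> per level.\<close>

lemma one_minus_power_le:
  fixes z :: real
  assumes "0 \<le> z" "z \<le> 1"
  shows "(1 - z) ^ m \<le> 1 / (1 + m * z)"
proof -
  have "(1 - z) ^ m * (1 + m * z) \<le> (1 - z) ^ m * (1 + z) ^ m"
    using Bernoulli_inequality[of z m] assms by (intro mult_left_mono) auto
  also have "\<dots> = (1 - z * z) ^ m" by (simp add: power_mult_distrib[symmetric] algebra_simps)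
  also have "\<dots> \<le> 1" using assms by (intro power_le_one) (auto simp: mult_le_one)
  finally show ?thesis using assms by (simp add: field_simps add_pos_nonneg)
qed

lemma pow2_between:
  fixes y :: real
  assumes "1 \<le> y"
  obtains i :: nat where "y \<le> 2 ^ i" "2 ^ i \<le> 2 * y"
proof -
  obtain N where "y < 2 ^ N" using real_arch_pow[of 2 y] by auto
  then have ex: "\<exists>i. y \<le> 2 ^ i" by (meson less_imp_le)
  define i where "i = (LEAST i. y \<le> 2 ^ i)"
  have 1: "y \<le> 2 ^ i" unfolding i_def by (rule LeastI_ex[OF ex])
  have 2: "2 ^ i \<le> 2 * y"
  proof (cases i)
    case (Suc j)
    then have "\<not> y \<le> 2 ^ j" using not_less_Least[of j "\<lambda>i. y \<le> 2 ^ i"] by (simp add: i_def)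
    then show ?thesis by (simp add: Suc)
  qed (use assms in simp)
  show thesis by (rule that[OF 1 2])
qed

section \<open>Probabilities of the pathwise events\<close>

locale join_prob = join_params +
  fixes M :: "('a \<Rightarrow> 'b) measure"
  assumes lsh: "lsh_distribution M sim" and lam: "0 < lam" "lam < 1" and dist: "distinct xs"
    and D_lam: "2 \<le> (1 / lam) ^ D"
begin

abbreviation "U \<equiv> uniform_measure lborel {0..1::real}"
abbreviation "base \<equiv> U \<Otimes>\<^sub>M M"

sublocale M: prob_space M using lsh by (simp add: lsh_distribution_def)

sublocale U: prob_space U by (rule prob_space_uniform_measure) simp_all

sublocale B: pair_prob_space U M ..

sublocale R: prob_space "randomness M"
  unfolding randomness_def by (rule B.prob_space_stream_space)

abbreviation "\<Omega> \<equiv> space (randomness M)"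

lemma coll_sets: "{h \<in> space M. h x = h y} \<in> sets M" and
  coll_prob: "measure M {h \<in> space M. h x = h y} = sim x y"
  using lsh by (auto simp: lsh_distribution_def)

lemma sim_bounds: "0 \<le> sim x y" "sim x y \<le> 1" "sim x x = 1"
  unfolding coll_prob[symmetric] by (simp_all add: M.prob_space)

definition "coinE = {u \<in> space base. fst u < lam}"
definition "collE x y = {u \<in> space base. collides u x y}"

lemma coinE: "coinE \<in> sets base" "B.prob coinE = lam"
proof -
  have eq: "coinE = {..<lam} \<times> space M" by (auto simp: coinE_def space_pair_measure)
  show "coinE \<in> sets base" unfolding eq by (rule pair_measureI) auto
  have "{0..1} \<inter> {..<lam} = {0..<lam}" using lam by auto
  then have "emeasure U {..<lam} = ennreal lam" using lam by (simp add: divide_ennreal_def)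
  then have "emeasure base coinE = ennreal lam"
    unfolding eq by (subst M.emeasure_pair_measure_Times) (auto simp: M.emeasure_space_1)
  then show "B.prob coinE = lam" using lam by (simp add: measure_def)
qed

lemma collE: "collE x y \<in> sets base" "B.prob (collE x y) = sim x y"
proof -
  have eq: "collE x y = space U \<times> {h \<in> space M. h x = h y}"
    by (auto simp: collE_def space_pair_measure collides_def)
  show "collE x y \<in> sets base" unfolding eq using coll_sets by (intro pair_measureI) auto
  have "emeasure base (collE x y) = emeasure U (space U) * emeasure M {h \<in> space M. h x = h y}"
    unfolding eq by (rule M.emeasure_pair_measure_Times) (use coll_sets in auto)
  also have "\<dots> = ennreal (sim x y)"
    by (simp only: U.emeasure_space_1 mult_1 M.emeasure_eq_measure coll_prob)
  finally show "B.prob (collE x y) = sim x y" using sim_bounds(1) by (simp add: measure_def)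
qed

lemma snth_space: "\<omega> \<in> \<Omega> \<Longrightarrow> \<omega> !! i \<in> space base"
  by (simp add: randomness_def space_stream_space streams_iff_snth)

lemma sdrop_space: "\<omega> \<in> \<Omega> \<Longrightarrow> sdrop i \<omega> \<in> \<Omega>"
  by (simp add: randomness_def space_stream_space streams_iff_snth sdrop_snth)

definition "fails b i k = {\<omega> \<in> \<Omega>. \<not> passes \<omega> b i k}"
definition "misses b i k x y = {\<omega> \<in> \<Omega>. \<forall>r<a3 * 2 ^ i. \<not> hit \<omega> b i k r x y}"

lemma missed_eq:
  "{\<omega> \<in> \<Omega>. sdrop d \<omega> \<in> B.missed E k T} =
   {\<omega> \<in> \<Omega>. \<forall>t<T. \<not> (\<forall>i<k. sdrop d \<omega> !! (t * k + i) \<in> E)}"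
  using sdrop_space by (auto simp: B.missed_def randomness_def)

lemma fails_eq: "fails b i k = {\<omega> \<in> \<Omega>. sdrop (offset b i k) \<omega> \<in> B.missed coinE k (a * 2 ^ i)}"
  unfolding missed_eq fails_def passes_def coin_success_def coinE_def
  using snth_space sdrop_space by auto

lemma misses_eq: "misses b i k x y = {\<omega> \<in> \<Omega>.
    sdrop (offset b i k + a * 2 ^ i * k) \<omega> \<in> B.missed (collE x y) k (a3 * 2 ^ i)}"
  unfolding missed_eq misses_def hit_def all_collide_def collE_def
  using snth_space sdrop_space by auto

lemma sdrop_missed_sets:
  assumes "E \<in> sets base"
  shows "{\<omega> \<in> \<Omega>. sdrop d \<omega> \<in> B.missed E k T} \<in> sets (randomness M)"
  using measurable_sets[OF measurable_sdrop B.missed_measurable[OF assms]]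
  by (simp only: vimage_def Int_def mem_Collect_eq conj_commute randomness_def)

lemma fails: "fails b i k \<in> sets (randomness M)" "R.prob (fails b i k) = (1 - lam ^ k) ^ (a * 2 ^ i)"
  unfolding fails_eq
  using sdrop_missed_sets[OF coinE(1)] B.measure_missed_sdrop[OF coinE(1)]
  by (simp_all only: randomness_def coinE(2))

lemma misses: "misses b i k x y \<in> sets (randomness M)"
  "R.prob (misses b i k x y) = (1 - sim x y ^ k) ^ (a3 * 2 ^ i)"
  unfolding misses_eq
  using sdrop_missed_sets[OF collE(1)] B.measure_missed_sdrop[OF collE(1)]
  by (simp_all only: randomness_def collE(2))

lemma hits: "{\<omega> \<in> \<Omega>. hit \<omega> b i k r x y} \<in> sets (randomness M)"
  "R.prob {\<omega> \<in> \<Omega>. hit \<omega> b i k r x y} = sim x y ^ k"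
proof -
  let ?d = "offset b i k + a * 2 ^ i * k + r * k"
  have eq: "{\<omega> \<in> \<Omega>. hit \<omega> b i k r x y} =
      {\<omega> \<in> \<Omega>. \<forall>j<k. \<omega> !! (?d + j) \<in> collE x y}"
    using snth_space by (auto simp: hit_def all_collide_def collE_def sdrop_snth add.assoc)
  show "R.prob {\<omega> \<in> \<Omega>. hit \<omega> b i k r x y} = sim x y ^ k"
    unfolding eq using B.measure_block[OF collE(1)] by (simp only: randomness_def collE(2))
  show "{\<omega> \<in> \<Omega>. hit \<omega> b i k r x y} \<in> sets (randomness M)"
  proof -
    let ?S = "stream_space base"
    have "{\<omega> \<in> space ?S. (\<forall>j<k. \<omega> !! (?d + j) \<in> collE x y) \<and> sdrop 0 \<omega> \<in> space ?S} \<in> sets ?S"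
      by (rule B.stream_block_measurable[OF collE(1) sets.top])
    also have "{\<omega> \<in> space ?S. (\<forall>j<k. \<omega> !! (?d + j) \<in> collE x y) \<and> sdrop 0 \<omega> \<in> space ?S} =
        {\<omega> \<in> space ?S. \<forall>j<k. \<omega> !! (?d + j) \<in> collE x y}" by auto
    finally show ?thesis unfolding eq unfolding randomness_def .
  qed
qed

text \<open>In each of two regimes one of the events alone is unlikely. If
  \<open>a ^ 2 * 2 ^ i * lam ^ k \<le> 1\<close>, the \<open>a * 2 ^ i\<close> trials pass with
  probability at most \<open>a * 2 ^ i * lam ^ k \<le> 1 / a\<close>, by Bernoulli's inequality.
  Otherwise the \<open>a ^ 3 * 2 ^ i\<close> repetitions produce more than \<open>a\<close> hits in
  expectation, and all of them miss with probability at most \<open>1 / a\<close>.\<close>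

lemma bad_prob:
  assumes "lam \<le> sim x y"
  shows "R.prob (misses b i k x y - fails b i k) \<le> 1 / a"
proof (cases "real a * real a * 2 ^ i * lam ^ k \<le> 1")
  case True
  have "R.prob (misses b i k x y - fails b i k) \<le> R.prob (\<Omega> - fails b i k)"
  proof (rule R.finite_measure_mono)
    show "misses b i k x y - fails b i k \<subseteq> \<Omega> - fails b i k"
      by (auto simp: misses_def)
    show "\<Omega> - fails b i k \<in> sets (randomness M)" by (rule sets.compl_sets[OF fails(1)])
  qed
  also have "\<dots> = 1 - (1 - lam ^ k) ^ (a * 2 ^ i)" using R.prob_compl[OF fails(1)] fails(2) by simp
  also have "\<dots> \<le> real (a * 2 ^ i) * lam ^ k"
    using Bernoulli_inequality[of "- (lam ^ k)" "a * 2 ^ i"] lam by (simp add: power_le_one)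
  also have "\<dots> \<le> 1 / a" using True a_pos by (simp add: field_simps)
  finally show ?thesis .
next
  case False
  have lk: "0 < lam ^ k" "lam ^ k \<le> 1" "lam ^ k \<le> sim x y ^ k" "sim x y ^ k \<le> 1"
    using lam assms sim_bounds by (auto intro: power_mono power_le_one)
  have "R.prob (misses b i k x y - fails b i k) \<le> R.prob (misses b i k x y)"
    by (rule R.finite_measure_mono[OF Diff_subset misses(1)])
  also have "\<dots> = (1 - sim x y ^ k) ^ (a3 * 2 ^ i)" by (rule misses(2))
  also have "\<dots> \<le> (1 - lam ^ k) ^ (a3 * 2 ^ i)" using lk by (intro power_mono) auto
  also have "\<dots> \<le> 1 / (1 + (a3 * 2 ^ i) * lam ^ k)" using one_minus_power_le[of "lam ^ k" "a3 * 2 ^ i"] lk by simp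
  also have "\<dots> \<le> 1 / a"
  proof (rule divide_left_mono)
    have "real a * 1 \<le> real a * (real a * real a * 2 ^ i * lam ^ k)"
      using False by (intro mult_left_mono) auto
    also have "\<dots> = (a3 * 2 ^ i) * lam ^ k" by (simp add: a3_def)
    finally show "real a \<le> 1 + (a3 * 2 ^ i) * lam ^ k" by simp
    show "0 < (1 + (a3 * 2 ^ i) * lam ^ k) * real a"
      using a_pos lk by (intro mult_pos_pos add_pos_nonneg) auto
  qed simp
  finally show ?thesis .
qed

text \<open>A union bound over \<open>L * L * K = D * L ^ 3\<close> triples, each of them bad with
  probability at most \<open>1 / a = 1 / (q * L ^ 3)\<close>. The measurable superset
  \<open>Z\<close> will be the event that the pair is reported.\<close>

lemma found_prob:
  assumes "lam \<le> sim x y" "{\<omega> \<in> \<Omega>. found \<omega> x y} \<subseteq> Z" "Z \<in> sets (randomness M)"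
  shows "1 - real D / q \<le> R.prob Z"
proof -
  let ?J = "{..I} \<times> {..I} \<times> {..<K}"
  let ?bad = "\<Union>(b, i, k)\<in>?J. misses b i k x y - fails b i k"
  have bad: "?bad \<in> sets (randomness M)"
    using misses(1) fails(1) by (intro sets.finite_UN) (auto intro!: sets.Diff)
  have "R.prob ?bad \<le> (\<Sum>(b, i, k)\<in>?J. R.prob (misses b i k x y - fails b i k))"
    using R.finite_measure_subadditive_finite[of ?J "\<lambda>(b, i, k). misses b i k x y - fails b i k"] misses(1) fails(1)
    by (auto simp: case_prod_beta image_subset_iff intro!: sets.Diff)
  also have "\<dots> \<le> (\<Sum>_\<in>?J. 1 / real a)"
    using bad_prob[OF assms(1)] by (intro sum_mono) auto
  also have "\<dots> = real (L * (L * K)) / a" by (simp add: L_def)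
  also have "\<dots> = real D / q"
  proof -
    have "a * D = q * (L * (L * K))" by (simp add: a_def K_def)
    then have "real a * real D = real q * real (L * (L * K))" by (simp only: of_nat_mult[symmetric])
    then show ?thesis using a_pos q by (simp add: field_simps)
  qed
  finally have 1: "R.prob ?bad \<le> real D / q" .
  have "\<Omega> - Z \<subseteq> ?bad"
  proof
    fix \<omega> assume \<omega>: "\<omega> \<in> \<Omega> - Z"
    then have "\<not> found \<omega> x y" using assms(2) by auto
    then obtain b i k where "b \<le> I" "i \<le> b" "k < K" "passes \<omega> b i k" "\<forall>r<a3 * 2 ^ i. \<not> hit \<omega> b i k r x y"
      unfolding found_def by blast
    then have "\<omega> \<in> misses b i k x y - fails b i k" "(b, i, k) \<in> ?J"
      using \<omega> by (auto simp: misses_def fails_def)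
    then show "\<omega> \<in> ?bad" by blast
  qed
  then have "R.prob (\<Omega> - Z) \<le> R.prob ?bad" by (rule R.finite_measure_mono[OF _ bad])
  then show ?thesis using 1 R.prob_compl[OF assms(3)] by simp
qed

end

context join_prob
begin

definition "F x = (INF k. point_cost lam sim (set xs) (xs ! x) k)"

lemma sum_nth_xs: "(\<Sum>w<n. f (xs ! w)) = (\<Sum>y\<in>set xs. f y)"
  using sum.reindex_bij_betw[OF bij_betw_nth[OF dist refl refl], of f] by simp

text \<open>The minimizing exponent is among those tried: exponent 0 costs exactly \<open>n\<close>,
  whereas for \<open>k \<ge> K\<close> already \<open>(1 / lam) ^ k \<ge> 2 ^ L = 2 * 2 ^ I\<close>,
  which exceeds \<open>n\<close>.\<close>

lemma F_attained:
  assumes x: "x < n"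
  obtains k where "F x = point_cost lam sim (set xs) (xs ! x) k" "1 \<le> F x" "(1 / lam) ^ k \<le> F x" "k < K"
    "F x = (1 / lam) ^ k * (\<Sum>w<n. sim (xs ! x) (xs ! w) ^ k)"
proof -
  obtain k where k: "point_cost lam sim (set xs) (xs ! x) k = F x"
    using point_cost_min[of lam sim "set xs" "xs ! x"] lam sim_bounds(1) by (auto simp: F_def)
  have ge: "(1 / lam) ^ j \<le> point_cost lam sim (set xs) (xs ! x) j" for j
    using lam sim_bounds(1) by (auto simp: point_cost_def intro!: sum_nonneg)
  have xs: "xs ! x \<in> set xs" using x by simp
  have bdd: "bdd_below (range (point_cost lam sim (set xs) (xs ! x)))"
  proof (rule bdd_belowI[of _ 0], clarify)
    fix j
    have "0 \<le> (1 / lam) ^ j" using lam by simp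
    then show "0 \<le> point_cost lam sim (set xs) (xs ! x) j" using ge[of j] by linarith
  qed
  have "F x \<le> point_cost lam sim (set xs) (xs ! x) 0" unfolding F_def by (rule cINF_lower[OF bdd]) simp
  also have "\<dots> = real n"
  proof -
    have "card (set xs - {xs ! x}) = n - 1" using xs by (simp add: distinct_card[OF dist])
    then show ?thesis using x by (simp add: point_cost_def)
  qed
  finally have Fn: "F x \<le> real n" .
  have one: "1 \<le> 1 / lam" using lam by simp
  have 1: "(1 / lam) ^ k \<le> F x" using ge[of k] k by simp
  have F1: "1 \<le> F x" using one_le_power[OF one, of k] 1 by linarith
  have kK: "k < K"
  proof (rule ccontr)
    assume "\<not> k < K"
    then have "((1 / lam) ^ D) ^ L \<le> (1 / lam) ^ k"
      unfolding power_mult[symmetric] using one by (intro power_increasing) (auto simp: K_def)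
    moreover have "2 ^ L \<le> ((1 / lam) ^ D) ^ L" using D_lam by (intro power_mono) auto
    moreover have "real n \<le> 2 ^ I" using I(1) by (metis of_nat_le_iff of_nat_numeral of_nat_power)
    moreover have "(2::real) ^ L = 2 * 2 ^ I" by (simp add: L_def)
    moreover have "(0::real) < 2 ^ I" by simp
    ultimately show False using 1 Fn by linarith
  qed
  have "(\<Sum>w<n. sim (xs ! x) (xs ! w) ^ k) = 1 + (\<Sum>y\<in>set xs - {xs ! x}. sim (xs ! x) y ^ k)"
    unfolding sum_nth_xs[of "\<lambda>y. sim (xs ! x) y ^ k"] using xs by (subst sum.remove[OF _ xs]) (auto simp: sim_bounds(3))
  then have "F x = (1 / lam) ^ k * (\<Sum>w<n. sim (xs ! x) (xs ! w) ^ k)"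
    unfolding k[symmetric] point_cost_def
    by (simp add: power_divide algebra_simps sum_distrib_left sum_divide_distrib)
  then show thesis using that k 1 F1 kK by metis
qed

text \<open>The count is a sum of indicators, whose expectations add up however the hits depend on
  each other; Markov's inequality does the rest.\<close>

lemma mates_prob:
  fixes b i k x :: nat and c :: real
  assumes c: "0 < c"
  defines "Z \<equiv> {\<omega> \<in> \<Omega>. c \<le> real (mates \<omega> b i k x)}"
  shows "Z \<in> sets (randomness M)"
    and "R.prob Z \<le> real (a3 * 2 ^ i) * (\<Sum>w<n. sim (xs ! x) (xs ! w) ^ k) / c"
proof -
  define H where "H = (\<lambda>r w. {\<omega> \<in> \<Omega>. hit \<omega> b i k r (xs ! x) (xs ! w)})"
  define g :: "('a, 'b) source \<Rightarrow> real" where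
    "g = (\<lambda>\<omega>. \<Sum>r<a3 * 2 ^ i. \<Sum>w<n. indicator (H r w) \<omega>)"
  have H [measurable]: "H r w \<in> sets (randomness M)" for r w unfolding H_def by (rule hits(1))
  have g: "real (mates \<omega> b i k x) = g \<omega>" if "\<omega> \<in> \<Omega>" for \<omega>
  proof -
    have "real (card {w. w < n \<and> hit \<omega> b i k r (xs ! x) (xs ! w)}) = (\<Sum>w<n. indicator (H r w) \<omega>)" for r
    proof -
      have "(\<Sum>w<n. indicator (H r w) \<omega> :: real) = (\<Sum>w<n. of_bool (hit \<omega> b i k r (xs ! x) (xs ! w)))"
        using that by (intro sum.cong refl) (auto simp: H_def indicator_def)
      also have "\<dots> = real (card ({..<n} \<inter> {w. hit \<omega> b i k r (xs ! x) (xs ! w)}))"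
        by (subst sum_of_bool_eq) (rule finite_lessThan, rule refl)
      also have "{..<n} \<inter> {w. hit \<omega> b i k r (xs ! x) (xs ! w)} = {w. w < n \<and> hit \<omega> b i k r (xs ! x) (xs ! w)}"
        by auto
      finally show ?thesis by simp
    qed
    then show ?thesis by (simp add: mates_def g_def)
  qed
  have gm: "g \<in> borel_measurable (randomness M)" unfolding g_def by measurable
  have Zg: "Z = {\<omega> \<in> \<Omega>. c \<le> g \<omega>}" using g by (auto simp: Z_def)
  show "Z \<in> sets (randomness M)" unfolding Zg using gm by measurable
  have int: "integrable (randomness M) (\<lambda>\<omega>. indicator (H r w) \<omega> :: real)" for r w
    by (rule integrable_real_indicator) (auto simp: R.emeasure_eq_measure)
  have gi: "integrable (randomness M) g" unfolding g_def using int by (intro Bochner_Integration.integrable_sum)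
  have "R.expectation g = (\<Sum>r<a3 * 2 ^ i. \<Sum>w<n. R.prob (H r w))"
    unfolding g_def using int by (simp add: Bochner_Integration.integral_sum)
  also have "\<dots> = real (a3 * 2 ^ i) * (\<Sum>w<n. sim (xs ! x) (xs ! w) ^ k)"
    unfolding H_def hits(2) by simp
  finally have E: "R.expectation g = real (a3 * 2 ^ i) * (\<Sum>w<n. sim (xs ! x) (xs ! w) ^ k)" .
  have "R.prob {\<omega> \<in> \<Omega>. c \<le> g \<omega>} \<le> R.expectation g / c"
    by (rule integral_Markov_inequality_measure[OF gi sets.empty_sets]) (use c in \<open>auto simp: g_def intro!: sum_nonneg\<close>)
  then show "R.prob Z \<le> real (a3 * 2 ^ i) * (\<Sum>w<n. sim (xs ! x) (xs ! w) ^ k) / c"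
    unfolding Zg E .
qed

text \<open>For \<open>2 ^ b < 4 * F x\<close> the bound exceeds 1. Otherwise one level of the
  preceding phase \<open>b'\<close> suffices: the optimal \<open>k\<close> with the width
  \<open>(1 / lam) ^ k \<le> 2 ^ i \<le> 2 * (1 / lam) ^ k\<close>, which is at most
  \<open>2 * F x \<le> 2 ^ b'\<close> and hence is tried in that phase. To survive it, the coins
  must fail or the mates exceed the cap; these have probability at most \<open>F x / 2 ^ b'\<close>
  and \<open>2 * F x / 2 ^ b'\<close>.\<close>

lemma survival_prob:
  assumes x: "x < n" and b: "b \<le> I"
  obtains Z where "Z \<in> sets (randomness M)" "{\<omega> \<in> \<Omega>. x \<in> survivors \<omega> b} \<subseteq> Z"
    "R.prob Z \<le> 8 * F x / 2 ^ b"
proof (cases "2 ^ b < 4 * F x")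
  case True
  obtain k where "1 \<le> F x" using F_attained[OF x] by blast
  have "1 \<le> 8 * F x / 2 ^ b" using True \<open>1 \<le> F x\<close> by (simp add: field_simps)
  then show thesis using that[of "\<Omega>"] by (auto simp: R.prob_space)
next
  case False
  obtain k where F1: "1 \<le> F x" and Fk: "(1 / lam) ^ k \<le> F x" and kK: "k < K"
    and Fs: "F x = (1 / lam) ^ k * (\<Sum>w<n. sim (xs ! x) (xs ! w) ^ k)"
    using F_attained[OF x] by blast
  obtain b' where b': "b = Suc b'" using False F1 by (cases b) auto
  obtain i :: nat where i: "(1 / lam) ^ k \<le> 2 ^ i" "2 ^ i \<le> 2 * (1 / lam) ^ k"
    using pow2_between[of "(1 / lam) ^ k"] lam by (auto simp: one_le_power)
  have "\<not> 2 ^ b' < 2 * F x" using False b' by simp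
  then have "(2::real) ^ i \<le> 2 ^ b'" using i(2) Fk by linarith
  then have ib: "i \<le> b'" by simp
  let ?c = "real (a3 * 2 ^ b')"
  have c: "0 < ?c" using a3_pos by simp
  let ?N = "{\<omega> \<in> \<Omega>. ?c \<le> real (mates \<omega> b' i k x)}"
  note N = mates_prob[OF c, of b' i k x]
  let ?Z = "fails b' i k \<union> ?N"
  have "R.prob (fails b' i k) \<le> 1 / 2 ^ b'"
  proof -
    have lk: "0 \<le> lam ^ k" "lam ^ k \<le> 1" using lam by (auto intro: power_le_one)
    have "1 \<le> 2 ^ i * lam ^ k" using i(1) lam by (simp add: power_divide field_simps)
    have "(1 - lam ^ k) ^ (2 ^ i) \<le> 1 / (1 + real (2 ^ i) * lam ^ k)" by (rule one_minus_power_le[OF lk])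
    also have "\<dots> \<le> 1 / 2" using \<open>1 \<le> 2 ^ i * lam ^ k\<close> by (simp add: field_simps)
    finally have half: "(1 - lam ^ k) ^ (2 ^ i) \<le> 1 / 2" .
    have "R.prob (fails b' i k) = ((1 - lam ^ k) ^ (2 ^ i)) ^ a" unfolding fails(2) by (simp add: power_mult[symmetric] mult.commute)
    also have "\<dots> \<le> (1 / 2) ^ a" using half lk by (intro power_mono) auto
    \<comment> \<open>The factor \<open>a \<ge> L > b'\<close> in the number of trials turns a
      failure probability of 1/2 into \<open>1 / 2 ^ b'\<close>.\<close>
    also have "\<dots> \<le> (1 / 2) ^ b'"
      using a_le(6) b b' by (intro power_decreasing) (auto simp: L_def)
    finally show ?thesis by (simp add: power_divide)
  qed
  also have "\<dots> \<le> F x / 2 ^ b'" using F1 by (simp add: divide_right_mono)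
  finally have p1: "R.prob (fails b' i k) \<le> F x / 2 ^ b'" .
  have "R.prob ?N \<le> real (a3 * 2 ^ i) * (\<Sum>w<n. sim (xs ! x) (xs ! w) ^ k) / ?c" by (rule N(2))
  also have "\<dots> = 2 ^ i * (\<Sum>w<n. sim (xs ! x) (xs ! w) ^ k) / 2 ^ b'" using a3_pos by simp
  also have "\<dots> \<le> 2 * (1 / lam) ^ k * (\<Sum>w<n. sim (xs ! x) (xs ! w) ^ k) / 2 ^ b'"
    using i(2) sim_bounds(1) by (intro divide_right_mono mult_right_mono sum_nonneg) auto
  also have "\<dots> = 2 * F x / 2 ^ b'" by (simp add: Fs)
  finally have p2: "R.prob ?N \<le> 2 * F x / 2 ^ b'" .
  have "R.prob ?Z \<le> R.prob (fails b' i k) + R.prob ?N"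
    by (rule measure_Un_le[OF fails(1) N(1)])
  also have "\<dots> \<le> F x / 2 ^ b' + 2 * F x / 2 ^ b'" using p1 p2 by (rule add_mono)
  also have "\<dots> \<le> 8 * F x / 2 ^ b" using F1 b' by (simp add: field_simps)
  finally have p: "R.prob ?Z \<le> 8 * F x / 2 ^ b" .
  have "{\<omega> \<in> \<Omega>. x \<in> survivors \<omega> b} \<subseteq> ?Z"
  proof
    fix \<omega> assume w: "\<omega> \<in> {\<omega> \<in> \<Omega>. x \<in> survivors \<omega> b}"
    show "\<omega> \<in> ?Z"
    proof (cases "passes \<omega> b' i k")
      case True
      then have "a3 * 2 ^ b' < mates \<omega> b' i k x" using w ib kK b' by (simp add: survivors_def)
      then have "?c \<le> real (mates \<omega> b' i k x)" by linarith
      then show ?thesis using w by simp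
    next
      case False
      then show ?thesis using w by (simp add: fails_def)
    qed
  qed
  then show thesis using that[of ?Z] p fails(1) N(1) by blast
qed

end

text \<open>A halted configuration never changes, so all halting times show the same output, namely
  that of the run provided by \<open>wp\<close>.\<close>

lemma wp_halts:
  fixes \<omega> :: "('a, 'b) source"
  assumes "wp ((length xs + 2) ^ \<kappa>) sim xs c Q (init \<omega>) 0"
  obtains s t where "halted (c, \<kappa>) sim xs \<omega> t" "run_time (c, \<kappa>) sim xs \<omega> \<le> of_nat t"
    "reported (c, \<kappa>) sim xs \<omega> = set (outlist s)" "Q s t"
proof -
  let ?f = "step ((length xs + 2) ^ \<kappa>) sim xs"
  obtain s t where r: "runs ((length xs + 2) ^ \<kappa>) sim xs c (init \<omega>) s t" and Q: "Q s t"
    using assms unfolding wp_def by auto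
  have t: "conf (c, \<kappa>) sim xs \<omega> t = ([], s)" using r by (simp add: conf_def runs_def)
  then have halt: "halted (c, \<kappa>) sim xs \<omega> t" by (simp add: halted_def)
  have stay: "conf (c, \<kappa>) sim xs \<omega> (u + d) = conf (c, \<kappa>) sim xs \<omega> u" if h: "halted (c, \<kappa>) sim xs \<omega> u" for u d
  proof (induction d)
    case (Suc d)
    obtain s' where "conf (c, \<kappa>) sim xs \<omega> u = ([], s')"
      using h unfolding halted_def by (metis prod.collapse)
    then show ?case using Suc by (simp add: conf_Suc)
  qed simp
  have uniq: "conf (c, \<kappa>) sim xs \<omega> u = ([], s)" if u: "halted (c, \<kappa>) sim xs \<omega> u" for u
  proof (cases "u \<le> t")
    case True
    then show ?thesis using stay[OF u, of "t - u"] t by simp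
  next
    case False
    then show ?thesis using stay[OF halt, of "u - t"] t by simp
  qed
  have "reported (c, \<kappa>) sim xs \<omega> = set (outlist s)"
    unfolding reported_def using halt uniq by auto
  moreover have "run_time (c, \<kappa>) sim xs \<omega> \<le> of_nat t"
    using halt Least_le[of "halted (c, \<kappa>) sim xs \<omega>" t] by (auto simp: run_time_def)
  ultimately show thesis using that halt Q by blast
qed

context join_prob
begin

lemma phase_time_bound:
  assumes "b \<le> I"
  shows "real (phase_time \<omega> b) \<le> 840 * real L * real K ^ 2 * real a3 * 2 ^ b * (real (card (survivors \<omega> b)) + 1) + 20 * real n + 100"
proof -
  let ?X = "real K ^ 2 * (real (card (survivors \<omega> b)) + 1)"
  have "real (phase_time \<omega> b) = real (Suc b) * (420 * ?X * (real a3 * 2 ^ b + 1)) + 20 * real n + 100"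
    by (simp add: phase_time_def power2_eq_square algebra_simps)
  also have "real (Suc b) * (420 * ?X * (real a3 * 2 ^ b + 1)) \<le> real L * (420 * ?X * (2 * (real a3 * 2 ^ b)))"
  proof (intro mult_mono mult_left_mono)
    have "1 * 1 \<le> real a3 * 2 ^ b" using a3_pos by (intro mult_mono) auto
    then show "real a3 * 2 ^ b + 1 \<le> 2 * (real a3 * 2 ^ b)" by linarith
  qed (use assms in \<open>auto simp: L_def\<close>)
  also have "\<dots> = 840 * real L * real K ^ 2 * real a3 * 2 ^ b * (real (card (survivors \<omega> b)) + 1)"
    by (simp add: mult_ac)
  finally show ?thesis by simp
qed

abbreviation "alg \<kappa> \<equiv> (program lam D q, \<kappa> :: nat)"

lemma program_run:
  fixes \<omega> :: "('a, 'b) source"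
  assumes W: "W = (n + 2) ^ \<kappa>"
  obtains s :: "('a, 'b) state" and t where "halted (alg \<kappa>) sim xs \<omega> t"
    "run_time (alg \<kappa>) sim xs \<omega> \<le> of_nat t"
    "reported (alg \<kappa>) sim xs \<omega> = set (outlist s)" "good s"
    "complete \<omega> s"
    "t \<le> 100 * Suc I + (\<Sum>b<Suc I. phase_time \<omega> b + 10)"
proof (rule wp_halts)
  show "wp ((n + 2) ^ \<kappa>) sim xs (program lam D q) (\<lambda>s \<tau>. good s \<and>
      complete \<omega> s \<and>
      \<tau> \<le> 100 * Suc I + (\<Sum>b<Suc I. phase_time \<omega> b + 10)) (init \<omega>) 0"
    unfolding W[symmetric] by (rule wp_program)
next
  fix s :: "('a, 'b) state" and t
  assume 1: "halted (alg \<kappa>) sim xs \<omega> t"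
    "run_time (alg \<kappa>) sim xs \<omega> \<le> of_nat t"
    "reported (alg \<kappa>) sim xs \<omega> = set (outlist s)"
    and 2: "good s \<and>
      complete \<omega> s \<and>
      t \<le> 100 * Suc I + (\<Sum>b<Suc I. phase_time \<omega> b + 10)"
  show thesis
    by (rule that[OF 1 conjunct1[OF 2] conjunct1[OF conjunct2[OF 2]] conjunct2[OF conjunct2[OF 2]]])
qed

text \<open>The run time is dominated pointwise by the integrable function \<open>T\<close>, built
  from measurable supersets \<open>Z x b\<close> of the survival events. In each phase the cost
  factor \<open>2 ^ b\<close> cancels against the survival probability
  \<open>8 * F x / 2 ^ b\<close>.\<close>

lemma expected_time_bound:
  assumes W: "W = (n + 2) ^ \<kappa>" and n: "2 \<le> n"
  shows "expected_time (alg \<kappa>) sim M xs \<le>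
    ennreal (10000 * real L ^ 2 * real K ^ 2 * real a3 * (\<Sum>x<n. F x))"
proof -
  let ?Y = "840 * real L * real K ^ 2 * real a3"
  define Z where "Z = (\<lambda>x b. SOME Z. Z \<in> sets (randomness M) \<and>
    {\<omega> \<in> \<Omega>. x \<in> survivors \<omega> b} \<subseteq> Z \<and> R.prob Z \<le> 8 * F x / 2 ^ b)"
  have "Z x b \<in> sets (randomness M) \<and> {\<omega> \<in> \<Omega>. x \<in> survivors \<omega> b} \<subseteq> Z x b \<and>
      R.prob (Z x b) \<le> 8 * F x / 2 ^ b" if "x < n" "b \<le> I" for x b
    unfolding Z_def by (rule someI_ex, rule survival_prob[OF that]) blast
  then have Z: "\<And>x b. x < n \<Longrightarrow> b \<le> I \<Longrightarrow> Z x b \<in> sets (randomness M)"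
    "\<And>x b. x < n \<Longrightarrow> b \<le> I \<Longrightarrow> {\<omega> \<in> \<Omega>. x \<in> survivors \<omega> b} \<subseteq> Z x b"
    "\<And>x b. x < n \<Longrightarrow> b \<le> I \<Longrightarrow> R.prob (Z x b) \<le> 8 * F x / 2 ^ b"
    by blast+
  define G where "G = (\<lambda>b \<omega>. ?Y * 2 ^ b * ((\<Sum>x<n. indicator (Z x b) \<omega>) + 1) + (20 * real n + 110))"
  define T where "T = (\<lambda>\<omega>. 100 * real L + (\<Sum>b<Suc I. G b \<omega>))"
  have int: "integrable (randomness M) (\<lambda>\<omega>. indicator (Z x b) \<omega> :: real)" if "x < n" "b \<le> I" for x b
    using Z(1)[OF that] by (intro integrable_real_indicator) (auto simp: R.emeasure_eq_measure)
  have intS: "integrable (randomness M) (\<lambda>\<omega>. \<Sum>x<n. indicator (Z x b) \<omega> :: real)" if "b \<le> I" for b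
    using int that by (intro Bochner_Integration.integrable_sum) auto
  have intB: "integrable (randomness M) (G b)" if "b \<le> I" for b
    unfolding G_def using intS[OF that]
    by (intro Bochner_Integration.integrable_add integrable_mult_right R.integrable_const)
  have intG: "integrable (randomness M) (\<lambda>\<omega>. \<Sum>b<Suc I. G b \<omega>)"
    using intB by (intro Bochner_Integration.integrable_sum) auto
  have intT: "integrable (randomness M) T"
    unfolding T_def using intG by (intro Bochner_Integration.integrable_add R.integrable_const)
  have T0: "0 \<le> T \<omega>" for \<omega>
    unfolding T_def G_def by (intro add_nonneg_nonneg sum_nonneg mult_nonneg_nonneg) auto
  have le: "run_time (alg \<kappa>) sim xs \<omega> \<le> ennreal (T \<omega>)" if \<omega>: "\<omega> \<in> \<Omega>" for \<omega>
  proof -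
    obtain s t where rt: "run_time (alg \<kappa>) sim xs \<omega> \<le> of_nat t"
      and t: "t \<le> 100 * Suc I + (\<Sum>b<Suc I. phase_time \<omega> b + 10)"
      by (rule program_run[OF W, of \<omega>])
    have "real t \<le> real (100 * Suc I + (\<Sum>b<Suc I. phase_time \<omega> b + 10))" using t by (rule of_nat_mono)
    also have "\<dots> = 100 * real L + (\<Sum>b<Suc I. real (phase_time \<omega> b) + 10)" by (simp add: L_def)
    also have "\<dots> \<le> T \<omega>" unfolding T_def G_def
    proof (intro add_left_mono sum_mono)
      fix b assume "b \<in> {..<Suc I}"
      then have b: "b \<le> I" by simp
      have "real (card (survivors \<omega> b)) = (\<Sum>x\<in>survivors \<omega> b. 1)" by simp
      also have "\<dots> \<le> (\<Sum>x\<in>survivors \<omega> b. indicator (Z x b) \<omega>)"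
        using Z(2)[OF _ b] \<omega> by (intro sum_mono) (force simp: survivors_def indicator_def)
      also have "\<dots> \<le> (\<Sum>x<n. indicator (Z x b) \<omega>)"
        by (intro sum_mono2) (auto simp: survivors_def)
      finally have "?Y * 2 ^ b * (real (card (survivors \<omega> b)) + 1) \<le> ?Y * 2 ^ b * ((\<Sum>x<n. indicator (Z x b) \<omega>) + 1)"
        by (intro mult_left_mono) auto
      then show "real (phase_time \<omega> b) + 10 \<le> ?Y * 2 ^ b * ((\<Sum>x<n. indicator (Z x b) \<omega>) + 1) + (20 * real n + 110)"
        using phase_time_bound[OF b, of \<omega>] by linarith
    qed
    finally have "ennreal (real t) \<le> ennreal (T \<omega>)" by (rule ennreal_leI)
    then show ?thesis using rt by (simp add: ennreal_of_nat_eq_real_of_nat)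
  qed
  have F1: "1 \<le> F x" if "x < n" for x using F_attained[OF that] by metis
  have "(\<Sum>x<n. 1::real) \<le> (\<Sum>x<n. F x)" using F1 by (intro sum_mono) auto
  then have nF: "real n \<le> (\<Sum>x<n. F x)" by simp
  have "2 ^ I \<le> 2 * n"
  proof (cases I)
    case (Suc j)
    then show ?thesis using I(2) by simp
  qed (use n in simp)
  then have "real (2 ^ I) \<le> real (2 * n)" by (rule of_nat_mono)
  then have pI: "2 ^ I \<le> 2 * real n" by simp
  let ?S = "\<Sum>x<n. F x"
  have EG: "R.expectation (G b) = ?Y * 2 ^ b * ((\<Sum>x<n. R.prob (Z x b)) + 1) + (20 * real n + 110)" if b: "b \<le> I" for b
  proof -
    have "R.expectation (\<lambda>\<omega>. \<Sum>x<n. indicator (Z x b) \<omega> :: real) = (\<Sum>x<n. R.expectation (\<lambda>\<omega>. indicator (Z x b) \<omega>))"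
      using int b by (intro Bochner_Integration.integral_sum) auto
    also have "\<dots> = (\<Sum>x<n. R.prob (Z x b))" using Z(1)[OF _ b] by (intro sum.cong) auto
    finally show ?thesis unfolding G_def using intS[OF b] by (simp add: R.prob_space)
  qed
  have "R.expectation T = 100 * real L + R.expectation (\<lambda>\<omega>. \<Sum>b<Suc I. G b \<omega>)"
    unfolding T_def by (subst Bochner_Integration.integral_add[OF R.integrable_const intG]) (simp add: R.prob_space)
  also have "R.expectation (\<lambda>\<omega>. \<Sum>b<Suc I. G b \<omega>) = (\<Sum>b<Suc I. R.expectation (G b))"
    using intB by (intro Bochner_Integration.integral_sum) auto
  also have "\<dots> = (\<Sum>b<Suc I. ?Y * 2 ^ b * ((\<Sum>x<n. R.prob (Z x b)) + 1) + (20 * real n + 110))"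
    by (intro sum.cong EG) auto
  also have "100 * real L + (\<Sum>b<Suc I. ?Y * 2 ^ b * ((\<Sum>x<n. R.prob (Z x b)) + 1) + (20 * real n + 110)) \<le>
      100 * real L + (\<Sum>b<Suc I. ?Y * (10 * ?S) + 130 * ?S)"
  proof (intro add_left_mono sum_mono)
    fix b assume "b \<in> {..<Suc I}"
    then have b: "b \<le> I" by simp
    have "(\<Sum>x<n. R.prob (Z x b)) \<le> (\<Sum>x<n. 8 * F x / 2 ^ b)" using Z(3)[OF _ b] by (intro sum_mono) auto
    also have "\<dots> = 8 * ?S / 2 ^ b" by (simp add: sum_distrib_left sum_divide_distrib)
    finally have "2 ^ b * ((\<Sum>x<n. R.prob (Z x b)) + 1) \<le> 2 ^ b * (8 * ?S / 2 ^ b + 1)" by (intro mult_left_mono) auto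
    \<comment> \<open>The leftover \<open>2 ^ b\<close>, due to the \<open>+ 1\<close> in the number
      of active points, is at most \<open>2 * n\<close>, and \<open>n \<le> ?S\<close> because every
      \<open>F x\<close> is at least 1.\<close>
    also have "\<dots> = 8 * ?S + 2 ^ b" by (simp add: field_simps)
    also have "(2::real) ^ b \<le> 2 ^ I" using b by (intro power_increasing) auto
    finally have "2 ^ b * ((\<Sum>x<n. R.prob (Z x b)) + 1) \<le> 10 * ?S" using pI nF by linarith
    then have "?Y * (2 ^ b * ((\<Sum>x<n. R.prob (Z x b)) + 1)) \<le> ?Y * (10 * ?S)" by (intro mult_left_mono) auto
    moreover have "20 * real n + 110 \<le> 130 * ?S" using nF n by linarith
    ultimately have "?Y * (2 ^ b * ((\<Sum>x<n. R.prob (Z x b)) + 1)) + (20 * real n + 110) \<le> ?Y * (10 * ?S) + 130 * ?S"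
      by (rule add_mono)
    then show "?Y * 2 ^ b * ((\<Sum>x<n. R.prob (Z x b)) + 1) + (20 * real n + 110) \<le> ?Y * (10 * ?S) + 130 * ?S"
      by (simp only: mult.assoc)
  qed
  also have "\<dots> = 100 * real L + 8400 * (real L ^ 2 * real K ^ 2 * real a3 * ?S) + 130 * (L * ?S)"
    by (simp add: L_def power2_eq_square algebra_simps)
  \<comment> \<open>All factors are at least 1, so both lower-order terms are bounded by the main
    product, and 8400 + 100 + 130 is below 10000.\<close>
  also have "\<dots> \<le> 10000 * (real L ^ 2 * real K ^ 2 * real a3 * ?S)"
  proof -
    have S1: "1 \<le> ?S" using nF n by linarith
    have "1 \<le> real L" "1 \<le> real K" "1 \<le> real a3" using L_pos K_pos a3_pos by simp_all
    then have "real L * 1 * 1 * 1 \<le> real L ^ 2 * real K ^ 2 * real a3 * 1"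
      by (intro mult_mono) (auto simp: self_le_power one_le_power)
    then have X: "real L \<le> real L ^ 2 * real K ^ 2 * real a3" by simp
    have "L * ?S \<le> real L ^ 2 * real K ^ 2 * real a3 * ?S" using X S1 by (intro mult_right_mono) auto
    moreover have "real L * 1 \<le> real L * ?S" using S1 by (intro mult_left_mono) auto
    ultimately show ?thesis by linarith
  qed
  finally have E: "R.expectation T \<le> 10000 * real L ^ 2 * real K ^ 2 * real a3 * ?S" by (simp add: mult.assoc)
  have "expected_time (alg \<kappa>) sim M xs \<le> (\<integral>\<^sup>+ \<omega>. ennreal (T \<omega>) \<partial>randomness M)"
    unfolding expected_time_def by (intro nn_integral_mono le)
  also have "\<dots> = ennreal (R.expectation T)" using intT T0 by (intro nn_integral_eq_integral) auto
  also have "\<dots> \<le> ennreal (10000 * real L ^ 2 * real K ^ 2 * real a3 * ?S)" using E by (rule ennreal_leI)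
  finally show ?thesis .
qed

end

section \<open>Checks of the program text, choice of the constants, conclusion\<close>

definition program_vars :: "string set" where
  "program_vars = level_vars \<union>
     {''V'', ''L'', ''K'', ''a'', ''a3'', ''B'', ''cap'', ''m'', ''i'', ''act'', ''P'', ''k''}"

lemma ix_eq_ix: "\<exists>g. ix f = ix g"
  by blast

lemma program_bounded_writes: "bounded_writes program_vars (program r D q)"
  unfolding program_def phase_def build_active_def level_def retire_def coin_def rep_def scan_def scan_body_def
    init_list_def refine_def refine_body_def For_def program_vars_def
  by (simp add: ix_eq_ix)

lemma program_flips_only: "flips_only r (program r D q)"
  unfolding program_def phase_def build_active_def level_def retire_def coin_def rep_def scan_def scan_body_def
    init_list_def refine_def refine_body_def For_def
  by simp

context join_prob
begin

text \<open>Halting and soundness hold for every \<open>\<omega>\<close>; recall follows from the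
  inclusion of the event \<open>found\<close> in the event that the pair is reported.\<close>

lemma program_solves:
  assumes W: "W = (n + 2) ^ \<kappa>" and phi: "phi \<le> 1 - real D / q"
  shows "solves_self_join (alg \<kappa>) lam phi sim M xs"
  unfolding solves_self_join_def
proof (intro conjI ballI impI)
  have "\<exists>t. halted (alg \<kappa>) sim xs \<omega> t" for \<omega> :: "('a, 'b) source"
    by (rule program_run[OF W, of \<omega>]) blast
  then show "AE \<omega> in randomness M. \<exists>t. halted (alg \<kappa>) sim xs \<omega> t" by simp
next
  fix \<omega> :: "('a, 'b) source"
  show "reported (alg \<kappa>) sim xs \<omega> \<subseteq> {(x, y). x \<in> set xs \<and> y \<in> set xs \<and> lam \<le> sim x y}"
    by (rule program_run[OF W, of \<omega>]) (simp add: good_def)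
next
  fix x y assume xy: "x \<in> set xs" "y \<in> set xs" "lam \<le> sim x y"
  let ?Z = "{\<omega> \<in> \<Omega>. (x, y) \<in> reported (alg \<kappa>) sim xs \<omega>}"
  obtain i j where ij: "i < n" "j < n" "x = xs ! i" "y = xs ! j" using xy by (auto simp: in_set_conv_nth)
  have Z: "?Z \<in> sets (randomness M)" by (rule reported_measurable[OF coll_sets program_flips_only])
  have "{\<omega> \<in> \<Omega>. found \<omega> x y} \<subseteq> ?Z"
  proof clarify
    fix \<omega> assume w: "\<omega> \<in> \<Omega>" "found \<omega> x y"
    obtain s :: "('a, 'b) state" where s: "reported (alg \<kappa>) sim xs \<omega> = set (outlist s)"
      "complete \<omega> s"
      by (rule program_run[OF W, of \<omega>])
    have "emitted xs s i j" using s(2) ij xy(3) w(2) by simp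
    then show "(x, y) \<in> reported (alg \<kappa>) sim xs \<omega>" using s(1) ij by (simp add: emitted_def)
  qed
  from found_prob[OF xy(3) this Z] show "phi \<le> measure (randomness M) ?Z" using phi by linarith
qed

end

text \<open>Crude estimates keep the exponent independent of \<open>n\<close>: for
  \<open>m = n + 2\<close> one has \<open>Suc I \<le> m ^ 2\<close>,
  \<open>2 ^ Suc I \<le> m ^ 3\<close> and \<open>q \<le> m ^ q\<close>. The product then needs the
  exponent \<open>3 * (q + 6) + 3 = 3 * q + 21\<close>, the additive 2 costs two more, and
  \<open>D * Suc I\<close> needs \<open>D + 2\<close>.\<close>

lemma word_size_suffices:
  fixes n D q I :: nat
  assumes I: "I = 0 \<or> 2 ^ (I - 1) < n" and q: "0 < q"
  defines "W \<equiv> (n + 2) ^ (3 * q + D + 23)"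
  shows "(q * (Suc I * (Suc I * Suc I))) ^ 3 * 2 ^ Suc I + 2 < W" "D * Suc I < W" "n + 2 \<le> W"
proof -
  define m where "m = n + 2"
  have m: "2 \<le> m" by (simp add: m_def)
  have pw: "2 ^ I \<le> 2 * m"
  proof (cases I)
    case (Suc j)
    then show ?thesis using I by (simp add: m_def)
  qed (simp add: m_def)
  have m2: "2 * m \<le> m ^ 2" using m by (simp add: power2_eq_square)
  have "Suc I \<le> 2 ^ I" by (rule Suc_leI[OF less_exp])
  then have SI: "Suc I \<le> m ^ 2" using pw m2 by linarith
  have "2 ^ Suc I \<le> 2 * (2 * m)" using pw by simp
  also have "\<dots> \<le> m * m ^ 2" using m m2 by (intro mult_mono) auto
  finally have p3: "2 ^ Suc I \<le> m ^ 3" by (simp add: power3_eq_cube power2_eq_square)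
  have le_pow: "c \<le> m ^ c" for c
  proof -
    have "c < 2 ^ c" by (rule less_exp)
    also have "2 ^ c \<le> m ^ c" using m by (rule power_mono) simp
    finally show ?thesis by simp
  qed
  have "(q * (Suc I * (Suc I * Suc I))) ^ 3 * 2 ^ Suc I \<le> (m ^ q * (m ^ 2 * (m ^ 2 * m ^ 2))) ^ 3 * m ^ 3"
    using SI le_pow[of q] p3 by (intro mult_mono power_mono) auto
  also have "\<dots> = m ^ (3 * q + 21)" by (simp add: power_add[symmetric] power_mult[symmetric] power_mult_distrib algebra_simps)
  finally have A: "(q * (Suc I * (Suc I * Suc I))) ^ 3 * 2 ^ Suc I \<le> m ^ (3 * q + 21)" .
  have one: "1 \<le> m ^ (3 * q + 21)" using m by simp
  have "m ^ (3 * q + 21) + 2 < 4 * m ^ (3 * q + 21)" using one by linarith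
  also have "\<dots> \<le> m ^ 2 * m ^ (3 * q + 21)" using m power_mono[of 2 m 2] by (intro mult_right_mono) auto
  also have "\<dots> = m ^ (3 * q + 23)" by (simp add: power_add[symmetric] add.commute)
  also have "\<dots> \<le> W" unfolding W_def m_def[symmetric] using m by (intro power_increasing) auto
  finally show "(q * (Suc I * (Suc I * Suc I))) ^ 3 * 2 ^ Suc I + 2 < W" using A by linarith
  have "D * Suc I \<le> m ^ D * m ^ 2" using SI le_pow[of D] by (intro mult_mono) auto
  also have "\<dots> = m ^ (D + 2)" by (rule power_add[symmetric])
  also have "\<dots> < m ^ (3 * q + D + 23)" using m by (intro power_strict_increasing) auto
  finally show "D * Suc I < W" by (simp add: W_def m_def)
  have "m ^ 1 \<le> m ^ (3 * q + D + 23)" using m by (intro power_increasing) auto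
  then show "n + 2 \<le> W" by (simp add: W_def m_def)
qed

lemma ceil_log2:
  fixes n :: nat
  obtains I where "n \<le> 2 ^ I" "I = 0 \<or> 2 ^ (I - 1) < n"
proof -
  define I where "I = (LEAST i. n \<le> 2 ^ i)"
  have "n \<le> 2 ^ n" using less_exp[of n] by (rule less_imp_le)
  then have 1: "n \<le> 2 ^ I" unfolding I_def by (rule LeastI)
  have 2: "I = 0 \<or> 2 ^ (I - 1) < n"
  proof (cases I)
    case (Suc j)
    then have "\<not> n \<le> 2 ^ j" using not_less_Least[of j "\<lambda>i. n \<le> 2 ^ i"] by (simp add: I_def)
    then show ?thesis by (simp add: Suc)
  qed simp
  show thesis by (rule that[OF 1 2])
qed

theorem theorem5p10:
  fixes lam phi :: real
  assumes "0 < lam" and "lam < 1" and "0 < phi" and "phi < 1"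
  shows "\<exists>(A :: algorithm) (C :: real) (c :: nat).
    \<forall>(sim :: 'a \<Rightarrow> 'a \<Rightarrow> real) (M :: ('a \<Rightarrow> 'b) measure) (xs :: 'a list).
      lsh_distribution M sim \<and> distinct xs \<longrightarrow>
        solves_self_join A lam phi sim M xs \<and>
        (length xs \<ge> 2 \<longrightarrow>
          (\<forall>\<omega>\<in>space (randomness M). \<forall>t.
             real (working_space A sim xs \<omega> t) \<le> C * log 2 (length xs) ^ c * length xs) \<and>
          expected_time A sim M xs \<le>
            ennreal (C * log 2 (length xs) ^ c *
              (\<Sum>x\<in>set xs. INF k. point_cost lam sim (set xs) x k)))"
proof -
  have "1 < 1 / lam" using assms by simp
  then obtain D where D: "2 < (1 / lam) ^ D" using real_arch_pow by blast
  have D0: "0 < D" using D by (cases D) auto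
  obtain q :: nat where q: "real D / (1 - phi) < q" using reals_Archimedean2 by blast
  have q0: "0 < q" using q assms D0 by (cases q) (auto simp: field_simps)
  have phi: "phi \<le> 1 - real D / q" using q q0 assms by (simp add: field_simps)
  define \<kappa> where "\<kappa> = 3 * q + D + 23"
  \<comment> \<open>Since \<open>K = D * L\<close> and \<open>a3 = (q * L ^ 3) ^ 3\<close>, the
    product \<open>L ^ 2 * K ^ 2 * a3\<close> is \<open>D ^ 2 * q ^ 3 * L ^ 13\<close>; the factor
    \<open>3 ^ 13\<close> comes from \<open>L \<le> 3 * log 2 (length xs)\<close>.\<close>
  define C1 where "C1 = 10000 * real D ^ 2 * real q ^ 3 * 3 ^ 13"
  define C2 where "C2 = real (card program_vars + 1)"
  have C0: "0 \<le> C1" "0 \<le> C2" by (simp_all add: C1_def C2_def)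
  have "solves_self_join (program lam D q, \<kappa>) lam phi sim M xs \<and>
        (length xs \<ge> 2 \<longrightarrow>
          (\<forall>\<omega>\<in>space (randomness M). \<forall>t.
             real (working_space (program lam D q, \<kappa>) sim xs \<omega> t) \<le> (C1 + C2) * log 2 (length xs) ^ 13 * length xs) \<and>
          expected_time (program lam D q, \<kappa>) sim M xs \<le>
            ennreal ((C1 + C2) * log 2 (length xs) ^ 13 *
              (\<Sum>x\<in>set xs. INF k. point_cost lam sim (set xs) x k)))"
    if lsh: "lsh_distribution M sim" and dist: "distinct xs"
    for sim :: "'a \<Rightarrow> 'a \<Rightarrow> real" and M :: "('a \<Rightarrow> 'b) measure" and xs :: "'a list"
  proof -
    obtain I where I: "length xs \<le> 2 ^ I" "I = 0 \<or> 2 ^ (I - 1) < length xs" by (rule ceil_log2)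
    \<comment> \<open>The symmetry that \<open>join_machine\<close> asks for is inherited from the
      collision events.\<close>
    have sym: "sim x y = sim y x" for x y
    proof -
      have c: "measure M {h \<in> space M. h u = h v} = sim u v" for u v
        using lsh by (simp add: lsh_distribution_def)
      have "sim x y = measure M {h \<in> space M. h x = h y}" by (rule c[symmetric])
      also have "{h \<in> space M. h x = h y} = {h \<in> space M. h y = h x}" by auto
      also have "measure M \<dots> = sim y x" by (rule c)
      finally show ?thesis .
    qed
    interpret join_prob "(length xs + 2) ^ \<kappa>" sim xs lam I D q M
      unfolding \<kappa>_def
      by unfold_locales (use word_size_suffices[OF I(2) q0, of D] sym D0 q0 I lsh assms dist D in auto)
    have solves: "solves_self_join (program lam D q, \<kappa>) lam phi sim M xs"
      by (rule program_solves[OF refl phi])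
    show ?thesis
    proof (intro conjI impI ballI allI solves)
      fix \<omega> t assume n: "2 \<le> length xs"
      have l1: "1 \<le> log 2 (length xs)" using n by (subst one_le_log_cancel_iff) auto
      have "working_space (program lam D q, \<kappa>) sim xs \<omega> t \<le> (card program_vars + 1) * length xs"
        using n by (intro working_space_bound program_bounded_writes) (auto simp: program_vars_def \<kappa>_def)
      then have "real (working_space (program lam D q, \<kappa>) sim xs \<omega> t) \<le> real ((card program_vars + 1) * length xs)"
        by (rule of_nat_mono)
      also have "\<dots> = C2 * 1 * length xs" by (simp add: C2_def algebra_simps)
      also have "\<dots> \<le> (C1 + C2) * log 2 (length xs) ^ 13 * length xs"
        using C0 one_le_power[OF l1, of 13] by (intro mult_right_mono mult_mono) auto
      finally show "real (working_space (program lam D q, \<kappa>) sim xs \<omega> t) \<le>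
        (C1 + C2) * log 2 (length xs) ^ 13 * length xs" .
    next
      assume n: "2 \<le> length xs"
      have l1: "1 \<le> log 2 (length xs)" using n by (subst one_le_log_cancel_iff) auto
      let ?S = "\<Sum>x\<in>set xs. INF k. point_cost lam sim (set xs) x k"
      have S: "(\<Sum>x<length xs. F x) = ?S" unfolding F_def by (rule sum_nth_xs)
      have "0 \<le> (\<Sum>x<length xs. F x)"
      proof (rule sum_nonneg)
        fix x assume "x \<in> {..<length xs}"
        then have "x < length xs" by simp
        then show "0 \<le> F x" by (rule F_attained) simp
      qed
      then have S0: "0 \<le> ?S" by (simp add: S)
      \<comment> \<open>In the nontrivial case \<open>L = j + 2\<close> with
        \<open>2 ^ j < length xs\<close>, and the logarithm is at least 1.\<close>
      have L: "real L \<le> 3 * log 2 (length xs)"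
      proof (cases I)
        case 0
        then show ?thesis using I n by simp
      next
        case (Suc j)
        then have "2 ^ j < length xs" using I by simp
        then have "real (2 ^ j) < real (length xs)" by (rule of_nat_less_iff[THEN iffD2])
        then have "2 ^ j < real (length xs)" by (simp only: of_nat_power of_nat_numeral)
        then have "real j < log 2 (length xs)" by (rule less_log_of_power) simp
        then show ?thesis unfolding L_def using l1 Suc by simp
      qed
      have "10000 * real L ^ 2 * real K ^ 2 * real a3 = 10000 * real D ^ 2 * real q ^ 3 * real L ^ 13"
        by (simp add: K_def a3_def a_def power_mult_distrib power2_eq_square power3_eq_cube eval_nat_numeral mult_ac)
      also have "\<dots> \<le> 10000 * real D ^ 2 * real q ^ 3 * (3 * log 2 (length xs)) ^ 13"
        using L by (intro mult_left_mono power_mono) auto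
      also have "\<dots> = C1 * log 2 (length xs) ^ 13" by (simp add: C1_def power_mult_distrib)
      also have "\<dots> \<le> (C1 + C2) * log 2 (length xs) ^ 13" using C0 l1 by (intro mult_right_mono) auto
      finally have "10000 * real L ^ 2 * real K ^ 2 * real a3 * ?S \<le> (C1 + C2) * log 2 (length xs) ^ 13 * ?S"
        using S0 by (rule mult_right_mono)
      then have "ennreal (10000 * real L ^ 2 * real K ^ 2 * real a3 * ?S) \<le> ennreal ((C1 + C2) * log 2 (length xs) ^ 13 * ?S)"
        by (rule ennreal_leI)
      then show "expected_time (program lam D q, \<kappa>) sim M xs \<le> ennreal ((C1 + C2) * log 2 (length xs) ^ 13 * ?S)"
        using expected_time_bound[OF refl n] unfolding S by (rule order_trans[rotated])
    qed
  qed
  then show ?thesis by (intro exI[of _ "(program lam D q, \<kappa>)"] exI[of _ "C1 + C2"] exI[of _ 13]) blast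
qed

end
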